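(* There exists a unique family of rational numbers $\{\phi_T\}_{T\in\mathbb{T}}$ indexed by the (isomorphism classes of) rooted trees such that, for every integer $n\ge 1$ and every system $F=z+H\in\mathbb{C}[[z_1,\ldots,z_n]]^n$ of the form identity plus higher, the D-Log $a$ of $F$ is $$a=\sum_{T\in\mathbb{T}}\phi_T\,\mathcal{P}_T .$$ These numbers satisfy, and are uniquely determined by, the following properties: $\phi_T=1$ when $v(T)=1$, and, when $v(T)\ge 2$, $$\phi_T=-\sum_{k=2}^{v(T)}\frac{1}{k!}\sum_{\substack{\vec e=(e_1,\ldots,e_{k-1})\in E(T)^{k-1}\\ e_1\succ\cdots\succ e_{k-1}}}\phi_{T_{\vec e,1}}\phi_{T_{\vec e,2}}\cdots\phi_{T_{\vec e,k}} .$$ The latter formula can be restated as $$\sum_{k=1}^{v(T)}\frac{1}{k!}\sum_{\substack{\vec e=(e_1,\ldots,e_{k-1})\in E(T)^{k-1}\\ e_1\succ\cdots\succ e_{k-1}}}\phi_{T_{\vec e,1}}\phi_{T_{\vec e,2}}\cdots\phi_{T_{\vec e,k}}=0\qquad(v(T)\ge 2),$$ where the $k=1$ summand is interpreted as $\phi_T$.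
   Context: Trees. A rooted tree is a finite connected acyclic graph with a designated vertex, its root $\mathrm{rt}_T$; isomorphisms preserve roots. $\mathbb{T}$ is the set of isomorphism classes of rooted trees. $V(T),E(T)$ are the vertex and edge sets, $v(T)=|V(T)|$, $\alpha_T=|\mathrm{Aut}(T)|$, and for $v\in V(T)$, $v^+$ is the set of children of $v$ (neighbours of $v$ farther from the root). Cutting edges. For $e\in E(T)$ let $T_e$ be the connected component of $T$ minus the edge $e$ that contains $\mathrm{rt}_T$ (rooted at $\mathrm{rt}_T$), and $T'_e$ the other component, rooted at the endpoint of $e$ farther from $\mathrm{rt}_T$. For $e,f\in E(T)$ write $e\succ f$ if $f\in E(T_e)$. The notation $e_1\succ\cdots\succ e_r$ means $e_i\succ e_j$ for all $i<j$. Such a sequence $\vec e=(e_1,\ldots,e_r)$ determines rooted trees $T_{\vec e,1},\ldots,T_{\vec e,r+1}$: put $S_1=T$ and, for $i=1,\ldots,r$, $T_{\vec e,i}=(S_i)'_{e_i}$, $S_{i+1}=(S_i)_{e_i}$; finally $T_{\vec e,r+1}=S_{r+1}$. Power series of a tree. Let $\mathbb{C}[[z]]=\mathbb{C}[[z_1,\ldots,z_n]]$, $D_i=\partial/\partial z_i$, and $H=(H_1,\ldots,H_n)\in\mathbb{C}[[z]]^n$. For a labeling $f:V(T)\to\{1,\ldots,n\}$ put $P_{T,f}=\prod_{v\in V(T)}\big(\prod_{w\in v^+}D_{f(w)}\big)H_{f(v)}$. Then $P_{T,i}=\sum_{f:\,f(\mathrm{rt}_T)=i}P_{T,f}$, $P_T=(P_{T,1},\ldots,P_{T,n})$,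 $\mathcal{P}_T=\frac{1}{\alpha_T}P_T$. D-Log. $F=(F_1,\ldots,F_n)\in\mathbb{C}[[z]]^n$ is of the form identity plus higher if $F=z+H$ with $z=(z_1,\dots,z_n)$ and each $H_i$ involving only monomials of degree $\ge 2$. The D-Log of such an $F$ is the (known to exist) unique system $a=(a_1,\ldots,a_n)\in\mathbb{C}[[z]]^n$ involving only monomials of degree $\ge 2$ such that, with $A=\sum_{i=1}^n a_iD_i$, one has $\exp(A)\cdot z=F$, where $\exp(A)=\sum_{k\ge 0}A^k/k!$ acts coordinatewise. When each $H_i$ has only monomials of degree $\ge2$, $\mathcal{P}_T$ has only monomials of degree $\ge v(T)+1$, so the infinite sums over $\mathbb{T}$ make sense. *)

theory Defs
  imports Complex_Main "HOL-Library.Multiset" "HOL-Library.FuncSet" "HOL-Library.Groups_Big_Fun"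
begin

section \<open>Formal power series in several commuting variables\<close>

text \<open>
  A monomial in the variables \<open>'v\<close> is a finite multiset of variables: \<open>count m i\<close> is the exponent
  of the \<open>i\<close>-th variable and \<open>size m\<close> the total degree.
\<close>

typedef ('v, 'a) mps = "UNIV :: ('v multiset \<Rightarrow> 'a) set"
  morphisms mps_coeff Abs_mps
  by simp

setup_lifting type_definition_mps

lemma mps_eqI: "(\<And>m. mps_coeff f m = mps_coeff g m) \<Longrightarrow> f = g"
  by transfer auto

lemma finite_submultisets: "finite {a. a \<subseteq># (m :: 'v multiset)}"
proof (rule finite_subset)
  show "{a. a \<subseteq># m} \<subseteq> mset ` {xs. set xs \<subseteq> set_mset m \<and> length xs \<le> size m}"
  proof
    fix a assume "a \<in> {a. a \<subseteq># m}"
    then have a: "a \<subseteq># m" by simp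
    obtain xs where "a = mset xs" by (metis ex_mset)
    moreover from this a have "set xs \<subseteq> set_mset m" "length xs \<le> size m"
      using set_mset_mono[OF a] size_mset_mono[OF a] by auto
    ultimately show "a \<in> mset ` {xs. set xs \<subseteq> set_mset m \<and> length xs \<le> size m}" by blast
  qed
  show "finite (mset ` {xs. set xs \<subseteq> set_mset m \<and> length xs \<le> size m})"
    by (intro finite_imageI finite_lists_length_le) simp
qed

lemma finite_multiset_splittings [simp]: "finite {(a, b). a + b = (m :: 'v multiset)}"
proof (rule finite_subset)
  show "{(a, b). a + b = m} \<subseteq> {a. a \<subseteq># m} \<times> {a. a \<subseteq># m}" by auto
qed (simp add: finite_submultisets)

instantiation mps :: (type, comm_ring_1) comm_ring_1
begin

lift_definition zero_mps :: "('a, 'b) mps" is "\<lambda>_. 0" .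
lift_definition one_mps :: "('a, 'b) mps" is "\<lambda>m. if m = {#} then 1 else 0" .
lift_definition plus_mps :: "('a, 'b) mps \<Rightarrow> ('a, 'b) mps \<Rightarrow> ('a, 'b) mps"
  is "\<lambda>f g m. f m + g m" .
lift_definition minus_mps :: "('a, 'b) mps \<Rightarrow> ('a, 'b) mps \<Rightarrow> ('a, 'b) mps"
  is "\<lambda>f g m. f m - g m" .
lift_definition uminus_mps :: "('a, 'b) mps \<Rightarrow> ('a, 'b) mps"
  is "\<lambda>f m. - f m" .
lift_definition times_mps :: "('a, 'b) mps \<Rightarrow> ('a, 'b) mps \<Rightarrow> ('a, 'b) mps"
  is "\<lambda>f g m. \<Sum>(a, b) | a + b = m. f a * g b" .

instance
proof
  fix f g h :: "('a, 'b) mps"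
  show "f * g * h = f * (g * h)"
  proof (transfer, rule ext)
    fix f g h :: "'a multiset \<Rightarrow> 'b" and m :: "'a multiset"
    let ?L = "SIGMA p:{(a, b). a + b = m}. {(c, d). c + d = fst p}"
    let ?R = "SIGMA p:{(a, b). a + b = m}. {(c, d). c + d = snd p}"
    have "(\<Sum>(a, b) | a + b = m. (\<Sum>(c, d) | c + d = a. f c * g d) * h b)
        = (\<Sum>p\<in>{(a, b). a + b = m}. \<Sum>q\<in>{(c, d). c + d = fst p}. f (fst q) * g (snd q) * h (snd p))"
      by (simp add: case_prod_unfold sum_distrib_right)
    also have "\<dots> = (\<Sum>x\<in>?L. f (fst (snd x)) * g (snd (snd x)) * h (snd (fst x)))"
      by (subst sum.Sigma) (auto simp: case_prod_unfold intro: finite_multiset_splittings[simplified case_prod_unfold])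
    also have "\<dots> = (\<Sum>x\<in>?R. f (fst (fst x)) * (g (fst (snd x)) * h (snd (snd x))))"
      by (rule sum.reindex_bij_witness
          [where i = "\<lambda>((a, b), (c, d)). ((a + c, d), (a, c))"
             and j = "\<lambda>((a, b), (c, d)). ((c, d + b), (d, b))"])
        (auto simp: mult.assoc add.assoc)
    also have "\<dots> = (\<Sum>p\<in>{(a, b). a + b = m}. \<Sum>q\<in>{(c, d). c + d = snd p}. f (fst p) * (g (fst q) * h (snd q)))"
      by (subst sum.Sigma) (auto simp: case_prod_unfold intro: finite_multiset_splittings[simplified case_prod_unfold])
    also have "\<dots> = (\<Sum>(a, b) | a + b = m. f a * (\<Sum>(c, d) | c + d = b. g c * h d))"
      by (simp add: case_prod_unfold sum_distrib_left)
    finally show "(\<Sum>(a, b) | a + b = m. (\<Sum>(c, d) | c + d = a. f c * g d) * h b)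
        = (\<Sum>(a, b) | a + b = m. f a * (\<Sum>(c, d) | c + d = b. g c * h d))" .
  qed
  show "f * g = g * f"
    by (transfer, rule ext, rule sum.reindex_bij_witness[where i = prod.swap and j = prod.swap])
      (auto simp: add.commute mult.commute)
  show "1 * f = f"
  proof (transfer, rule ext)
    fix f :: "'a multiset \<Rightarrow> 'b" and m :: "'a multiset"
    have "(\<Sum>(a, b) | a + b = m. (if a = {#} then 1 else 0) * f b)
        = (\<Sum>(a, b)\<in>{({#} :: 'a multiset, m)}. (if a = {#} then 1 else 0) * f b)"
      by (rule sum.mono_neutral_right) (auto split: if_splits)
    then show "(\<Sum>(a, b) | a + b = m. (if a = {#} then 1 else 0) * f b) = f m" by simp
  qed
  show "(f + g) * h = f * h + g * h"
    by transfer (auto simp: case_prod_unfold distrib_right sum.distrib)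
  show "(0 :: ('a, 'b) mps) \<noteq> 1"
    by transfer (auto simp: fun_eq_iff)
qed (transfer; auto simp: fun_eq_iff algebra_simps)+

end

lift_definition mps_const :: "'a \<Rightarrow> ('v, 'a :: zero) mps"
  is "\<lambda>c m. if m = {#} then c else 0" .

lift_definition mps_var :: "'v \<Rightarrow> ('v, 'a :: zero_neq_one) mps"
  is "\<lambda>i m. if m = {#i#} then 1 else 0" .

lift_definition mps_deriv :: "'v \<Rightarrow> ('v, 'a :: semiring_1) mps \<Rightarrow> ('v, 'a) mps"
  is "\<lambda>i f m. of_nat (count m i + 1) * f (add_mset i m)" .

text \<open>
  Infinite sums are taken coefficientwise and require that every coefficient receives only finitely
  many non-zero contributions (\<^const>\<open>Sum_any\<close> is \<open>0\<close> on functions of infinite support, a case which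
  does not occur for the series considered below).
\<close>

lift_definition mps_sum :: "('i \<Rightarrow> ('v, 'a :: comm_monoid_add) mps) \<Rightarrow> ('v, 'a) mps"
  is "\<lambda>f m. Sum_any (\<lambda>x. f x m)" .

text \<open>Partial derivatives commute, so their composition over a finite set is well defined.\<close>

lemma mps_deriv_commute:
  "mps_deriv i (mps_deriv j f) = mps_deriv j (mps_deriv i (f :: ('v, 'a :: comm_semiring_1) mps))"
proof (cases "i = j")
  case False
  then show ?thesis
    by transfer (auto simp: fun_eq_iff add_mset_commute mult.left_commute)
qed simp

lemma comp_fun_commute_mps_deriv:
  "comp_fun_commute (\<lambda>w. mps_deriv (l w) :: ('v, 'a :: comm_semiring_1) mps \<Rightarrow> _)"
  by unfold_locales (auto simp: fun_eq_iff mps_deriv_commute)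


section \<open>The D-Log\<close>

text \<open>
  The ring of power series in \<open>z\<^sub>1, \<dots>, z\<^sub>n\<close> consists of those elements of \<^typ>\<open>(nat, complex) mps\<close> in
  which only the variables \<open>1, \<dots>, n\<close> occur; in this way \<open>n\<close> may be quantified over inside a formula.
\<close>

definition higher :: "nat \<Rightarrow> (nat, complex) mps set" where
  "higher n = {f. \<forall>m. mps_coeff f m \<noteq> 0 \<longrightarrow> set_mset m \<subseteq> {1..n} \<and> 2 \<le> size m}"

definition vector_field ::
  "nat \<Rightarrow> (nat \<Rightarrow> (nat, complex) mps) \<Rightarrow> (nat, complex) mps \<Rightarrow> (nat, complex) mps" where
  "vector_field n a g = (\<Sum>i=1..n. a i * mps_deriv i g)"

definition exp_operator ::
  "((nat, complex) mps \<Rightarrow> (nat, complex) mps) \<Rightarrow> (nat, complex) mps \<Rightarrow> (nat, complex) mps" where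
  "exp_operator A g = mps_sum (\<lambda>k :: nat. mps_const (1 / fact k) * (A ^^ k) g)"

text \<open>Systems with \<open>n\<close> components are extensional functions on the index set \<open>{1..n}\<close>.\<close>

definition D_Log :: "nat \<Rightarrow> (nat \<Rightarrow> (nat, complex) mps) \<Rightarrow> nat \<Rightarrow> (nat, complex) mps" where
  "D_Log n F = (THE a. a \<in> {1..n} \<rightarrow>\<^sub>E higher n \<and>
     (\<forall>i\<in>{1..n}. exp_operator (vector_field n a) (mps_var i) = F i))"


section \<open>Rooted trees\<close>

record 'a rgraph =
  verts :: "'a set"
  edges :: "'a set set"
  rt :: 'a

definition adj :: "'a set set \<Rightarrow> ('a \<times> 'a) set" where
  "adj E = {(u, v). {u, v} \<in> E}"

definition cycle_in :: "'a set set \<Rightarrow> 'a list \<Rightarrow> bool" where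
  "cycle_in E xs \<longleftrightarrow> 3 \<le> length xs \<and> distinct xs \<and>
     (\<forall>i<length xs. {xs ! i, xs ! (Suc i mod length xs)} \<in> E)"

definition rooted_tree :: "'a rgraph \<Rightarrow> bool" where
  "rooted_tree T \<longleftrightarrow>
     finite (verts T) \<and> rt T \<in> verts T \<and>
     edges T \<subseteq> {{u, v} | u v. u \<in> verts T \<and> v \<in> verts T \<and> u \<noteq> v} \<and>
     (\<forall>u\<in>verts T. \<forall>v\<in>verts T. (u, v) \<in> (adj (edges T))\<^sup>*) \<and>
     (\<nexists>xs. cycle_in (edges T) xs)"

definition is_iso :: "'a rgraph \<Rightarrow> 'b rgraph \<Rightarrow> ('a \<Rightarrow> 'b) \<Rightarrow> bool" where
  "is_iso T T' p \<longleftrightarrow> bij_betw p (verts T) (verts T') \<and>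
     edges T' = (\<lambda>e. p ` e) ` edges T \<and> p (rt T) = rt T'"

definition isomorphic :: "'a rgraph \<Rightarrow> 'b rgraph \<Rightarrow> bool" where
  "isomorphic T T' \<longleftrightarrow> (\<exists>p. is_iso T T' p)"

definition aut :: "'a rgraph \<Rightarrow> ('a \<Rightarrow> 'a) set" where
  "aut T = {p \<in> extensional (verts T). is_iso T T p}"

definition graph_dist :: "'a rgraph \<Rightarrow> 'a \<Rightarrow> 'a \<Rightarrow> nat" where
  "graph_dist T u v = (LEAST k. (u, v) \<in> adj (edges T) ^^ k)"

definition children :: "'a rgraph \<Rightarrow> 'a \<Rightarrow> 'a set" where
  "children T v = {w. {v, w} \<in> edges T \<and> graph_dist T (rt T) v < graph_dist T (rt T) w}"

subsection \<open>Cutting edges\<close>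

definition component :: "'a rgraph \<Rightarrow> 'a set \<Rightarrow> 'a \<Rightarrow> 'a rgraph" where
  "component T e x =
     (let V = {v \<in> verts T. (x, v) \<in> (adj (edges T - {e}))\<^sup>*}
      in \<lparr>verts = V, edges = {f \<in> edges T - {e}. f \<subseteq> V}, rt = x\<rparr>)"

definition far_end :: "'a rgraph \<Rightarrow> 'a set \<Rightarrow> 'a" where
  "far_end T e = (THE w. \<exists>v. e = {v, w} \<and> graph_dist T (rt T) v < graph_dist T (rt T) w)"

text \<open>The trees \<open>T\<^sub>e\<close> and \<open>T'\<^sub>e\<close>; the component not containing the root contains \<open>far_end T e\<close>.\<close>

definition upper_part :: "'a rgraph \<Rightarrow> 'a set \<Rightarrow> 'a rgraph" where
  "upper_part T e = component T e (rt T)"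

definition lower_part :: "'a rgraph \<Rightarrow> 'a set \<Rightarrow> 'a rgraph" where
  "lower_part T e = component T e (far_end T e)"

definition edge_succ :: "'a rgraph \<Rightarrow> 'a set \<Rightarrow> 'a set \<Rightarrow> bool" where
  "edge_succ T e f \<longleftrightarrow> f \<in> edges (upper_part T e)"

definition cut_seqs :: "'a rgraph \<Rightarrow> nat \<Rightarrow> 'a set list set" where
  "cut_seqs T r = {es. length es = r \<and> set es \<subseteq> edges T \<and> sorted_wrt (edge_succ T) es}"

text \<open>\<open>pieces T [e\<^sub>1, \<dots>, e\<^sub>r]\<close> lists the \<open>r + 1\<close> trees into which the sequence cuts \<open>T\<close>.\<close>

fun pieces :: "'a rgraph \<Rightarrow> 'a set list \<Rightarrow> 'a rgraph list" where
  "pieces T [] = [T]"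
| "pieces T (e # es) = lower_part T e # pieces (upper_part T e) es"

subsection \<open>Power series of a tree\<close>

definition label_series ::
  "(nat \<Rightarrow> (nat, complex) mps) \<Rightarrow> 'a rgraph \<Rightarrow> ('a \<Rightarrow> nat) \<Rightarrow> (nat, complex) mps" where
  "label_series H T l =
     (\<Prod>v\<in>verts T. Finite_Set.fold (\<lambda>w. mps_deriv (l w)) (H (l v)) (children T v))"

text \<open>The \<open>i\<close>-th components of \<open>P\<^sub>T\<close> and of \<open>P\<^sub>T / \<alpha>\<^sub>T\<close>.\<close>

definition tree_series ::
  "nat \<Rightarrow> (nat \<Rightarrow> (nat, complex) mps) \<Rightarrow> 'a rgraph \<Rightarrow> nat \<Rightarrow> (nat, complex) mps" where
  "tree_series n H T i =
     (\<Sum>l | l \<in> verts T \<rightarrow>\<^sub>E {1..n} \<and> l (rt T) = i. label_series H T l)"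

definition normalized_tree_series ::
  "nat \<Rightarrow> (nat \<Rightarrow> (nat, complex) mps) \<Rightarrow> 'a rgraph \<Rightarrow> nat \<Rightarrow> (nat, complex) mps" where
  "normalized_tree_series n H T i = mps_const (1 / of_nat (card (aut T))) * tree_series n H T i"

subsection \<open>Isomorphism invariance\<close>

lemma rooted_tree_edge:
  assumes "rooted_tree T" "{u, v} \<in> edges T"
  shows "u \<in> verts T" "v \<in> verts T" "u \<noteq> v"
  using assms unfolding rooted_tree_def by (auto simp: doubleton_eq_iff dest!: subsetD)

lemma rooted_tree_edge_subset: "rooted_tree T \<Longrightarrow> e \<in> edges T \<Longrightarrow> e \<subseteq> verts T"
  unfolding rooted_tree_def by blast

lemma is_iso_edge:
  assumes "rooted_tree T" "is_iso T T' p" "u \<in> verts T" "v \<in> verts T"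
  shows "{p u, p v} \<in> edges T' \<longleftrightarrow> {u, v} \<in> edges T"
proof
  assume "{p u, p v} \<in> edges T'"
  then obtain e where e: "e \<in> edges T" "p ` e = p ` {u, v}"
    using assms(2) unfolding is_iso_def by auto
  moreover have "inj_on p (verts T)"
    using assms(2) unfolding is_iso_def bij_betw_def by blast
  ultimately have "e = {u, v}"
    using assms rooted_tree_edge_subset[of T e] by (subst (asm) inj_on_image_eq_iff) auto
  with e show "{u, v} \<in> edges T" by simp
next
  assume "{u, v} \<in> edges T"
  then have "p ` {u, v} \<in> edges T'"
    using assms(2) unfolding is_iso_def by blast
  then show "{p u, p v} \<in> edges T'" by simp
qed

lemma isomorphic_refl: "isomorphic T T"
  unfolding isomorphic_def is_iso_def by (rule exI[of _ id]) auto

lemma is_iso_comp: "is_iso T T' p \<Longrightarrow> is_iso T' T'' q \<Longrightarrow> is_iso T T'' (q \<circ> p)"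
  unfolding is_iso_def by (auto intro: bij_betw_trans simp: image_comp image_image)

lemma is_iso_inv:
  assumes "rooted_tree T" "is_iso T T' p"
  shows "is_iso T' T (inv_into (verts T) p)"
proof -
  have inj: "inj_on p (verts T)" and b: "bij_betw p (verts T) (verts T')"
    using assms(2) unfolding is_iso_def bij_betw_def by auto
  have "inv_into (verts T) p ` p ` e = e" if "e \<in> edges T" for e
    using inj rooted_tree_edge_subset[OF assms(1) that] by simp
  then have "edges T = (\<lambda>e. inv_into (verts T) p ` e) ` edges T'"
    using assms(2) unfolding is_iso_def by (simp add: image_image)
  moreover have "inv_into (verts T) p (rt T') = rt T"
    using assms inj unfolding is_iso_def rooted_tree_def by (metis inv_into_f_f)
  ultimately show ?thesis
    using bij_betw_inv_into[OF b] unfolding is_iso_def by blast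
qed

lemma is_iso_relpow:
  assumes "rooted_tree T" "rooted_tree T'" "is_iso T T' p" "u \<in> verts T" "v \<in> verts T"
  shows "(p u, p v) \<in> adj (edges T') ^^ k \<longleftrightarrow> (u, v) \<in> adj (edges T) ^^ k"
  using assms(5)
proof (induction k arbitrary: v)
  case 0
  have "inj_on p (verts T)" using assms(3) unfolding is_iso_def bij_betw_def by blast
  then show ?case using 0 assms(4) by (auto dest: inj_onD)
next
  case (Suc k)
  have im: "verts T' = p ` verts T" using assms(3) unfolding is_iso_def bij_betw_def by auto
  show ?case
  proof
    assume "(p u, p v) \<in> adj (edges T') ^^ Suc k"
    then obtain y where y: "(p u, y) \<in> adj (edges T') ^^ k" "{y, p v} \<in> edges T'"
      by (auto simp: adj_def)
    then obtain x where x: "x \<in> verts T" "y = p x"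
      using rooted_tree_edge[OF assms(2)] im by blast
    then show "(u, v) \<in> adj (edges T) ^^ Suc k"
      using y Suc is_iso_edge[OF assms(1,3) x(1) Suc.prems] by (auto simp: adj_def)
  next
    assume "(u, v) \<in> adj (edges T) ^^ Suc k"
    then obtain x where x: "(u, x) \<in> adj (edges T) ^^ k" "{x, v} \<in> edges T"
      by (auto simp: adj_def)
    moreover have "x \<in> verts T" using rooted_tree_edge[OF assms(1) x(2)] by blast
    ultimately show "(p u, p v) \<in> adj (edges T') ^^ Suc k"
      using Suc is_iso_edge[OF assms(1,3), of x v] by (auto simp: adj_def)
  qed
qed

lemma is_iso_children:
  assumes T: "rooted_tree T" "rooted_tree T'" "is_iso T T' p" and v: "v \<in> verts T"
  shows "children T' (p v) = p ` children T v"
proof -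
  have im: "verts T' = p ` verts T" and r: "p (rt T) = rt T'" "rt T \<in> verts T"
    using T unfolding is_iso_def bij_betw_def rooted_tree_def by auto
  have d: "graph_dist T' (rt T') (p x) = graph_dist T (rt T) x" if "x \<in> verts T" for x
    using is_iso_relpow[OF T r(2) that] unfolding graph_dist_def r(1) by simp
  show ?thesis
  proof (intro equalityI subsetI)
    fix y assume y: "y \<in> children T' (p v)"
    then have "y \<in> verts T'" using rooted_tree_edge[OF T(2)] unfolding children_def by blast
    then obtain x where x: "x \<in> verts T" "y = p x" using im by auto
    then show "y \<in> p ` children T v"
      using y v d is_iso_edge[OF T(1,3) v x(1)] unfolding children_def by auto
  next
    fix y assume "y \<in> p ` children T v"
    then obtain x where x: "x \<in> children T v" "y = p x" by auto
    then have "x \<in> verts T" using rooted_tree_edge[OF T(1)] unfolding children_def by blast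
    then show "y \<in> children T' (p v)"
      using x v d is_iso_edge[OF T(1,3) v, of x] unfolding children_def by auto
  qed
qed

lemma children_subset: "rooted_tree T \<Longrightarrow> children T v \<subseteq> verts T"
  using rooted_tree_edge unfolding children_def by fastforce

lemma is_iso_label_series:
  assumes T: "rooted_tree T" "rooted_tree T'" "is_iso T T' p"
    and l: "\<And>v. v \<in> verts T \<Longrightarrow> l v = l' (p v)"
  shows "label_series H T l = label_series H T' l'"
proof -
  have inj: "inj_on p (verts T)" and b: "bij_betw p (verts T) (verts T')"
    using T(3) unfolding is_iso_def bij_betw_def by auto
  have eq: "Finite_Set.fold (\<lambda>w. mps_deriv (l w)) (H (l v)) (children T v)
      = Finite_Set.fold (\<lambda>w. mps_deriv (l' w)) (H (l' (p v))) (children T' (p v))" (is "?L = ?R")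
    if v: "v \<in> verts T" for v
  proof -
    have sub: "children T v \<subseteq> verts T" by (rule children_subset[OF T(1)])
    have "?R = Finite_Set.fold (\<lambda>w. mps_deriv (l' w)) (H (l' (p v))) (p ` children T v)"
      by (simp only: is_iso_children[OF T v])
    also have "\<dots> = Finite_Set.fold ((\<lambda>w. mps_deriv (l' w)) \<circ> p) (H (l' (p v))) (children T v)"
      by (rule fold_image[OF inj_on_subset[OF inj sub]])
    also have "\<dots> = ?L"
    proof (rule Finite_Set.fold_cong[where S = UNIV])
      show "comp_fun_commute_on UNIV ((\<lambda>w. mps_deriv (l' w) :: (nat, complex) mps \<Rightarrow> _) \<circ> p)"
        unfolding comp_def comp_fun_commute_def'[symmetric] by (rule comp_fun_commute_mps_deriv)
      show "comp_fun_commute_on UNIV (\<lambda>w. mps_deriv (l w) :: (nat, complex) mps \<Rightarrow> _)"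
        unfolding comp_fun_commute_def'[symmetric] by (rule comp_fun_commute_mps_deriv)
      show "finite (children T v)"
        using sub T(1) finite_subset unfolding rooted_tree_def by blast
    qed (use l v sub in \<open>auto simp: subset_eq\<close>)
    finally show ?thesis by simp
  qed
  show ?thesis
    unfolding label_series_def
    by (rule prod.reindex_bij_betw[OF b, symmetric, THEN ssubst]) (simp add: eq cong: prod.cong)
qed

lemma is_iso_tree_series:
  assumes T: "rooted_tree T" "rooted_tree T'" "is_iso T T' p"
  shows "tree_series n H T i = tree_series n H T' i"
proof -
  have inj: "inj_on p (verts T)" and im: "p ` verts T = verts T'"
    and r: "rt T' = p (rt T)" "rt T \<in> verts T"
    using T unfolding is_iso_def bij_betw_def rooted_tree_def by auto
  let ?q = "inv_into (verts T) p"
  have q: "?q (p v) = v" if "v \<in> verts T" for v using inj that by simp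
  have q': "p (?q v) = v" "?q v \<in> verts T" if "v \<in> verts T'" for v
    using that im by (auto simp: f_inv_into_f inv_into_into)
  have p: "p v \<in> verts T'" if "v \<in> verts T" for v using that im by auto
  show ?thesis
    unfolding tree_series_def
  proof (rule sum.reindex_bij_witness[where i = "\<lambda>l. restrict (l \<circ> p) (verts T)"
        and j = "\<lambda>l. restrict (l \<circ> ?q) (verts T')"], goal_cases)
    case (1 l)
    then have "l \<in> extensional (verts T)" by (simp add: PiE_def)
    then show ?case by (intro extensionalityI[where A = "verts T"]) (simp_all add: q p)
  next
    case (2 l)
    then have "l \<in> verts T \<rightarrow> {1..n}" "l (rt T) = i" by (auto simp: PiE_def)
    then show ?case using q' q p r by (auto simp: Pi_def)
  next
    case (3 l)
    then have "l \<in> extensional (verts T')" by (simp add: PiE_def)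
    then show ?case by (intro extensionalityI[where A = "verts T'"]) (simp_all add: q')
  next
    case (4 l)
    then have "l \<in> verts T' \<rightarrow> {1..n}" "l (rt T') = i" by (auto simp: PiE_def)
    then show ?case using p r by (auto simp: Pi_def)
  next
    case (5 l)
    then show ?case
      by (intro is_iso_label_series[OF T, symmetric]) (auto simp: p q)
  qed
qed

lemma is_iso_cong: "(\<And>v. v \<in> verts T \<Longrightarrow> p v = q v) \<Longrightarrow> rooted_tree T \<Longrightarrow> is_iso T T' p \<Longrightarrow> is_iso T T' q"
  unfolding is_iso_def
proof (elim conjE, intro conjI)
  assume eq: "\<And>v. v \<in> verts T \<Longrightarrow> p v = q v" and T: "rooted_tree T"
  show "bij_betw q (verts T) (verts T')" if "bij_betw p (verts T) (verts T')"
    using that eq bij_betw_cong by metis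
  have "p ` e = q ` e" if "e \<in> edges T" for e
    using rooted_tree_edge_subset[OF T that] eq by (intro image_cong) auto
  then show "edges T' = (`) q ` edges T" if "edges T' = (`) p ` edges T"
    using that by (simp cong: image_cong)
  show "q (rt T) = rt T'" if "p (rt T) = rt T'"
    using that eq T unfolding rooted_tree_def by metis
qed

lemma is_iso_card_aut:
  assumes T: "rooted_tree T" "rooted_tree T'" "is_iso T T' p"
  shows "card (aut T) = card (aut T')"
proof -
  have inj: "inj_on p (verts T)" and im: "p ` verts T = verts T'"
    using T unfolding is_iso_def bij_betw_def by auto
  let ?q = "inv_into (verts T) p"
  have iq: "is_iso T' T ?q" by (rule is_iso_inv[OF T(1,3)])
  have q: "?q (p v) = v" if "v \<in> verts T" for v using inj that by simp
  have q': "p (?q v) = v" "?q v \<in> verts T" if "v \<in> verts T'" for v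
    using that im by (auto simp: f_inv_into_f inv_into_into)
  have p: "p v \<in> verts T'" if "v \<in> verts T" for v using that im by auto
  have mem: "s v \<in> verts S" if "is_iso S S s" "v \<in> verts S" for s v and S :: "'c rgraph"
    using that unfolding is_iso_def bij_betw_def by auto
  have A: "restrict (p \<circ> s \<circ> ?q) (verts T') \<in> aut T'" if "s \<in> aut T" for s
  proof -
    have "is_iso T' T' (p \<circ> s \<circ> ?q)"
      using is_iso_comp[OF is_iso_comp[OF iq] T(3)] that by (auto simp: aut_def comp_assoc)
    then show ?thesis
      unfolding aut_def by (auto intro: is_iso_cong[OF _ T(2), rotated])
  qed
  have B: "restrict (?q \<circ> s \<circ> p) (verts T) \<in> aut T" if "s \<in> aut T'" for s
  proof -
    have "is_iso T T (?q \<circ> s \<circ> p)"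
      using is_iso_comp[OF is_iso_comp[OF T(3)] iq] that by (auto simp: aut_def comp_assoc)
    then show ?thesis
      unfolding aut_def by (auto intro: is_iso_cong[OF _ T(1), rotated])
  qed
  have "bij_betw (\<lambda>s. restrict (p \<circ> s \<circ> ?q) (verts T')) (aut T) (aut T')"
  proof (rule bij_betwI[where g = "\<lambda>s. restrict (?q \<circ> s \<circ> p) (verts T)"])
    show "(\<lambda>s. restrict (p \<circ> s \<circ> ?q) (verts T')) \<in> aut T \<rightarrow> aut T'" using A by blast
    show "(\<lambda>s. restrict (?q \<circ> s \<circ> p) (verts T)) \<in> aut T' \<rightarrow> aut T" using B by blast
    show "restrict (?q \<circ> restrict (p \<circ> s \<circ> ?q) (verts T') \<circ> p) (verts T) = s" if "s \<in> aut T" for s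
      using that mem[of T s] by (auto simp: fun_eq_iff q p aut_def extensional_def)
    show "restrict (p \<circ> restrict (?q \<circ> s \<circ> p) (verts T) \<circ> ?q) (verts T') = s" if "s \<in> aut T'" for s
      using that mem[of T' s] by (auto simp: fun_eq_iff q' aut_def extensional_def)
  qed
  then show ?thesis by (rule bij_betw_same_card)
qed

lemma normalized_tree_series_cong:
  assumes "rooted_tree T" "rooted_tree T'" "isomorphic T T'"
  shows "normalized_tree_series n H T = normalized_tree_series n H T'"
proof -
  from assms obtain p where "is_iso T T' p" unfolding isomorphic_def by blast
  then show ?thesis
    using is_iso_tree_series[OF assms(1,2)] is_iso_card_aut[OF assms(1,2)]
    unfolding normalized_tree_series_def by (intro ext) simp
qed

subsection \<open>Isomorphism classes\<close>

text \<open>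
  Every finite rooted tree is isomorphic to one with vertices in \<^typ>\<open>nat\<close>. The abstraction function
  \<open>tree_class\<close> is meaningful only on graphs satisfying \<^const>\<open>rooted_tree\<close>.
\<close>

quotient_type tree = "nat rgraph" / partial: "\<lambda>T T'. rooted_tree T \<and> rooted_tree T' \<and> isomorphic T T'"
  morphisms rep_tree tree_class
proof (rule part_equivpI)
  have "rooted_tree \<lparr>verts = {0 :: nat}, edges = {}, rt = 0\<rparr>"
    unfolding rooted_tree_def
  proof (intro conjI)
    have "\<not> cycle_in {} xs" for xs :: "nat list"
      unfolding cycle_in_def by (cases xs) auto
    then show "\<nexists>xs. cycle_in (edges \<lparr>verts = {0 :: nat}, edges = {}, rt = 0\<rparr>) xs" by simp
  qed simp_all
  then show "\<exists>T :: nat rgraph. rooted_tree T \<and> rooted_tree T \<and> isomorphic T T"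
    using isomorphic_refl by blast
  show "symp (\<lambda>T T' :: nat rgraph. rooted_tree T \<and> rooted_tree T' \<and> isomorphic T T')"
    by (rule sympI) (meson is_iso_inv isomorphic_def)
  show "transp (\<lambda>T T' :: nat rgraph. rooted_tree T \<and> rooted_tree T' \<and> isomorphic T T')"
    by (rule transpI) (meson is_iso_comp isomorphic_def)
qed

lift_definition tree_P :: "nat \<Rightarrow> (nat \<Rightarrow> (nat, complex) mps) \<Rightarrow> tree \<Rightarrow> nat \<Rightarrow> (nat, complex) mps"
  is normalized_tree_series
  by (simp add: normalized_tree_series_cong)

section \<open>The two characterizations of the coefficients\<close>

definition represents_D_Log :: "(tree \<Rightarrow> rat) \<Rightarrow> bool" where
  "represents_D_Log \<phi> \<longleftrightarrow>
     (\<forall>n\<ge>1. \<forall>H \<in> {1..n} \<rightarrow> higher n. \<forall>i\<in>{1..n}.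
        D_Log n (\<lambda>j. mps_var j + H j) i = mps_sum (\<lambda>t. mps_const (of_rat (\<phi> t)) * tree_P n H t i))"

text \<open>The \<open>k\<close>-th summand of the recursion; for \<open>k = 1\<close> the only sequence is empty and the summand is
  \<open>\<phi> (tree_class T)\<close>.\<close>

definition cut_term :: "(tree \<Rightarrow> rat) \<Rightarrow> nat rgraph \<Rightarrow> nat \<Rightarrow> rat" where
  "cut_term \<phi> T k =
     1 / fact k * (\<Sum>es\<in>cut_seqs T (k - 1). prod_list (map (\<lambda>S. \<phi> (tree_class S)) (pieces T es)))"

definition satisfies_recursion :: "(tree \<Rightarrow> rat) \<Rightarrow> bool" where
  "satisfies_recursion \<phi> \<longleftrightarrow>
     (\<forall>T. rooted_tree T \<and> card (verts T) = 1 \<longrightarrow> \<phi> (tree_class T) = 1) \<and>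
     (\<forall>T. rooted_tree T \<and> 2 \<le> card (verts T) \<longrightarrow>
        \<phi> (tree_class T) = - (\<Sum>k=2..card (verts T). cut_term \<phi> T k))"

end

theory Submission
  imports Defs "HOL-Library.Transitive_Closure_Table"
begin

text \<open>
  Write \<open>a(\<psi>) = \<Sum>\<^sub>T \<psi>\<^sub>T \<P>\<^sub>T\<close> for a function \<open>\<psi>\<close> of isomorphism classes of trees. By the
  Leibniz rule, applying the vector field with coefficients \<open>P\<^sub>S\<close> to \<open>P\<^sub>T\<close> produces the sum of \<open>P\<^sub>U\<close> over
  all trees \<open>U\<close> obtained by joining the root of \<open>S\<close> to a vertex of \<open>T\<close> (\<open>sum_tree_series_graft\<close>). Grafting
  is inverse to cutting an edge (\<open>cut_edge\<close>, \<open>upper_part_graft\<close>, \<open>lower_part_graft\<close>), so the vector field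
  of \<open>a(\<phi>)\<close> maps \<open>a(\<psi>)\<close> to \<open>a(\<phi> \<star> \<psi>)\<close>, where \<open>(\<phi> \<star> \<psi>)(U)\<close> sums \<open>\<phi>(U'\<^sub>e) \<psi>(U\<^sub>e)\<close> over the edges \<open>e\<close> of \<open>U\<close>
  (\<open>vector_field_tree_sum\<close>). The symmetry factors \<open>1 / \<alpha>\<^sub>T\<close> are handled by replacing sums over
  isomorphism classes by sums over all trees with vertex set \<open>{0, \<dots>, m - 1}\<close>, divided by \<open>m!\<close>: each
  class has \<open>m! / \<alpha>\<^sub>T\<close> labelled copies (\<open>card_labelled_copies\<close>), and \<open>1 / m!\<close> is what makes products of
  such sums convolve without further factors (\<open>size_part_cut_conv\<close>).

  Iterating, the \<open>(k + 1)\<close>-st power of the vector field of \<open>a(\<phi>)\<close> maps \<open>z\<close> to \<open>a(c\<^sub>k)\<close>, where \<open>c\<^sub>k(T)\<close> is the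
  sum over the descending edge sequences of length \<open>k\<close> in the recursion (\<open>cut_sum_Suc\<close>,
  \<open>iterate_tree_sum\<close>). Hence \<open>exp(A) z = z + a(\<Sum>\<^sub>k c\<^sub>k / (k + 1)!)\<close>, and the recursion states that this
  weight is \<open>1\<close> on the one-vertex tree and \<open>0\<close> on all others, so that \<open>exp(A) z = z + H\<close>
  (\<open>exp_tree_sum\<close>). As \<open>exp\<close> is injective on vector fields of order at least \<open>2\<close> (\<open>exp_operator_inj\<close>),
  \<open>a(\<phi>)\<close> is the D-Log. The recursion expresses \<open>\<phi>\<^sub>T\<close> by smaller trees, so it has exactly one solution.

  Conversely a family that represents all D-Logs is unique, because for every tree \<open>T\<close> there are a system
  \<open>H\<close> and a monomial whose coefficient in \<open>\<P>\<^sub>U\<close> vanishes exactly when \<open>U\<close> is not isomorphic to \<open>T\<close>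
  (\<open>coeff_tree_series_detector_nonzero\<close>, \<open>coeff_tree_series_detector_zero\<close>). It therefore coincides
  with the solution of the recursion.
\<close>


section \<open>Coefficients, derivatives and orders of power series\<close>

lemma mps_coeff_simps [simp]:
  "mps_coeff 0 m = 0"
  "mps_coeff (f + g) m = mps_coeff f m + mps_coeff g m"
  "mps_coeff (f - g) m = mps_coeff f m - mps_coeff g m"
  "mps_coeff (- f) m = - mps_coeff f m"
  by (transfer; simp)+

lemma mps_coeff_times:
  "mps_coeff (f * g) m = (\<Sum>(a, b) | a + b = m. mps_coeff f a * mps_coeff g b)"
  by transfer simp

lemma mps_coeff_one: "mps_coeff 1 m = (if m = {#} then 1 else 0)"
  by transfer simp

lemma mps_coeff_var: "mps_coeff (mps_var i) m = (if m = {#i#} then 1 else 0)"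
  by transfer simp

lemma mps_coeff_deriv:
  "mps_coeff (mps_deriv i f) m = of_nat (count m i + 1) * mps_coeff f (add_mset i m)"
  by transfer simp

lemma mps_coeff_mps_sum: "mps_coeff (mps_sum f) m = Sum_any (\<lambda>x. mps_coeff (f x) m)"
  by transfer simp

lemma mps_coeff_sum: "mps_coeff (sum f A) m = (\<Sum>x\<in>A. mps_coeff (f x) m)"
  by (induction A rule: infinite_finite_induct) auto

lemma mps_coeff_const_times [simp]:
  fixes f :: "('v, 'a :: comm_ring_1) mps"
  shows "mps_coeff (mps_const c * f) m = c * mps_coeff f m"
proof -
  have "mps_coeff (mps_const c * f) m
      = (\<Sum>(a, b) | a + b = m. (if a = {#} then c else 0) * mps_coeff f b)"
    unfolding mps_coeff_times by (simp add: mps_const.rep_eq)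
  also have "\<dots> = (\<Sum>(a, b)\<in>{({#} :: 'v multiset, m)}. (if a = {#} then c else 0) * mps_coeff f b)"
    by (rule sum.mono_neutral_right) (auto split: if_splits)
  finally show ?thesis by simp
qed

lemma mps_const_simps:
  "mps_const 0 * f = 0"
  "mps_const 1 * f = f"
  "mps_const a * (mps_const b * f) = mps_const (a * b) * f"
  by (rule mps_eqI; simp add: mult.assoc)+

lemma mps_const_sum_left: "(\<Sum>x\<in>A. mps_const (c x) * f) = mps_const (\<Sum>x\<in>A. c x) * f"
  by (rule mps_eqI) (simp add: mps_coeff_sum sum_distrib_right)

lemma mps_deriv_diff: "mps_deriv i (f - g) = mps_deriv i f - mps_deriv i (g :: ('v, 'a :: comm_ring_1) mps)"
  by (rule mps_eqI) (simp add: mps_coeff_deriv algebra_simps)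

lemma mps_deriv_sum:
  "mps_deriv i (\<Sum>x\<in>A. f x) = (\<Sum>x\<in>A. mps_deriv i (f x :: ('v, 'a :: comm_ring_1) mps))"
  by (rule mps_eqI) (simp add: mps_coeff_deriv mps_coeff_sum sum_distrib_left)

lemma mps_deriv_const_times:
  "mps_deriv i (mps_const c * f) = mps_const c * mps_deriv i (f :: ('v, 'a :: comm_ring_1) mps)"
  by (rule mps_eqI) (simp add: mps_coeff_deriv mult.left_commute)

lemma mps_deriv_var:
  "mps_deriv j (mps_var i :: ('v, 'a :: comm_ring_1) mps) = (if i = j then 1 else 0)"
  by (rule mps_eqI) (auto simp: mps_coeff_deriv mps_coeff_var mps_coeff_one)

lemma mps_deriv_one: "mps_deriv i (1 :: ('v, 'a :: comm_ring_1) mps) = 0"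
  by (rule mps_eqI) (simp add: mps_coeff_deriv mps_coeff_one)

text \<open>The weight \<open>count a i\<close> discards the splittings in which \<open>i\<close> does not occur in \<open>a\<close>; in the others one
  copy of \<open>i\<close> can be taken off. This reindexing matches one half of the Leibniz rule.\<close>

lemma sum_splittings_weighted_by_count:
  fixes F :: "'v multiset \<Rightarrow> 'v multiset \<Rightarrow> 'a :: comm_ring_1"
  shows "(\<Sum>(a, b) | a + b = add_mset i m. of_nat (count a i) * F a b)
    = (\<Sum>(a, b) | a + b = m. of_nat (count a i + 1) * F (add_mset i a) b)"
proof -
  let ?S = "{(a, b). a + b = add_mset i m}"
  have "(\<Sum>(a, b)\<in>?S. of_nat (count a i) * F a b)
      = (\<Sum>(a, b)\<in>{(a, b). a + b = add_mset i m \<and> i \<in># a}. of_nat (count a i) * F a b)"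
    by (rule sum.mono_neutral_right) (auto, metis mult_zero_left not_in_iff of_nat_0)
  also have "\<dots> = (\<Sum>(a, b) | a + b = m. of_nat (count a i + 1) * F (add_mset i a) b)"
    by (rule sum.reindex_bij_witness[where i = "\<lambda>(a, b). (add_mset i a, b)"
          and j = "\<lambda>(a, b). (a - {#i#}, b)"])
      (auto simp: insert_DiffM diff_union_single_conv)
  finally show ?thesis .
qed

text \<open>The exponent of \<open>i\<close> in a product of monomials is the sum of the two exponents.\<close>

lemma mps_deriv_mult:
  fixes f g :: "('v, 'a :: comm_ring_1) mps"
  shows "mps_deriv i (f * g) = mps_deriv i f * g + f * mps_deriv i g"
proof (rule mps_eqI)
  fix m :: "'v multiset"
  let ?S = "{(a, b). a + b = add_mset i m}" and ?R = "{(a, b). a + b = m}"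
  let ?F = "\<lambda>a b. mps_coeff f a * mps_coeff g b"
  have swap: "(\<Sum>(a, b) | a + b = k. G a b) = (\<Sum>(a, b) | a + b = k. G b a)"
    for k :: "'v multiset" and G :: "_ \<Rightarrow> _ \<Rightarrow> 'a"
    by (rule sum.reindex_bij_witness[where i = prod.swap and j = prod.swap]) (auto simp: add.commute)
  have cnt: "count m i + 1 = count a i + count b i" if "a + b = add_mset i m" for a b
    using arg_cong[OF that, of "\<lambda>x. count x i"] by simp
  have "mps_coeff (mps_deriv i (f * g)) m = (\<Sum>(a, b)\<in>?S. of_nat (count m i + 1) * ?F a b)"
    unfolding mps_coeff_deriv mps_coeff_times sum_distrib_left by (simp add: case_prod_unfold)
  also have "\<dots> = (\<Sum>(a, b)\<in>?S. of_nat (count a i) * ?F a b + of_nat (count b i) * ?F a b)"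
  proof (rule sum.cong[OF refl], clarify)
    fix a b assume "a + b = add_mset i m"
    then show "of_nat (count m i + 1) * ?F a b
        = of_nat (count a i) * ?F a b + of_nat (count b i) * ?F a b"
      by (simp only: cnt of_nat_add distrib_right)
  qed
  also have "\<dots> = (\<Sum>(a, b)\<in>?S. of_nat (count a i) * ?F a b) + (\<Sum>(a, b)\<in>?S. of_nat (count b i) * ?F a b)"
    by (simp add: case_prod_unfold sum.distrib)
  also have "(\<Sum>(a, b)\<in>?S. of_nat (count b i) * ?F a b) = (\<Sum>(a, b)\<in>?S. of_nat (count a i) * ?F b a)"
    by (rule swap)
  also have "\<dots> = (\<Sum>(a, b)\<in>?R. of_nat (count a i + 1) * ?F b (add_mset i a))"
    by (rule sum_splittings_weighted_by_count)
  also have "\<dots> = (\<Sum>(a, b)\<in>?R. of_nat (count b i + 1) * ?F a (add_mset i b))"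
    by (rule swap)
  also have "\<dots> = mps_coeff (f * mps_deriv i g) m"
    unfolding mps_coeff_times mps_coeff_deriv by (simp add: case_prod_unfold algebra_simps)
  also have "(\<Sum>(a, b)\<in>?S. of_nat (count a i) * ?F a b)
      = (\<Sum>(a, b)\<in>?R. of_nat (count a i + 1) * ?F (add_mset i a) b)"
    by (rule sum_splittings_weighted_by_count)
  also have "\<dots> = mps_coeff (mps_deriv i f * g) m"
    unfolding mps_coeff_times mps_coeff_deriv by (simp add: case_prod_unfold algebra_simps)
  finally show "mps_coeff (mps_deriv i (f * g)) m = mps_coeff (mps_deriv i f * g + f * mps_deriv i g) m"
    by simp
qed

lemma mps_deriv_prod:
  fixes f :: "'b \<Rightarrow> ('v, 'a :: comm_ring_1) mps"
  assumes "finite A"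
  shows "mps_deriv i (\<Prod>x\<in>A. f x) = (\<Sum>x\<in>A. mps_deriv i (f x) * (\<Prod>y\<in>A - {x}. f y))"
  using assms
proof (induction A)
  case (insert x A)
  have "(\<Prod>y\<in>insert x A - {z}. f y) = f x * (\<Prod>y\<in>A - {z}. f y)" if "z \<in> A" for z
  proof -
    have "insert x A - {z} = insert x (A - {z})" using insert that by auto
    then show ?thesis using insert by simp
  qed
  then show ?case
    using insert by (simp add: mps_deriv_mult sum_distrib_left algebra_simps)
qed (simp add: mps_deriv_one)


text \<open>Convergence of the infinite sums below is controlled by the order, the least total degree of an
  occurring monomial.\<close>

definition order_ge :: "nat \<Rightarrow> ('v, 'a :: comm_ring_1) mps \<Rightarrow> bool" where
  "order_ge d f \<longleftrightarrow> (\<forall>m. size m < d \<longrightarrow> mps_coeff f m = 0)"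

definition in_vars :: "'v set \<Rightarrow> ('v, 'a :: comm_ring_1) mps \<Rightarrow> bool" where
  "in_vars X f \<longleftrightarrow> (\<forall>m. mps_coeff f m \<noteq> 0 \<longrightarrow> set_mset m \<subseteq> X)"

lemma higher_iff: "f \<in> higher n \<longleftrightarrow> in_vars {1..n} f \<and> order_ge 2 f"
  unfolding higher_def in_vars_def order_ge_def by (auto simp: not_less)

lemma order_ge_mono: "order_ge d f \<Longrightarrow> d' \<le> d \<Longrightarrow> order_ge d' f"
  unfolding order_ge_def by auto

lemma order_ge_0 [simp]: "order_ge 0 f" "order_ge d 0"
  unfolding order_ge_def by auto

lemma order_ge_var: "order_ge 1 (mps_var i)"
  unfolding order_ge_def by (auto simp: mps_coeff_var)

lemma order_ge_linear:
  "order_ge d f \<Longrightarrow> order_ge d g \<Longrightarrow> order_ge d (f + g)"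
  "order_ge d f \<Longrightarrow> order_ge d g \<Longrightarrow> order_ge d (f - g)"
  "order_ge d f \<Longrightarrow> order_ge d (mps_const c * f)"
  unfolding order_ge_def by auto

lemma order_ge_sum: "(\<And>x. x \<in> A \<Longrightarrow> order_ge d (f x)) \<Longrightarrow> order_ge d (sum f A)"
  unfolding order_ge_def by (auto simp: mps_coeff_sum)

lemma order_ge_mult:
  assumes "order_ge d f" "order_ge e g"
  shows "order_ge (d + e) (f * g)"
  unfolding order_ge_def
proof (intro allI impI)
  fix m :: "'a multiset" assume "size m < d + e"
  then have "size a < d \<or> size b < e" if "a + b = m" for a b
    using that by (metis add_mono not_less size_union)
  then show "mps_coeff (f * g) m = 0"
    using assms unfolding mps_coeff_times order_ge_def by (intro sum.neutral) fastforce
qed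

lemma order_ge_deriv: "order_ge d f \<Longrightarrow> order_ge (d - 1) (mps_deriv i f)"
  unfolding order_ge_def by (auto simp: mps_coeff_deriv)

lemma order_ge_prod:
  assumes "\<And>x. x \<in> A \<Longrightarrow> order_ge (d x) (f x)"
  shows "order_ge (\<Sum>x\<in>A. d x) (\<Prod>x\<in>A. f x)"
  using assms by (induction A rule: infinite_finite_induct) (auto intro: order_ge_mult)

lemma in_vars_zero_one [simp]: "in_vars X 0" "in_vars X 1"
  unfolding in_vars_def by (auto simp: mps_coeff_one)

lemma in_vars_const_times: "in_vars X f \<Longrightarrow> in_vars X (mps_const c * f)"
  unfolding in_vars_def by (metis mps_coeff_const_times mult_zero_right)

lemma in_vars_sum:
  assumes "\<And>x. x \<in> A \<Longrightarrow> in_vars X (f x)"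
  shows "in_vars X (sum f A)"
  unfolding in_vars_def mps_coeff_sum
proof (intro allI impI)
  fix m assume "(\<Sum>x\<in>A. mps_coeff (f x) m) \<noteq> 0"
  then obtain x where "x \<in> A" "mps_coeff (f x) m \<noteq> 0" by (rule sum.not_neutral_contains_not_neutral)
  then show "set_mset m \<subseteq> X" using assms unfolding in_vars_def by blast
qed

lemma in_vars_mult:
  assumes "in_vars X f" "in_vars X g"
  shows "in_vars X (f * g)"
  unfolding in_vars_def mps_coeff_times
proof (intro allI impI)
  fix m assume "(\<Sum>(a, b) | a + b = m. mps_coeff f a * mps_coeff g b) \<noteq> 0"
  then obtain p where "p \<in> {(a, b). a + b = m}"
    "(case p of (a, b) \<Rightarrow> mps_coeff f a * mps_coeff g b) \<noteq> 0"
    by (rule sum.not_neutral_contains_not_neutral)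
  then obtain a b where "a + b = m" "mps_coeff f a \<noteq> 0" "mps_coeff g b \<noteq> 0"
    by (cases p) (use mult_not_zero in auto)
  then have "set_mset a \<subseteq> X" "set_mset b \<subseteq> X" "a + b = m"
    using assms unfolding in_vars_def by blast+
  then show "set_mset m \<subseteq> X" by auto
qed

lemma in_vars_prod: "(\<And>x. x \<in> A \<Longrightarrow> in_vars X (f x)) \<Longrightarrow> in_vars X (prod f A)"
  by (induction A rule: infinite_finite_induct) (auto intro: in_vars_mult)

lemma in_vars_deriv: "in_vars X f \<Longrightarrow> in_vars X (mps_deriv i f)"
  unfolding in_vars_def mps_coeff_deriv
  by (metis mult_zero_right order_trans set_mset_add_mset_insert subset_insertI)

text \<open>A nonzero series has finite order, so an identity between infinite sums may be checked modulo
  every order, where the sums are finite.\<close>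

lemma mps_eq_if_order_ge: "(\<And>N. order_ge N (f - g)) \<Longrightarrow> f = g"
  by (rule mps_eqI) (simp add: order_ge_def, metis eq_iff_diff_eq_0 lessI)


lemma mps_coeff_mps_sum_nat:
  assumes "\<And>k. order_ge k (f k)" "size m < N"
  shows "mps_coeff (mps_sum f) m = (\<Sum>k<N. mps_coeff (f k) m)"
proof -
  have "{k. mps_coeff (f k) m \<noteq> 0} \<subseteq> {..<N}"
    using assms unfolding order_ge_def by (auto simp: not_less) (metis le_trans linorder_not_less)
  then show ?thesis
    unfolding mps_coeff_mps_sum by (intro Sum_any.expand_superset) auto
qed

lemma order_ge_mps_sum_truncate:
  assumes "\<And>k. order_ge (Suc k) (f k)"
  shows "order_ge (Suc N) (mps_sum f - (\<Sum>k<N. f k))"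
  unfolding order_ge_def
proof (intro allI impI)
  fix m :: "'a multiset" assume "size m < Suc N"
  then have "mps_coeff (mps_sum f) m = (\<Sum>k<Suc N. mps_coeff (f k) m)"
    by (intro mps_coeff_mps_sum_nat order_ge_mono[OF assms]) auto
  moreover have "mps_coeff (f N) m = 0"
    using assms \<open>size m < Suc N\<close> unfolding order_ge_def by blast
  ultimately show "mps_coeff (mps_sum f - (\<Sum>k<N. f k)) m = 0" by (simp add: mps_coeff_sum)
qed

lemma order_ge_mps_sum:
  assumes "\<And>k. order_ge k (f k)" "\<And>k. order_ge d (f k)"
  shows "order_ge d (mps_sum f)"
  using assms(2) mps_coeff_mps_sum_nat[OF assms(1)] unfolding order_ge_def
  by (metis (no_types, lifting) lessI sum.neutral)

lemma in_vars_mps_sum: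
  assumes "\<And>k. order_ge k (f k)" "\<And>k. in_vars X (f k)"
  shows "in_vars X (mps_sum f)"
  unfolding in_vars_def
proof (intro allI impI)
  fix m assume "mps_coeff (mps_sum f) m \<noteq> 0"
  then have "(\<Sum>k<Suc (size m). mps_coeff (f k) m) \<noteq> 0"
    using mps_coeff_mps_sum_nat[of f m "Suc (size m)"] assms(1) by simp
  then obtain k where "mps_coeff (f k) m \<noteq> 0" by (rule sum.not_neutral_contains_not_neutral)
  then show "set_mset m \<subseteq> X" using assms(2) unfolding in_vars_def by blast
qed


section \<open>Trees as connected graphs in which every edge is a bridge\<close>

lemma in_adj_iff: "(u, v) \<in> adj E \<longleftrightarrow> {u, v} \<in> E"
  unfolding adj_def by simp

lemma sym_adj_rtrancl: "sym ((adj E)\<^sup>*)"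
  by (intro sym_rtrancl symI) (simp add: in_adj_iff insert_commute)

lemma reach_sym: "(u, v) \<in> (adj E)\<^sup>* \<Longrightarrow> (v, u) \<in> (adj E)\<^sup>*"
  using sym_adj_rtrancl by (rule symD)

lemma reach_mono: "(u, v) \<in> (adj E)\<^sup>* \<Longrightarrow> E \<subseteq> E' \<Longrightarrow> (u, v) \<in> (adj E')\<^sup>*"
  by (rule rtrancl_mono[THEN subsetD, rotated]) (auto simp: adj_def)

lemma reach_map:
  assumes "(x, y) \<in> (adj E)\<^sup>*"
    and "\<And>a b. {a, b} \<in> E \<Longrightarrow> (h a, h b) \<in> (adj F)\<^sup>*"
  shows "(h x, h y) \<in> (adj F)\<^sup>*"
  using assms(1) by induction (auto simp: in_adj_iff intro: rtrancl_trans assms(2))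

text \<open>A path from \<open>u\<close> to \<open>v\<close> that avoids the edge \<open>{u, v}\<close> can be made repetition-free and is closed by
  that edge to a cycle; conversely, dropping an edge of a cycle leaves such a path.\<close>

lemma acyclic_iff_bridges:
  assumes simple: "\<And>u v. {u, v} \<in> E \<Longrightarrow> u \<noteq> v"
  shows "(\<nexists>xs. cycle_in E xs) \<longleftrightarrow> (\<forall>u v. {u, v} \<in> E \<longrightarrow> (u, v) \<notin> (adj (E - {{u, v}}))\<^sup>*)"
proof (intro iffI allI impI notI)
  fix u v
  assume acyclic: "\<nexists>xs. cycle_in E xs" and uv: "{u, v} \<in> E" "(u, v) \<in> (adj (E - {{u, v}}))\<^sup>*"
  let ?r = "\<lambda>a b. (a, b) \<in> adj (E - {{u, v}})"
  have "?r\<^sup>*\<^sup>* u v" using uv(2) by (simp add: rtranclp_rtrancl_eq)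
  then obtain xs' where "rtrancl_path ?r u xs' v"
    unfolding rtranclp_eq_rtrancl_path by blast
  then obtain xs where xs: "rtrancl_path ?r u xs v" "distinct (u # xs)"
    by (rule rtrancl_path_distinct)
  have step: "{(u # xs) ! i, xs ! i} \<in> E - {{u, v}}" if "i < length xs" for i
    using rtrancl_path_nth[OF xs(1) that] by (simp add: in_adj_iff)
  have "xs \<noteq> []" using xs(1) simple[OF uv(1)] by (auto elim: rtrancl_path.cases)
  then have last: "last xs = v" using rtrancl_path_last[OF xs(1)] by simp
  have "length xs \<noteq> 1"
  proof
    assume "length xs = 1"
    then have "xs = [v]" using last by (cases xs) auto
    then show False using step[of 0] by simp
  qed
  with \<open>xs \<noteq> []\<close> have len: "3 \<le> length (u # xs)" by (cases xs) (auto simp: Suc_le_eq)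
  have "{(u # xs) ! i, (u # xs) ! (Suc i mod length (u # xs))} \<in> E" if "i < length (u # xs)" for i
  proof (cases "i < length xs")
    case True
    then show ?thesis using step[of i] by simp
  next
    case False
    with that have i: "i = length xs" by simp
    have "(u # xs) ! i = v"
      using \<open>xs \<noteq> []\<close> last i by (simp add: last_conv_nth nth_Cons')
    then show ?thesis using uv(1) i by (simp add: insert_commute)
  qed
  with len xs(2) have "cycle_in E (u # xs)" unfolding cycle_in_def by blast
  with acyclic show False by blast
next
  assume bridges: "\<forall>u v. {u, v} \<in> E \<longrightarrow> (u, v) \<notin> (adj (E - {{u, v}}))\<^sup>*"
  assume "\<exists>xs. cycle_in E xs"
  then obtain xs where len: "3 \<le> length xs" and dist: "distinct xs"
    and edge: "\<And>i. i < length xs \<Longrightarrow> {xs ! i, xs ! (Suc i mod length xs)} \<in> E"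
    unfolding cycle_in_def by blast
  define e where "e = {xs ! 0, xs ! (length xs - 1)}"
  have "Suc (length xs - 1) = length xs" "length xs - 1 < length xs" using len by simp_all
  then have "e \<in> E" using edge[of "length xs - 1"] by (simp add: e_def insert_commute)
  have "(xs ! 0, xs ! i) \<in> (adj (E - {e}))\<^sup>*" if "i \<le> length xs - 1" for i
    using that
  proof (induction i)
    case (Suc i)
    have "xs ! i = xs ! 0 \<longleftrightarrow> i = 0" "xs ! i = xs ! (length xs - 1) \<longleftrightarrow> i = length xs - 1"
      "xs ! Suc i = xs ! (length xs - 1) \<longleftrightarrow> Suc i = length xs - 1"
      using Suc.prems len by (subst nth_eq_iff_index_eq[OF dist]; auto)+
    then have "{xs ! i, xs ! Suc i} \<noteq> e"
      using Suc.prems len unfolding e_def doubleton_eq_iff by linarith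
    moreover have "{xs ! i, xs ! Suc i} \<in> E" using edge[of i] Suc.prems len by simp
    ultimately have "(xs ! i, xs ! Suc i) \<in> adj (E - {e})" by (simp add: in_adj_iff)
    then show ?case using Suc by simp
  qed simp
  then have "(xs ! 0, xs ! (length xs - 1)) \<in> (adj (E - {e}))\<^sup>*" by blast
  with bridges \<open>e \<in> E\<close> show False unfolding e_def by blast
qed

text \<open>In contrast to the absence of cycles, the condition that every edge is a bridge passes directly to
  subgraphs, and its failure can be transported along collapsing maps by \<open>reach_map\<close>.\<close>

lemma rooted_tree_iff_bridges:
  "rooted_tree T \<longleftrightarrow>
     finite (verts T) \<and> rt T \<in> verts T \<and>
     edges T \<subseteq> {{u, v} | u v. u \<in> verts T \<and> v \<in> verts T \<and> u \<noteq> v} \<and>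
     (\<forall>u\<in>verts T. (rt T, u) \<in> (adj (edges T))\<^sup>*) \<and>
     (\<forall>u v. {u, v} \<in> edges T \<longrightarrow> (u, v) \<notin> (adj (edges T - {{u, v}}))\<^sup>*)" (is "_ \<longleftrightarrow> ?R")
proof -
  have simple: "u \<noteq> v"
    if "edges T \<subseteq> {{u, v} | u v. u \<in> verts T \<and> v \<in> verts T \<and> u \<noteq> v}" "{u, v} \<in> edges T" for u v
    using that by (auto simp: doubleton_eq_iff dest!: subsetD)
  have conn: "(u, v) \<in> (adj (edges T))\<^sup>*"
    if "\<forall>u\<in>verts T. (rt T, u) \<in> (adj (edges T))\<^sup>*" "u \<in> verts T" "v \<in> verts T" for u v
    using that by (meson reach_sym rtrancl_trans)
  show ?thesis
  proof
    assume T: "rooted_tree T"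
    then have E: "edges T \<subseteq> {{u, v} | u v. u \<in> verts T \<and> v \<in> verts T \<and> u \<noteq> v}"
      unfolding rooted_tree_def by blast
    show ?R
      using T acyclic_iff_bridges[OF simple[OF E]] rooted_tree_def[of T] by blast
  next
    assume R: ?R
    then have E: "edges T \<subseteq> {{u, v} | u v. u \<in> verts T \<and> v \<in> verts T \<and> u \<noteq> v}" by blast
    show "rooted_tree T"
      using R conn acyclic_iff_bridges[OF simple[OF E]] rooted_tree_def[of T] by blast
  qed
qed

lemma rooted_tree_bridge:
  "rooted_tree T \<Longrightarrow> {u, v} \<in> edges T \<Longrightarrow> (u, v) \<notin> (adj (edges T - {{u, v}}))\<^sup>*"
  unfolding rooted_tree_iff_bridges by blast

lemma rooted_tree_basic:
  assumes "rooted_tree T"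
  shows "finite (verts T)" "rt T \<in> verts T" "\<And>u. u \<in> verts T \<Longrightarrow> (rt T, u) \<in> (adj (edges T))\<^sup>*"
    "finite (edges T)"
proof -
  show "finite (verts T)" "rt T \<in> verts T" "\<And>u. u \<in> verts T \<Longrightarrow> (rt T, u) \<in> (adj (edges T))\<^sup>*"
    using assms unfolding rooted_tree_iff_bridges by blast+
  have "edges T \<subseteq> Pow (verts T)" using rooted_tree_edge_subset[OF assms] by blast
  then show "finite (edges T)" using \<open>finite (verts T)\<close> finite_subset by blast
qed

lemma rooted_tree_edgeE:
  assumes "rooted_tree T" "e \<in> edges T"
  obtains u v where "e = {u, v}" "u \<in> verts T" "v \<in> verts T" "u \<noteq> v"
  using assms unfolding rooted_tree_def by blast

text \<open>Consider the first time that a path uses the edge \<open>{v, w}\<close>.\<close>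

lemma reach_one_end:
  assumes "(r, x) \<in> (adj E)\<^sup>*"
  shows "(r, x) \<in> (adj (E - {{v, w}}))\<^sup>* \<or> (r, v) \<in> (adj (E - {{v, w}}))\<^sup>* \<or> (r, w) \<in> (adj (E - {{v, w}}))\<^sup>*"
  using assms
proof induction
  case (step y z)
  show ?case
  proof (cases "{y, z} = {v, w}")
    case True
    then show ?thesis using step.IH by (auto simp: doubleton_eq_iff)
  next
    case False
    then have "(y, z) \<in> adj (E - {{v, w}})" using step.hyps by (simp add: in_adj_iff)
    then show ?thesis using step.IH by (meson rtrancl.rtrancl_into_rtrancl)
  qed
qed simp

text \<open>A walk gets to the far side only by crossing the bridge, which it does from the near end.\<close>

lemma near_end_visited:
  assumes "(r, x) \<in> adj E ^^ k" "(r, x) \<notin> (adj (E - {{v, w}}))\<^sup>*" "(r, w) \<notin> (adj (E - {{v, w}}))\<^sup>*"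
  shows "\<exists>j<k. (r, v) \<in> adj E ^^ j"
  using assms(1,2)
proof (induction k arbitrary: x)
  case (Suc k)
  then obtain y where y: "(r, y) \<in> adj E ^^ k" "{y, x} \<in> E" by (auto simp: in_adj_iff)
  show ?case
  proof (cases "(r, y) \<in> (adj (E - {{v, w}}))\<^sup>*")
    case True
    have "{y, x} = {v, w}"
    proof (rule ccontr)
      assume "{y, x} \<noteq> {v, w}"
      then have "(y, x) \<in> adj (E - {{v, w}})" using y(2) by (simp add: in_adj_iff)
      with True Suc.prems(2) show False by (meson rtrancl.rtrancl_into_rtrancl)
    qed
    then have "y = v" using True assms(3) by (auto simp: doubleton_eq_iff)
    then show ?thesis using y(1) by blast
  next
    case False
    then show ?thesis using Suc.IH[OF y(1)] by (meson less_Suc_eq)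
  qed
qed simp

lemma graph_dist_less:
  assumes T: "rooted_tree T" "{v, w} \<in> edges T"
    and v: "(rt T, v) \<in> (adj (edges T - {{v, w}}))\<^sup>*"
  shows "graph_dist T (rt T) v < graph_dist T (rt T) w"
proof -
  have nw: "(rt T, w) \<notin> (adj (edges T - {{v, w}}))\<^sup>*"
    using rooted_tree_bridge[OF T] v by (meson reach_sym rtrancl_trans)
  have "w \<in> verts T" using rooted_tree_edge[OF T] by blast
  then have "\<exists>k. (rt T, w) \<in> adj (edges T) ^^ k"
    using rooted_tree_basic(3)[OF T(1)] rtrancl_power by metis
  then have "(rt T, w) \<in> adj (edges T) ^^ graph_dist T (rt T) w"
    unfolding graph_dist_def by (rule LeastI_ex)
  then obtain j where "j < graph_dist T (rt T) w" "(rt T, v) \<in> adj (edges T) ^^ j"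
    using near_end_visited[OF _ nw nw] by blast
  then show ?thesis unfolding graph_dist_def[of T "rt T" v] by (meson Least_le le_less_trans)
qed

lemma near_end_cases:
  assumes "rooted_tree T" "{v, w} \<in> edges T"
  shows "(rt T, v) \<in> (adj (edges T - {{v, w}}))\<^sup>* \<or> (rt T, w) \<in> (adj (edges T - {{v, w}}))\<^sup>*"
  using reach_one_end[of "rt T" v "edges T" v w] rooted_tree_basic(3)[OF assms(1)]
    rooted_tree_edge[OF assms] by blast

text \<open>The end of an edge closer to the root is the one that stays connected to the root when the edge is
  removed. This replaces distances by reachability, which is easy to follow through cutting and grafting.\<close>

lemma children_iff_near_end:
  assumes T: "rooted_tree T"
  shows "w \<in> children T v \<longleftrightarrow> {v, w} \<in> edges T \<and> (rt T, v) \<in> (adj (edges T - {{v, w}}))\<^sup>*"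
proof (cases "{v, w} \<in> edges T")
  case True
  have "\<not> graph_dist T (rt T) v < graph_dist T (rt T) w"
    if "(rt T, v) \<notin> (adj (edges T - {{v, w}}))\<^sup>*"
    using near_end_cases[OF T True] that graph_dist_less[OF T, of w v] True
    by (simp add: insert_commute)
  then show ?thesis
    using True graph_dist_less[OF T True] unfolding children_def by blast
qed (simp add: children_def)

lemma far_end_eq:
  assumes "w \<in> children T v"
  shows "far_end T {v, w} = w"
  unfolding far_end_def
  using assms unfolding children_def by (intro the_equality) (auto simp: doubleton_eq_iff)

lemma finite_children: "rooted_tree T \<Longrightarrow> finite (children T v)"
  using children_subset rooted_tree_basic(1) finite_subset by metis

lemma component_rooted_tree:
  assumes T: "rooted_tree T" "x \<in> verts T"
  shows "rooted_tree (component T e x)"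
  unfolding rooted_tree_iff_bridges
proof (intro conjI allI impI ballI)
  let ?C = "component T e x"
  have sub: "edges ?C \<subseteq> edges T" "verts ?C \<subseteq> verts T" and rt: "rt ?C = x"
    by (auto simp: component_def Let_def)
  show "finite (verts ?C)" using sub rooted_tree_basic(1)[OF T(1)] finite_subset by blast
  show "rt ?C \<in> verts ?C" using T(2) by (auto simp: component_def Let_def)
  show "edges ?C \<subseteq> {{u, v} |u v. u \<in> verts ?C \<and> v \<in> verts ?C \<and> u \<noteq> v}"
  proof
    fix f assume f: "f \<in> edges ?C"
    then obtain u v where "f = {u, v}" "u \<noteq> v" using rooted_tree_edgeE[OF T(1)] sub by blast
    moreover have "f \<subseteq> verts ?C" using f by (auto simp: component_def Let_def)
    ultimately show "f \<in> {{u, v} |u v. u \<in> verts ?C \<and> v \<in> verts ?C \<and> u \<noteq> v}" by blast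
  qed
  show "(u, v) \<notin> (adj (edges ?C - {{u, v}}))\<^sup>*" if "{u, v} \<in> edges ?C" for u v
    using rooted_tree_bridge[OF T(1), of u v] that sub(1) reach_mono[of u v _ "edges T - {{u, v}}"]
    by blast
  show "(rt ?C, u) \<in> (adj (edges ?C))\<^sup>*" if "u \<in> verts ?C" for u
  proof -
    have "(x, u) \<in> (adj (edges T - {e}))\<^sup>*" using that by (auto simp: component_def Let_def)
    then have "(x, u) \<in> (adj (edges ?C))\<^sup>*"
    proof induction
      case (step y z)
      then have "{y, z} \<in> edges T - {e}" by (simp add: in_adj_iff)
      moreover from this have "y \<in> verts T" "z \<in> verts T" using rooted_tree_edge[OF T(1)] by blast+
      moreover have "(x, z) \<in> (adj (edges T - {e}))\<^sup>*"
        using step.hyps by (rule rtrancl.rtrancl_into_rtrancl)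
      ultimately have "(y, z) \<in> adj (edges ?C)"
        using step.hyps(1) unfolding component_def Let_def in_adj_iff by simp
      with step.IH show ?case by (rule rtrancl.rtrancl_into_rtrancl)
    qed simp
    then show ?thesis by (simp add: rt)
  qed
qed


section \<open>Grafting, the inverse of cutting an edge\<close>

text \<open>The scion \<open>S\<close> is attached below the vertex \<open>v\<close> of the stock \<open>T\<close> by an edge to its root.\<close>

definition graft :: "'a rgraph \<Rightarrow> 'a rgraph \<Rightarrow> 'a \<Rightarrow> 'a rgraph" where
  "graft S T v = \<lparr>verts = verts S \<union> verts T, edges = insert {v, rt S} (edges S \<union> edges T), rt = rt T\<rparr>"

definition graftable :: "'a rgraph \<Rightarrow> 'a rgraph \<Rightarrow> 'a \<Rightarrow> bool" where
  "graftable S T v \<longleftrightarrow> rooted_tree S \<and> rooted_tree T \<and> verts S \<inter> verts T = {} \<and> v \<in> verts T"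

lemma graft_simps [simp]:
  "verts (graft S T v) = verts S \<union> verts T"
  "edges (graft S T v) = insert {v, rt S} (edges S \<union> edges T)"
  "rt (graft S T v) = rt T"
  by (simp_all add: graft_def)

context
  fixes S T :: "'a rgraph" and v :: 'a
  assumes graftable: "graftable S T v"
begin

lemma graftable_trees: "rooted_tree S" "rooted_tree T" and graftable_disjoint: "verts S \<inter> verts T = {}"
  and graftable_vert: "v \<in> verts T"
  using graftable unfolding graftable_def by auto

private lemma edge_S: "{a, b} \<in> edges S \<Longrightarrow> a \<in> verts S \<and> b \<in> verts S \<and> a \<notin> verts T \<and> b \<notin> verts T"
  using rooted_tree_edge[OF graftable_trees(1)] graftable_disjoint by blast

private lemma edge_T: "{a, b} \<in> edges T \<Longrightarrow> a \<in> verts T \<and> b \<in> verts T \<and> a \<notin> verts S \<and> b \<notin> verts S"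
  using rooted_tree_edge[OF graftable_trees(2)] graftable_disjoint by blast

private lemma rt_S: "rt S \<in> verts S" "rt S \<notin> verts T" "v \<notin> verts S"
  using rooted_tree_basic(2)[OF graftable_trees(1)] graftable_disjoint graftable_vert by auto

lemma graft_edge_fresh: "{v, rt S} \<notin> edges S" "{v, rt S} \<notin> edges T" "edges S \<inter> edges T = {}"
proof -
  show "{v, rt S} \<notin> edges S" "{v, rt S} \<notin> edges T"
    using edge_S edge_T rt_S graftable_vert by blast+
  show "edges S \<inter> edges T = {}"
    using edge_S edge_T rooted_tree_edgeE[OF graftable_trees(1)] by (metis disjoint_iff)
qed

text \<open>Collapsing \<open>T\<close> to the root of \<open>S\<close>, or \<open>S\<close> to the vertex \<open>v\<close>, sends walks to walks.\<close>

lemma reach_in_scion: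
  assumes F: "F \<subseteq> edges (graft S T v)" and xy: "x \<in> verts S" "y \<in> verts S"
  shows "(x, y) \<in> (adj F)\<^sup>* \<longleftrightarrow> (x, y) \<in> (adj (F \<inter> edges S))\<^sup>*"
proof
  let ?h = "\<lambda>x. if x \<in> verts S then x else rt S"
  assume "(x, y) \<in> (adj F)\<^sup>*"
  then have "(?h x, ?h y) \<in> (adj (F \<inter> edges S))\<^sup>*"
  proof (rule reach_map)
    fix a b assume ab: "{a, b} \<in> F"
    with F consider "{a, b} = {v, rt S}" | "{a, b} \<in> edges S" | "{a, b} \<in> edges T" by auto
    then show "(?h a, ?h b) \<in> (adj (F \<inter> edges S))\<^sup>*"
    proof cases
      case 2
      then show ?thesis using ab edge_S[OF 2] by (auto simp: in_adj_iff)
    qed (use edge_T rt_S in \<open>auto simp: doubleton_eq_iff\<close>)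
  qed
  then show "(x, y) \<in> (adj (F \<inter> edges S))\<^sup>*" using xy by simp
qed (rule reach_mono, auto)

lemma reach_in_stock:
  assumes F: "F \<subseteq> edges (graft S T v)" and xy: "x \<in> verts T" "y \<in> verts T"
  shows "(x, y) \<in> (adj F)\<^sup>* \<longleftrightarrow> (x, y) \<in> (adj (F \<inter> edges T))\<^sup>*"
proof
  let ?h = "\<lambda>x. if x \<in> verts T then x else v"
  assume "(x, y) \<in> (adj F)\<^sup>*"
  then have "(?h x, ?h y) \<in> (adj (F \<inter> edges T))\<^sup>*"
  proof (rule reach_map)
    fix a b assume ab: "{a, b} \<in> F"
    with F consider "{a, b} = {v, rt S}" | "{a, b} \<in> edges S" | "{a, b} \<in> edges T" by auto
    then show "(?h a, ?h b) \<in> (adj (F \<inter> edges T))\<^sup>*"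
    proof cases
      case 3
      then show ?thesis using ab edge_T[OF 3] by (auto simp: in_adj_iff)
    qed (use edge_S rt_S graftable_vert in \<open>auto simp: doubleton_eq_iff\<close>)
  qed
  then show "(x, y) \<in> (adj (F \<inter> edges T))\<^sup>*" using xy by simp
qed (rule reach_mono, auto)

text \<open>Since the new edge is the only passage, a walk from the stock into the scion passes \<open>v\<close> and then the
  root of \<open>S\<close>.\<close>

lemma reach_stock_scion:
  assumes F: "F \<subseteq> edges (graft S T v)" and xy: "x \<in> verts T" "y \<in> verts S"
  shows "(x, y) \<in> (adj F)\<^sup>* \<longleftrightarrow>
    {v, rt S} \<in> F \<and> (x, v) \<in> (adj (F \<inter> edges T))\<^sup>* \<and> (rt S, y) \<in> (adj (F \<inter> edges S))\<^sup>*"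
    (is "_ \<longleftrightarrow> ?R y")
proof
  assume "(x, y) \<in> (adj F)\<^sup>*"
  then have "y \<in> verts S \<longrightarrow> ?R y"
  proof induction
    case base
    then show ?case using xy graftable_disjoint by blast
  next
    case (step y z)
    have yz: "{y, z} \<in> F" using step.hyps by (simp add: in_adj_iff)
    with F consider "{y, z} = {v, rt S}" | "{y, z} \<in> edges S" | "{y, z} \<in> edges T" by auto
    then show ?case
    proof cases
      case 1
      show ?thesis
      proof
        assume "z \<in> verts S"
        with 1 rt_S have "y = v" "z = rt S" by (auto simp: doubleton_eq_iff)
        moreover have "(x, v) \<in> (adj (F \<inter> edges T))\<^sup>*"
          using step.hyps(1) reach_in_stock[OF F xy(1) graftable_vert] \<open>y = v\<close> by simp
        ultimately show "?R z" using yz by simp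
      qed
    next
      case 2
      then have "(y, z) \<in> adj (F \<inter> edges S)" using yz by (simp add: in_adj_iff)
      then show ?thesis using step.IH edge_S[OF 2] by (meson rtrancl.rtrancl_into_rtrancl)
    next
      case 3
      then show ?thesis using edge_T by blast
    qed
  qed
  then show "?R y" using xy by blast
next
  assume R: "?R y"
  then have "(x, v) \<in> (adj F)\<^sup>*" "(rt S, y) \<in> (adj F)\<^sup>*" "(v, rt S) \<in> adj F"
    by (auto simp: in_adj_iff intro: reach_mono)
  then show "(x, y) \<in> (adj F)\<^sup>*" by (meson rtrancl.rtrancl_into_rtrancl rtrancl_trans)
qed

lemma rooted_tree_graft: "rooted_tree (graft S T v)"
  unfolding rooted_tree_iff_bridges
proof (intro conjI allI impI ballI)
  let ?G = "graft S T v"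
  note ST = graftable_trees
  show "finite (verts ?G)" "rt ?G \<in> verts ?G"
    using rooted_tree_basic[OF ST(1)] rooted_tree_basic[OF ST(2)] by auto
  have "{v, rt S} \<in> {{u, w} |u w. u \<in> verts ?G \<and> w \<in> verts ?G \<and> u \<noteq> w}"
    using rt_S graftable_vert by fastforce
  moreover have "edges S \<subseteq> {{u, w} |u w. u \<in> verts ?G \<and> w \<in> verts ?G \<and> u \<noteq> w}"
    "edges T \<subseteq> {{u, w} |u w. u \<in> verts ?G \<and> w \<in> verts ?G \<and> u \<noteq> w}"
    using ST unfolding rooted_tree_def graft_simps by blast+
  ultimately show "edges ?G \<subseteq> {{u, w} |u w. u \<in> verts ?G \<and> w \<in> verts ?G \<and> u \<noteq> w}"
    by simp
  show "(rt ?G, u) \<in> (adj (edges ?G))\<^sup>*" if "u \<in> verts ?G" for u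
  proof (cases "u \<in> verts T")
    case True
    then show ?thesis using rooted_tree_basic(3)[OF ST(2)] by (auto intro: reach_mono)
  next
    case False
    have "edges ?G \<inter> edges T = edges T" "edges ?G \<inter> edges S = edges S" by auto
    then show ?thesis
      using False that reach_stock_scion[of "edges ?G" "rt T" u] rooted_tree_basic[OF ST(1)]
        rooted_tree_basic[OF ST(2)] graftable_vert by simp
  qed
  show "(a, b) \<notin> (adj (edges ?G - {{a, b}}))\<^sup>*" if ab: "{a, b} \<in> edges ?G" for a b
  proof -
    let ?F = "edges ?G - {{a, b}}"
    have F: "?F \<subseteq> edges ?G" by blast
    from ab consider "{a, b} = {v, rt S}" | "{a, b} \<in> edges S" | "{a, b} \<in> edges T" by auto
    then show ?thesis
    proof cases
      case 1
      then have "(v, rt S) \<notin> (adj ?F)\<^sup>*"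
        using reach_stock_scion[OF F graftable_vert rt_S(1)] by blast
      then have "(rt S, v) \<notin> (adj ?F)\<^sup>*" using reach_sym[of "rt S" v ?F] by blast
      with \<open>(v, rt S) \<notin> (adj ?F)\<^sup>*\<close> show ?thesis
        using 1 by (metis doubleton_eq_iff)
    next
      case 2
      have "?F \<inter> edges S = edges S - {{a, b}}" by auto
      then show ?thesis
        using reach_in_scion[OF F] edge_S[OF 2] rooted_tree_bridge[OF ST(1) 2] by simp
    next
      case 3
      have "?F \<inter> edges T = edges T - {{a, b}}" by auto
      then show ?thesis
        using reach_in_stock[OF F] edge_T[OF 3] rooted_tree_bridge[OF ST(2) 3] by simp
    qed
  qed
qed

lemma children_graft:
  "children (graft S T v) u =
    (if u \<in> verts S then children S u else if u = v then insert (rt S) (children T v) else children T u)"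
proof (rule set_eqI)
  fix w
  let ?G = "graft S T v" and ?F = "edges (graft S T v) - {{u, w}}"
  have F: "?F \<subseteq> edges ?G" by blast
  have G: "w \<in> children ?G u \<longleftrightarrow> {u, w} \<in> edges ?G \<and> (rt T, u) \<in> (adj ?F)\<^sup>*"
    using children_iff_near_end[OF rooted_tree_graft] by simp
  have rT: "rt T \<in> verts T" using rooted_tree_basic(2)[OF graftable_trees(2)] .
  have S: "w \<in> children S u \<longleftrightarrow> {u, w} \<in> edges S \<and> (rt S, u) \<in> (adj (edges S - {{u, w}}))\<^sup>*"
    and T: "w \<in> children T u \<longleftrightarrow> {u, w} \<in> edges T \<and> (rt T, u) \<in> (adj (edges T - {{u, w}}))\<^sup>*"
    by (rule children_iff_near_end[OF graftable_trees(1)], rule children_iff_near_end[OF graftable_trees(2)])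
  consider "{u, w} \<notin> edges ?G" | "{u, w} = {v, rt S}" | "{u, w} \<in> edges S" | "{u, w} \<in> edges T"
    by auto
  then show "w \<in> children ?G u \<longleftrightarrow> w \<in> (if u \<in> verts S then children S u
      else if u = v then insert (rt S) (children T v) else children T u)"
  proof cases
    case 1
    then show ?thesis using G S T by auto
  next
    case 2
    show ?thesis
    proof (cases "u = v")
      case True
      then have "w = rt S" using 2 rt_S by (auto simp: doubleton_eq_iff)
      have "?F \<inter> edges T = edges T" using 2 graft_edge_fresh by auto
      then have "(rt T, u) \<in> (adj ?F)\<^sup>*"
        using reach_in_stock[OF F rT graftable_vert] True
          rooted_tree_basic(3)[OF graftable_trees(2) graftable_vert] by simp
      then show ?thesis using G True \<open>w = rt S\<close> rt_S by simp
    next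
      case False
      then have "u = rt S" using 2 by (auto simp: doubleton_eq_iff)
      then have "(rt T, u) \<notin> (adj ?F)\<^sup>*"
        using reach_stock_scion[OF F rT rt_S(1)] 2 by auto
      then show ?thesis using G S False \<open>u = rt S\<close> rt_S 2 graft_edge_fresh by auto
    qed
  next
    case 3
    have "?F \<inter> edges S = edges S - {{u, w}}" "?F \<inter> edges T = edges T" "{v, rt S} \<in> ?F"
      using 3 graft_edge_fresh by auto
    then have "(rt T, u) \<in> (adj ?F)\<^sup>* \<longleftrightarrow> (rt S, u) \<in> (adj (edges S - {{u, w}}))\<^sup>*"
      using reach_stock_scion[OF F rT, of u] edge_S[OF 3]
        rooted_tree_basic(3)[OF graftable_trees(2) graftable_vert] by simp
    then show ?thesis using G S 3 edge_S[OF 3] by simp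
  next
    case 4
    have "?F \<inter> edges T = edges T - {{u, w}}" using 4 by auto
    then have "(rt T, u) \<in> (adj ?F)\<^sup>* \<longleftrightarrow> (rt T, u) \<in> (adj (edges T - {{u, w}}))\<^sup>*"
      using reach_in_stock[OF F rT, of u] edge_T[OF 4] by simp
    then show ?thesis using G T 4 edge_T[OF 4] rt_S by auto
  qed
qed

lemma rt_scion_in_children: "rt S \<in> children (graft S T v) v"
  using children_graft[of v] rt_S by simp

lemma upper_part_graft: "upper_part (graft S T v) {v, rt S} = T"
proof -
  let ?G = "graft S T v" and ?F = "edges (graft S T v) - {{v, rt S}}"
  have F: "?F \<subseteq> edges ?G" by blast
  have rT: "rt T \<in> verts T" using rooted_tree_basic(2)[OF graftable_trees(2)] .
  have eq: "?F = edges S \<union> edges T" using graft_edge_fresh by auto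
  have "(rt T, x) \<in> (adj ?F)\<^sup>*" if "x \<in> verts T" for x
    using rooted_tree_basic(3)[OF graftable_trees(2) that] eq by (auto intro: reach_mono)
  moreover have "(rt T, x) \<notin> (adj ?F)\<^sup>*" if "x \<in> verts S" for x
    using reach_stock_scion[OF F rT that] by blast
  ultimately have V: "{x \<in> verts ?G. (rt T, x) \<in> (adj ?F)\<^sup>*} = verts T" by auto
  have "{f \<in> ?F. f \<subseteq> verts T} = edges T"
  proof -
    have "\<not> f \<subseteq> verts T" if "f \<in> edges S" for f
      by (rule rooted_tree_edgeE[OF graftable_trees(1) that]) (use that edge_S in auto)
    then show ?thesis using eq rooted_tree_edge_subset[OF graftable_trees(2)] by blast
  qed
  then show ?thesis unfolding upper_part_def component_def Let_def graft_simps(3) V by simp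
qed

lemma lower_part_graft: "lower_part (graft S T v) {v, rt S} = S"
proof -
  let ?G = "graft S T v" and ?F = "edges (graft S T v) - {{v, rt S}}"
  have F: "?F \<subseteq> edges ?G" by blast
  have eq: "?F = edges S \<union> edges T" using graft_edge_fresh by auto
  have "(rt S, x) \<in> (adj ?F)\<^sup>*" if "x \<in> verts S" for x
    using rooted_tree_basic(3)[OF graftable_trees(1) that] eq by (auto intro: reach_mono)
  moreover have "(rt S, x) \<notin> (adj ?F)\<^sup>*" if "x \<in> verts T" for x
    using reach_stock_scion[OF F that rt_S(1)] reach_sym[of "rt S" x ?F] by blast
  ultimately have V: "{x \<in> verts ?G. (rt S, x) \<in> (adj ?F)\<^sup>*} = verts S" by auto
  have "{f \<in> ?F. f \<subseteq> verts S} = edges S"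
  proof -
    have "\<not> f \<subseteq> verts S" if "f \<in> edges T" for f
      by (rule rooted_tree_edgeE[OF graftable_trees(2) that]) (use that edge_T in auto)
    then show ?thesis using eq rooted_tree_edge_subset[OF graftable_trees(1)] by blast
  qed
  then show ?thesis
    unfolding lower_part_def far_end_eq[OF rt_scion_in_children] component_def Let_def V by simp
qed

text \<open>Excursions of a walk from the stock into the scion can be left out, so the removal of \<open>e\<close> separates
  the same vertices of the stock from the root before and after grafting.\<close>

lemma edge_succ_stock:
  assumes "e \<in> edges T" "f \<in> edges T"
  shows "edge_succ (graft S T v) e f \<longleftrightarrow> edge_succ T e f"
proof -
  let ?F = "edges (graft S T v) - {e}"
  have "?F \<inter> edges T = edges T - {e}" by auto
  then have "(rt T, x) \<in> (adj ?F)\<^sup>* \<longleftrightarrow> (rt T, x) \<in> (adj (edges T - {e}))\<^sup>*" if "x \<in> verts T" for x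
    using reach_in_stock[of ?F "rt T" x] that rooted_tree_basic(2)[OF graftable_trees(2)] by auto
  then show ?thesis
    using assms rooted_tree_edge_subset[OF graftable_trees(2)]
    unfolding edge_succ_def upper_part_def component_def Let_def by auto
qed

end

text \<open>Every edge arises from grafting: the two components of its complement are disjoint because the edge
  is a bridge, and cover the tree because it is connected.\<close>

lemma cut_edge:
  assumes T: "rooted_tree T" "e \<in> edges T"
  obtains v where "graftable (lower_part T e) (upper_part T e) v"
    "e = {v, rt (lower_part T e)}" "T = graft (lower_part T e) (upper_part T e) v"
proof -
  have "\<exists>v w. e = {v, w} \<and> (rt T, v) \<in> (adj (edges T - {{v, w}}))\<^sup>*"
  proof -
    obtain a b where ab: "e = {a, b}" using rooted_tree_edgeE[OF T] by metis
    then show ?thesis using near_end_cases[OF T(1), of a b] T(2) by (metis insert_commute)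
  qed
  then obtain v w where e: "e = {v, w}" and v: "(rt T, v) \<in> (adj (edges T - {e}))\<^sup>*" by blast
  have w: "w \<in> children T v" using children_iff_near_end[OF T(1)] e v T(2) by simp
  let ?U = "upper_part T e" and ?L = "lower_part T e"
  have L: "?L = component T e w" unfolding lower_part_def e far_end_eq[OF w] ..
  have vw: "v \<in> verts T" "w \<in> verts T" using rooted_tree_edge[OF T(1)] T(2) e by blast+
  have rU: "rt ?U = rt T" and rL: "rt ?L = w"
    unfolding L upper_part_def component_def by (simp_all add: Let_def)
  have VU: "x \<in> verts ?U \<longleftrightarrow> x \<in> verts T \<and> (rt T, x) \<in> (adj (edges T - {e}))\<^sup>*"
    and VL: "x \<in> verts ?L \<longleftrightarrow> x \<in> verts T \<and> (w, x) \<in> (adj (edges T - {e}))\<^sup>*" for x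
    unfolding L upper_part_def component_def by (simp_all add: Let_def)
  have EU: "edges ?U = {f \<in> edges T - {e}. f \<subseteq> verts ?U}"
    and EL: "edges ?L = {f \<in> edges T - {e}. f \<subseteq> verts ?L}"
    unfolding L upper_part_def component_def by (simp_all add: Let_def)
  have nw: "(rt T, w) \<notin> (adj (edges T - {e}))\<^sup>*"
    using rooted_tree_bridge[OF T(1), of v w] v T(2) e by (metis reach_sym rtrancl_trans)
  have disj: "verts ?L \<inter> verts ?U = {}"
    using nw unfolding disjoint_iff VU VL by (metis reach_sym rtrancl_trans)
  have cover: "verts ?L \<union> verts ?U = verts T"
  proof -
    have "(rt T, x) \<in> (adj (edges T - {e}))\<^sup>* \<or> (w, x) \<in> (adj (edges T - {e}))\<^sup>*"
      if "(rt T, x) \<in> (adj (edges T))\<^sup>*" for x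
      using that
    proof induction
      case (step y z)
      show ?case
      proof (cases "{y, z} = e")
        case True
        then show ?thesis using v e by (auto simp: doubleton_eq_iff)
      next
        case False
        then have "(y, z) \<in> adj (edges T - {e})" using step.hyps by (simp add: in_adj_iff)
        then show ?thesis using step.IH by (meson rtrancl.rtrancl_into_rtrancl)
      qed
    qed simp
    then show ?thesis using VU VL rooted_tree_basic(3)[OF T(1)] by blast
  qed
  have edges: "edges T = insert e (edges ?L \<union> edges ?U)"
  proof -
    have "f \<subseteq> verts ?L \<or> f \<subseteq> verts ?U" if f: "f \<in> edges T - {e}" for f
    proof -
      obtain a b where ab: "f = {a, b}" "a \<in> verts T" "b \<in> verts T"
        using rooted_tree_edgeE[OF T(1)] f by blast
      then have "(a, b) \<in> adj (edges T - {e})" "(b, a) \<in> adj (edges T - {e})"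
        using f by (auto simp: in_adj_iff insert_commute)
      then have "b \<in> verts ?L \<longleftrightarrow> a \<in> verts ?L" "b \<in> verts ?U \<longleftrightarrow> a \<in> verts ?U"
        unfolding VL VU using ab by (meson rtrancl.rtrancl_into_rtrancl)+
      then show ?thesis using ab cover by auto
    qed
    then have "edges T - {e} = edges ?L \<union> edges ?U" unfolding EL EU by auto
    then show ?thesis using T(2) by auto
  qed
  have "graftable ?L ?U v"
    unfolding graftable_def
    using component_rooted_tree[OF T(1) vw(2), of e] L disj VU v vw(1)
      component_rooted_tree[OF T(1) rooted_tree_basic(2)[OF T(1)], of e]
    by (simp add: upper_part_def)
  moreover have "T = graft ?L ?U v"
  proof (rule rgraph.equality)
    show "verts T = verts (graft ?L ?U v)" unfolding graft_simps by (rule cover[symmetric])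
    show "edges T = edges (graft ?L ?U v)"
      unfolding graft_simps rL by (rule edges[THEN trans]) (simp only: e[symmetric])
    show "rt T = rt (graft ?L ?U v)" unfolding graft_simps by (rule rU[symmetric])
  qed simp
  ultimately show thesis using that e rL by metis
qed

lemma parts_rooted_tree:
  assumes "rooted_tree T" "e \<in> edges T"
  shows "rooted_tree (lower_part T e)" "rooted_tree (upper_part T e)"
  using cut_edge[OF assms] graftable_trees by metis+

lemma card_parts:
  assumes "rooted_tree T" "e \<in> edges T"
  shows "card (verts (lower_part T e)) + card (verts (upper_part T e)) = card (verts T)"
    "0 < card (verts (lower_part T e))" "0 < card (verts (upper_part T e))"
proof -
  obtain v where v: "graftable (lower_part T e) (upper_part T e) v"
    "T = graft (lower_part T e) (upper_part T e) v"
    using cut_edge[OF assms] by metis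
  note parts = graftable_trees[OF v(1)]
  have "card (verts T) = card (verts (lower_part T e) \<union> verts (upper_part T e))"
    using arg_cong[OF v(2), of verts] by simp
  then show "card (verts (lower_part T e)) + card (verts (upper_part T e)) = card (verts T)"
    using graftable_disjoint[OF v(1)] rooted_tree_basic(1)[OF parts(1)] rooted_tree_basic(1)[OF parts(2)]
    by (simp add: card_Un_disjoint)
  show "0 < card (verts (lower_part T e))" "0 < card (verts (upper_part T e))"
    using rooted_tree_basic(1,2)[OF parts(1)] rooted_tree_basic(1,2)[OF parts(2)]
    by (auto simp: card_gt_0_iff)
qed

lemma edges_empty_iff_singleton:
  assumes T: "rooted_tree T"
  shows "edges T = {} \<longleftrightarrow> verts T = {rt T}"
proof
  assume "edges T = {}"
  then have "adj (edges T) = {}" by (simp add: adj_def)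
  then have "u = rt T" if "u \<in> verts T" for u
    using rooted_tree_basic(3)[OF T that] by simp
  then show "verts T = {rt T}" using rooted_tree_basic(2)[OF T] by blast
next
  assume "verts T = {rt T}"
  then show "edges T = {}" using rooted_tree_edgeE[OF T] by (metis equals0I singletonD)
qed

text \<open>Since every tree with an edge is a graft of two smaller ones, trees admit induction by
  grafting.\<close>

lemma rooted_tree_induct [consumes 1, case_names singleton graft]:
  assumes "rooted_tree T"
    and "\<And>r. P \<lparr>verts = {r}, edges = {}, rt = r\<rparr>"
    and "\<And>S T v. graftable S T v \<Longrightarrow> P S \<Longrightarrow> P T \<Longrightarrow> P (graft S T v)"
  shows "P T"
  using assms(1)
proof (induction "card (verts T)" arbitrary: T rule: less_induct)
  case less
  show ?case
  proof (cases "edges T = {}")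
    case True
    then have "T = \<lparr>verts = {rt T}, edges = {}, rt = rt T\<rparr>"
      using edges_empty_iff_singleton[OF less.prems] by (cases T) simp
    then show ?thesis using assms(2) by metis
  next
    case False
    then obtain e where e: "e \<in> edges T" by blast
    have "card (verts (lower_part T e)) < card (verts T)" "card (verts (upper_part T e)) < card (verts T)"
      using card_parts[OF less.prems e] by linarith+
    then have "P (lower_part T e)" "P (upper_part T e)"
      using less.hyps parts_rooted_tree[OF less.prems e] by blast+
    then show ?thesis using cut_edge[OF less.prems e] assms(3) by metis
  qed
qed

text \<open>Every vertex except the root is a child of exactly one vertex; grafting adds one child, the root of
  the scion.\<close>

lemma sum_card_children:
  assumes "rooted_tree T"
  shows "(\<Sum>v\<in>verts T. card (children T v)) + 1 = card (verts T)"
  using assms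
proof (induction rule: rooted_tree_induct)
  case (graft S T v)
  note ST = graftable_trees[OF graft(1)]
  note fin = rooted_tree_basic(1)[OF ST(1)] rooted_tree_basic(1)[OF ST(2)]
  note disj = graftable_disjoint[OF graft(1)]
  have rS: "rt S \<notin> children T v"
    using children_subset[OF ST(2)] disj rooted_tree_basic(2)[OF ST(1)] by blast
  have "(\<Sum>u\<in>verts T. card (children (graft S T v) u))
      = (\<Sum>u\<in>verts T. card (children T u) + (if u = v then 1 else 0))"
    using disj rS by (intro sum.cong) (auto simp: children_graft[OF graft(1)] finite_children[OF ST(2)])
  also have "\<dots> = (\<Sum>u\<in>verts T. card (children T u)) + 1"
    using fin graftable_vert[OF graft(1)] by (simp add: sum.distrib)
  finally have T: "(\<Sum>u\<in>verts T. card (children (graft S T v) u)) = \<dots>" .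
  have S: "(\<Sum>u\<in>verts S. card (children (graft S T v) u)) = (\<Sum>u\<in>verts S. card (children S u))"
    by (intro sum.cong) (auto simp: children_graft[OF graft(1)])
  show ?case
    using graft.IH fin disj by (simp add: sum.union_disjoint card_Un_disjoint S T)
qed (simp add: children_def)

text \<open>Every vertex lies on a descending path from the root.\<close>

lemma children_closed_superset:
  assumes T: "rooted_tree T" and "rt T \<in> X" "\<And>v. v \<in> X \<Longrightarrow> children T v \<subseteq> X"
  shows "verts T \<subseteq> X"
proof -
  have "\<forall>X. rt T \<in> X \<and> (\<forall>v\<in>X. children T v \<subseteq> X) \<longrightarrow> verts T \<subseteq> X"
    using T
  proof (induction rule: rooted_tree_induct)
    case (graft S T v)
    note g = graft(1)
    note ST = graftable_trees[OF g]
    show ?case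
    proof (intro allI impI, elim conjE)
      fix X assume r: "rt (graft S T v) \<in> X" and X: "\<forall>u\<in>X. children (graft S T v) u \<subseteq> X"
      have "children T u \<subseteq> X \<inter> verts T" if "u \<in> X \<inter> verts T" for u
        using X that children_subset[OF ST(2)] graftable_disjoint[OF g]
        by (fastforce simp: children_graft[OF g] split: if_splits)
      then have "verts T \<subseteq> X \<inter> verts T"
        using graft.IH(2)[rule_format, of "X \<inter> verts T"] r rooted_tree_basic(2)[OF ST(2)] by simp
      then have T: "verts T \<subseteq> X" by blast
      then have "rt S \<in> X" using X rt_scion_in_children[OF g] graftable_vert[OF g] by blast
      moreover have "children S u \<subseteq> X \<inter> verts S" if "u \<in> X \<inter> verts S" for u
        using X that children_subset[OF ST(1)] by (fastforce simp: children_graft[OF g])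
      ultimately have "verts S \<subseteq> X \<inter> verts S"
        using graft.IH(1)[rule_format, of "X \<inter> verts S"] rooted_tree_basic(2)[OF ST(1)] by simp
      then show "verts (graft S T v) \<subseteq> X" using T by auto
    qed
  qed simp
  then show ?thesis using assms by blast
qed


section \<open>Transport of trees along bijections\<close>

definition map_graph :: "('a \<Rightarrow> 'b) \<Rightarrow> 'a rgraph \<Rightarrow> 'b rgraph" where
  "map_graph p T = \<lparr>verts = p ` verts T, edges = (\<lambda>e. p ` e) ` edges T, rt = p (rt T)\<rparr>"

lemma map_graph_simps [simp]:
  "verts (map_graph p T) = p ` verts T"
  "edges (map_graph p T) = (\<lambda>e. p ` e) ` edges T"
  "rt (map_graph p T) = p (rt T)"
  by (simp_all add: map_graph_def)

lemma is_iso_iff_map_graph: "is_iso T T' p \<longleftrightarrow> inj_on p (verts T) \<and> T' = map_graph p T"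
  unfolding is_iso_def bij_betw_def map_graph_def by (cases T') auto

lemma map_graph_cong:
  assumes "rooted_tree T" "\<And>x. x \<in> verts T \<Longrightarrow> p x = q x"
  shows "map_graph p T = map_graph q T"
proof -
  have "p ` e = q ` e" if "e \<in> edges T" for e
    using assms(2) rooted_tree_edge_subset[OF assms(1) that] by (intro image_cong) auto
  then show ?thesis
    using assms rooted_tree_basic(2)[OF assms(1)] unfolding map_graph_def by (simp cong: image_cong)
qed

lemma map_graph_comp: "map_graph p (map_graph q T) = map_graph (p \<circ> q) T"
  unfolding map_graph_def by (simp add: image_image image_comp)

lemma map_graph_ident:
  assumes "rooted_tree T" "\<And>x. x \<in> verts T \<Longrightarrow> p x = x"
  shows "map_graph p T = T"
proof -
  have "map_graph p T = map_graph (\<lambda>x. x) T" using assms by (intro map_graph_cong) auto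
  also have "\<dots> = T" unfolding map_graph_def by (cases T) simp
  finally show ?thesis .
qed

lemma map_graph_graft: "map_graph p (graft S T v) = graft (map_graph p S) (map_graph p T) (p v)"
  unfolding map_graph_def graft_def by (simp add: image_Un)

lemma rooted_tree_map_graph:
  assumes "rooted_tree T" "inj_on p (verts T)"
  shows "rooted_tree (map_graph p T)"
proof -
  have "inj_on p (verts T) \<longrightarrow> rooted_tree (map_graph p T)"
    using assms(1)
  proof (induction rule: rooted_tree_induct)
    case (singleton r)
    then show ?case by (auto simp: rooted_tree_iff_bridges)
  next
    case (graft S T v)
    show ?case
    proof
      assume inj: "inj_on p (verts (graft S T v))"
      then have "p ` verts S \<inter> p ` verts T = {}"
        using graftable_disjoint[OF graft(1)] by (auto simp: inj_on_def)
      then have "graftable (map_graph p S) (map_graph p T) (p v)"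
        using graft inj graftable_vert[OF graft(1)] unfolding graftable_def by (auto simp: inj_on_Un)
      then show "rooted_tree (map_graph p (graft S T v))"
        unfolding map_graph_graft by (rule rooted_tree_graft)
    qed
  qed
  then show ?thesis using assms(2) by blast
qed

lemma graftable_map_graph:
  assumes "graftable S T v" "inj_on p (verts S \<union> verts T)"
  shows "graftable (map_graph p S) (map_graph p T) (p v)"
  using assms unfolding graftable_def
  by (auto simp: inj_on_Un intro: rooted_tree_map_graph)

text \<open>Cutting commutes with relabelling because grafting visibly does.\<close>

lemma parts_map_graph:
  assumes T: "rooted_tree T" "inj_on p (verts T)" "e \<in> edges T"
  shows "upper_part (map_graph p T) (p ` e) = map_graph p (upper_part T e)"
    "lower_part (map_graph p T) (p ` e) = map_graph p (lower_part T e)"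
proof -
  obtain v where v: "graftable (lower_part T e) (upper_part T e) v"
    "e = {v, rt (lower_part T e)}" "T = graft (lower_part T e) (upper_part T e) v"
    using cut_edge[OF T(1,3)] by metis
  have "verts T = verts (lower_part T e) \<union> verts (upper_part T e)"
    by (subst v(3)) simp
  then have g: "graftable (map_graph p (lower_part T e)) (map_graph p (upper_part T e)) (p v)"
    using graftable_map_graph[OF v(1)] T(2) by simp
  have e: "p ` e = {p v, rt (map_graph p (lower_part T e))}"
    by (subst v(2)) simp
  have m: "map_graph p T = graft (map_graph p (lower_part T e)) (map_graph p (upper_part T e)) (p v)"
    by (subst v(3)) (rule map_graph_graft)
  show "upper_part (map_graph p T) (p ` e) = map_graph p (upper_part T e)"
    unfolding m e by (rule upper_part_graft[OF g])
  show "lower_part (map_graph p T) (p ` e) = map_graph p (lower_part T e)"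
    unfolding m e by (rule lower_part_graft[OF g])
qed

lemma isomorphicE:
  assumes "isomorphic T T'"
  obtains p where "inj_on p (verts T)" "T' = map_graph p T"
  using assms unfolding isomorphic_def is_iso_iff_map_graph by blast

lemma isomorphic_map_graph: "inj_on p (verts T) \<Longrightarrow> isomorphic T (map_graph p T)"
  unfolding isomorphic_def is_iso_iff_map_graph by blast

lemma isomorphic_card: "isomorphic T T' \<Longrightarrow> card (verts T') = card (verts T)"
  by (elim isomorphicE) (simp add: card_image)


section \<open>The series of a tree\<close>

lemma fold_deriv_insert:
  assumes "finite C" "w \<notin> C"
  shows "Finite_Set.fold (\<lambda>w. mps_deriv (l w)) f (insert w C)
    = mps_deriv (l w) (Finite_Set.fold (\<lambda>w. mps_deriv (l w)) (f :: ('v, 'a :: comm_ring_1) mps) C)"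
  by (rule comp_fun_commute_on.fold_insert[OF
        comp_fun_commute_mps_deriv[unfolded comp_fun_commute_def'] _ assms]) simp

lemma order_ge_fold_deriv:
  assumes "order_ge d f" "finite C"
  shows "order_ge (d - card C) (Finite_Set.fold (\<lambda>w. mps_deriv (l w)) f C)"
  using assms(2)
proof induction
  case (insert w C)
  then show ?case using order_ge_deriv[OF insert.IH] by (simp add: fold_deriv_insert)
qed (simp add: assms)

lemma in_vars_fold_deriv:
  assumes "in_vars X f" "finite C"
  shows "in_vars X (Finite_Set.fold (\<lambda>w. mps_deriv (l w)) f C)"
  using assms(2) by induction (simp_all add: assms fold_deriv_insert in_vars_deriv)

text \<open>Each vertex contributes order at least \<open>2\<close>, and each of the \<open>v(T) - 1\<close> edges lowers it by one.\<close>

lemma order_ge_label_series: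
  assumes T: "rooted_tree T" and l: "\<And>v. v \<in> verts T \<Longrightarrow> H (l v) \<in> higher n"
  shows "order_ge (Suc (card (verts T))) (label_series H T l)"
proof -
  have "order_ge (\<Sum>v\<in>verts T. 2 - card (children T v)) (label_series H T l)"
    unfolding label_series_def
    by (intro order_ge_prod order_ge_fold_deriv finite_children[OF T]) (use l higher_iff in blast)
  moreover have "(\<Sum>v\<in>verts T. 2) \<le> (\<Sum>v\<in>verts T. (2 - card (children T v)) + card (children T v))"
    by (rule sum_mono) simp
  then have "Suc (card (verts T)) \<le> (\<Sum>v\<in>verts T. 2 - card (children T v))"
    using sum_card_children[OF T] by (simp add: sum.distrib)
  ultimately show ?thesis by (rule order_ge_mono)
qed

lemma in_vars_label_series:
  assumes T: "rooted_tree T" and l: "\<And>v. v \<in> verts T \<Longrightarrow> H (l v) \<in> higher n"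
  shows "in_vars {1..n} (label_series H T l)"
  unfolding label_series_def
  by (intro in_vars_prod in_vars_fold_deriv finite_children[OF T]) (use l higher_iff in blast)

lemma label_series_cong:
  assumes "rooted_tree T" "\<And>v. v \<in> verts T \<Longrightarrow> l v = l' v"
  shows "label_series H T l = label_series H T l'"
  using is_iso_label_series[OF assms(1) assms(1), of id l l' H] assms
  by (simp add: is_iso_def)

text \<open>By the Leibniz rule, differentiating the series of \<open>T\<close> amounts to attaching a new child to each
  vertex of \<open>T\<close> in turn.\<close>

lemma sum_label_series_graft:
  assumes S: "rooted_tree S" and T: "rooted_tree T" and disj: "verts S \<inter> verts T = {}"
  shows "(\<Sum>v\<in>verts T. label_series H (graft S T v) l)
    = label_series H S l * mps_deriv (l (rt S)) (label_series H T l)"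
proof -
  let ?Q = "\<lambda>T v. Finite_Set.fold (\<lambda>w. mps_deriv (l w)) (H (l v)) (children T v)"
  note fin = rooted_tree_basic(1)[OF S] rooted_tree_basic(1)[OF T]
  have "label_series H (graft S T v) l
      = label_series H S l * (mps_deriv (l (rt S)) (?Q T v) * (\<Prod>u\<in>verts T - {v}. ?Q T u))"
    if v: "v \<in> verts T" for v
  proof -
    have g: "graftable S T v" using S T disj v unfolding graftable_def by blast
    have "rt S \<notin> children T v"
      using children_subset[OF T] disj rooted_tree_basic(2)[OF S] by blast
    then have Qv: "?Q (graft S T v) v = mps_deriv (l (rt S)) (?Q T v)"
      using v disj by (auto simp: children_graft[OF g] fold_deriv_insert finite_children[OF T])
    have "(\<Prod>u\<in>verts S. ?Q (graft S T v) u) = label_series H S l"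
      unfolding label_series_def by (intro prod.cong) (simp_all add: children_graft[OF g])
    moreover have "(\<Prod>u\<in>verts T - {v}. ?Q (graft S T v) u) = (\<Prod>u\<in>verts T - {v}. ?Q T u)"
      using disj by (intro prod.cong) (auto simp: children_graft[OF g])
    ultimately show ?thesis
      using fin disj v Qv unfolding label_series_def graft_simps
      by (simp add: prod.union_disjoint prod.remove[of "verts T" v])
  qed
  then show ?thesis
    unfolding mps_deriv_prod[OF fin(2)] label_series_def[of H T] by (simp add: sum_distrib_left)
qed

lemma finite_labelings: "finite A \<Longrightarrow> finite {l. l \<in> A \<rightarrow>\<^sub>E {1..n :: nat} \<and> P l}"
  by (rule finite_subset[of _ "A \<rightarrow>\<^sub>E {1..n}"]) (auto intro: finite_PiE)

text \<open>A labelling of a graft is a pair of labellings; the label \<open>j\<close> of the root of the scion selects the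
  component of the vector field and the derivative \<open>D\<^sub>j\<close> that the new edge brings about.\<close>

lemma sum_tree_series_graft:
  assumes S: "rooted_tree S" and T: "rooted_tree T" and disj: "verts S \<inter> verts T = {}"
  shows "(\<Sum>v\<in>verts T. tree_series n H (graft S T v) i)
    = vector_field n (tree_series n H S) (tree_series n H T i)"
proof -
  note fin = rooted_tree_basic(1)[OF S] rooted_tree_basic(1)[OF T]
  have rt: "rt S \<in> verts S" "rt T \<in> verts T" "rt T \<notin> verts S"
    using rooted_tree_basic(2)[OF S] rooted_tree_basic(2)[OF T] disj by auto
  define L where "L = {l. l \<in> verts S \<union> verts T \<rightarrow>\<^sub>E {1..n} \<and> l (rt T) = i}"
  define L1 where "L1 = verts S \<rightarrow>\<^sub>E {1..n}"
  define L2 where "L2 = {l. l \<in> verts T \<rightarrow>\<^sub>E {1..n} \<and> l (rt T) = i}"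
  have finL: "finite L" "finite L1" "finite L2"
    unfolding L_def L1_def L2_def using fin by (auto intro!: finite_labelings finite_PiE)
  have "(\<Sum>v\<in>verts T. tree_series n H (graft S T v) i)
      = (\<Sum>l\<in>L. \<Sum>v\<in>verts T. label_series H (graft S T v) l)"
    unfolding tree_series_def graft_simps L_def by (rule sum.swap)
  also have "\<dots> = (\<Sum>l\<in>L. label_series H S l * mps_deriv (l (rt S)) (label_series H T l))"
    by (simp add: sum_label_series_graft[OF S T disj])
  also have "\<dots> = (\<Sum>(l1, l2)\<in>L1 \<times> L2. label_series H S l1 * mps_deriv (l1 (rt S)) (label_series H T l2))"
  proof (rule sum.reindex_bij_witness[where j = "\<lambda>l. (restrict l (verts S), restrict l (verts T))"
        and i = "\<lambda>(l1, l2) x. if x \<in> verts S then l1 x else l2 x"], goal_cases)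
    case (1 l)
    then show ?case unfolding L_def by (auto simp: fun_eq_iff PiE_def extensional_def)
  next
    case (2 l)
    then show ?case unfolding L_def L1_def L2_def using rt by auto
  next
    case (3 p)
    then show ?case unfolding L1_def L2_def using disj
      by (auto simp: fun_eq_iff PiE_def extensional_def)
  next
    case (4 p)
    then show ?case unfolding L_def L1_def L2_def using rt by (auto simp: PiE_def extensional_def Pi_def)
  next
    case (5 l)
    have "label_series H S (restrict l (verts S)) = label_series H S l"
      "label_series H T (restrict l (verts T)) = label_series H T l"
      by (auto intro: label_series_cong S T)
    then show ?case using rt by simp
  qed
  also have "\<dots> = (\<Sum>l1\<in>L1. label_series H S l1 * mps_deriv (l1 (rt S)) (tree_series n H T i))"
    unfolding tree_series_def L2_def[symmetric]
    by (simp add: sum.cartesian_product[symmetric] mps_deriv_sum sum_distrib_left)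
  also have "\<dots> = (\<Sum>j\<in>{1..n}. \<Sum>l1\<in>{l1 \<in> L1. l1 (rt S) = j}.
      label_series H S l1 * mps_deriv (l1 (rt S)) (tree_series n H T i))"
    using rt unfolding L1_def by (intro sum.group[symmetric] finL(2)[unfolded L1_def]) auto
  also have "\<dots> = vector_field n (tree_series n H S) (tree_series n H T i)"
    unfolding vector_field_def tree_series_def[of n H S] sum_distrib_right
    by (intro sum.cong) (auto simp: L1_def)
  finally show ?thesis .
qed


section \<open>Sums over labelled trees\<close>

definition trees_on :: "'a set \<Rightarrow> 'a rgraph set" where
  "trees_on X = {T. rooted_tree T \<and> verts T = X}"

lemma finite_trees_on: "finite X \<Longrightarrow> finite (trees_on X)"
proof (rule finite_subset)
  show "trees_on X \<subseteq> (\<lambda>(E, r). \<lparr>verts = X, edges = E, rt = r\<rparr>) ` (Pow (Pow X) \<times> X)"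
  proof
    fix T assume "T \<in> trees_on X"
    then have "T = (\<lambda>(E, r). \<lparr>verts = X, edges = E, rt = r\<rparr>) (edges T, rt T)"
      "edges T \<subseteq> Pow X" "rt T \<in> X"
      unfolding trees_on_def using rooted_tree_edge_subset[of T] rooted_tree_basic(2)[of T] by auto
    then show "T \<in> (\<lambda>(E, r). \<lparr>verts = X, edges = E, rt = r\<rparr>) ` (Pow (Pow X) \<times> X)" by blast
  qed
qed auto

definition iso_invariant :: "('a rgraph \<Rightarrow> 'b) \<Rightarrow> bool" where
  "iso_invariant \<psi> \<longleftrightarrow> (\<forall>T p. rooted_tree T \<longrightarrow> inj_on p (verts T) \<longrightarrow> \<psi> (map_graph p T) = \<psi> T)"

text \<open>Summing over all labelled trees on \<open>X\<close>, rather than over isomorphism classes, makes automorphism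
  groups disappear from the combinatorics of cutting and grafting.\<close>

definition labelled_sum ::
  "nat \<Rightarrow> (nat \<Rightarrow> (nat, complex) mps) \<Rightarrow> ('a rgraph \<Rightarrow> rat) \<Rightarrow> 'a set \<Rightarrow> nat \<Rightarrow> (nat, complex) mps" where
  "labelled_sum n H \<psi> X i = (\<Sum>T\<in>trees_on X. mps_const (of_rat (\<psi> T)) * tree_series n H T i)"

lemma labelled_sum_card_eq:
  assumes "iso_invariant \<psi>" "finite X" "finite Y" "card X = card Y"
  shows "labelled_sum n H \<psi> X i = labelled_sum n H \<psi> Y i"
proof -
  obtain p where p: "bij_betw p X Y" using assms(2-4) by (metis finite_same_card_bij)
  define q where "q = inv_into X p"
  have q: "bij_betw q Y X" unfolding q_def by (rule bij_betw_inv_into[OF p])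
  have pq: "q (p x) = x" if "x \<in> X" for x
    using p that unfolding q_def bij_betw_def by simp
  have qp: "p (q x) = x" if "x \<in> Y" for x
    using p that unfolding q_def bij_betw_def by (simp add: f_inv_into_f)
  show ?thesis
    unfolding labelled_sum_def
  proof (rule sum.reindex_bij_witness[where j = "map_graph p" and i = "map_graph q"], goal_cases)
    case (1 T)
    then show ?case unfolding map_graph_comp trees_on_def by (intro map_graph_ident) (auto simp: pq)
  next
    case (2 T)
    then show ?case using p unfolding trees_on_def bij_betw_def by (auto intro: rooted_tree_map_graph)
  next
    case (3 T)
    then show ?case unfolding map_graph_comp trees_on_def by (intro map_graph_ident) (auto simp: qp)
  next
    case (4 T)
    then show ?case using q unfolding trees_on_def bij_betw_def by (auto intro: rooted_tree_map_graph)
  next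
    case (5 T)
    then have T: "rooted_tree T" "inj_on p (verts T)"
      using p unfolding trees_on_def bij_betw_def by auto
    then have "tree_series n H T i = tree_series n H (map_graph p T) i"
      using is_iso_tree_series[OF T(1) rooted_tree_map_graph[OF T], of p] is_iso_iff_map_graph by blast
    then show ?case using T assms(1) unfolding iso_invariant_def by simp
  qed
qed

text \<open>The product of weights that corresponds to applying one sum over trees, as a vector field, to
  another.\<close>

definition cut_conv :: "('a rgraph \<Rightarrow> rat) \<Rightarrow> ('a rgraph \<Rightarrow> rat) \<Rightarrow> 'a rgraph \<Rightarrow> rat" where
  "cut_conv \<phi> \<psi> T = (\<Sum>e\<in>edges T. \<phi> (lower_part T e) * \<psi> (upper_part T e))"

lemma vector_field_bilinear:
  assumes "finite A" "finite B"
  shows "vector_field n (\<lambda>j. \<Sum>x\<in>A. mps_const (c x) * f x j) (\<Sum>y\<in>B. mps_const (d y) * g y)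
    = (\<Sum>x\<in>A. \<Sum>y\<in>B. mps_const (c x * d y) * vector_field n (f x) (g y))"
proof -
  have c: "mps_const a * u * (mps_const b * v) = mps_const (a * b) * (u * v)"
    for a b and u v :: "(nat, complex) mps"
    by (metis (no_types, lifting) mps_const_simps(3) mult.assoc mult.left_commute)
  have "vector_field n (\<lambda>j. \<Sum>x\<in>A. mps_const (c x) * f x j) (\<Sum>y\<in>B. mps_const (d y) * g y)
      = (\<Sum>j=1..n. \<Sum>x\<in>A. \<Sum>y\<in>B. mps_const (c x * d y) * (f x j * mps_deriv j (g y)))"
    unfolding vector_field_def mps_deriv_sum mps_deriv_const_times sum_product c ..
  also have "\<dots> = (\<Sum>x\<in>A. \<Sum>y\<in>B. \<Sum>j=1..n. mps_const (c x * d y) * (f x j * mps_deriv j (g y)))"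
    by (subst sum.swap, intro sum.cong refl, rule sum.swap)
  finally show ?thesis unfolding vector_field_def sum_distrib_left .
qed

text \<open>Cutting an edge and grafting are inverse bijections between pairs \<open>(U, e)\<close> of a tree on \<open>Z\<close> with
  an edge and triples \<open>(S, T, v)\<close> of two trees on complementary subsets of \<open>Z\<close> with a vertex of the
  second one.\<close>

lemma vector_field_labelled_sum:
  assumes Z: "finite Z"
  shows "(\<Sum>X\<in>Pow Z. vector_field n (labelled_sum n H \<phi> X) (labelled_sum n H \<psi> (Z - X) i))
    = labelled_sum n H (cut_conv \<phi> \<psi>) Z i"
proof -
  let ?c = "\<lambda>S T. mps_const (of_rat (\<phi> S) * of_rat (\<psi> T)) :: (nat, complex) mps"
  let ?P = "\<lambda>T. tree_series n H T i"
  have fin: "finite (trees_on X)" "finite X" if "X \<subseteq> Z" for X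
    using that Z finite_subset finite_trees_on by blast+
  have "(\<Sum>X\<in>Pow Z. vector_field n (labelled_sum n H \<phi> X) (labelled_sum n H \<psi> (Z - X) i))
      = (\<Sum>X\<in>Pow Z. \<Sum>S\<in>trees_on X. \<Sum>T\<in>trees_on (Z - X).
          ?c S T * vector_field n (tree_series n H S) (?P T))"
    unfolding labelled_sum_def by (intro sum.cong refl vector_field_bilinear fin) auto
  also have "\<dots> = (\<Sum>X\<in>Pow Z. \<Sum>S\<in>trees_on X. \<Sum>T\<in>trees_on (Z - X). \<Sum>v\<in>Z - X. ?c S T * ?P (graft S T v))"
  proof (intro sum.cong refl)
    fix X S T assume "X \<in> Pow Z" "S \<in> trees_on X" "T \<in> trees_on (Z - X)"
    then show "?c S T * vector_field n (tree_series n H S) (?P T)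
        = (\<Sum>v\<in>Z - X. ?c S T * ?P (graft S T v))"
      unfolding trees_on_def
      by (subst sum_tree_series_graft[symmetric]) (auto simp: sum_distrib_left)
  qed
  also have "\<dots> = (\<Sum>(X, S, T, v)\<in>(SIGMA X:Pow Z. trees_on X \<times> trees_on (Z - X) \<times> (Z - X)).
      ?c S T * ?P (graft S T v))"
    using Z by (subst sum.Sigma[symmetric]) (auto simp: sum.cartesian_product fin)
  also have "\<dots> = (\<Sum>(U, e)\<in>(SIGMA U:trees_on Z. edges U).
      ?c (lower_part U e) (upper_part U e) * ?P U)"
    \<comment> \<open>The definite description recovers the grafting vertex as the end of \<open>e\<close> in the upper part.\<close>
  proof (rule sum.reindex_bij_witness[where j = "\<lambda>(X, S, T, v). (graft S T v, {v, rt S})"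
        and i = "\<lambda>(U, e). (verts (lower_part U e), lower_part U e, upper_part U e,
          THE v. v \<in> verts (upper_part U e) \<and> e = {v, rt (lower_part U e)})"], goal_cases)
    case (1 x)
    then obtain X S T v where x: "x = (X, S, T, v)" and g: "graftable S T v" "X = verts S"
      unfolding trees_on_def graftable_def by auto
    have "rt S \<notin> verts T"
      using graftable_disjoint[OF g(1)] rooted_tree_basic(2)[OF graftable_trees(1)[OF g(1)]] by blast
    then have "(THE u. u \<in> verts T \<and> {v, rt S} = {u, rt S}) = v"
      using graftable_vert[OF g(1)] by (intro the_equality) (auto simp: doubleton_eq_iff)
    then show ?case using x g by (simp add: lower_part_graft upper_part_graft)
  next
    case (2 x)
    then obtain X S T v where x: "x = (X, S, T, v)" and g: "graftable S T v"
      and "verts S \<subseteq> Z" "verts T = Z - verts S"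
      unfolding trees_on_def graftable_def by auto
    then have "verts S \<union> verts T = Z" by auto
    then show ?case using x rooted_tree_graft[OF g(1)] by (simp add: trees_on_def)
  next
    case (3 y)
    then obtain U e where y: "y = (U, e)" and U: "rooted_tree U" "e \<in> edges U" "verts U = Z"
      unfolding trees_on_def by auto
    obtain v where v: "graftable (lower_part U e) (upper_part U e) v"
      "e = {v, rt (lower_part U e)}" "U = graft (lower_part U e) (upper_part U e) v"
      using cut_edge[OF U(1,2)] by metis
    have "rt (lower_part U e) \<notin> verts (upper_part U e)"
      using graftable_disjoint[OF v(1)] rooted_tree_basic(2)[OF graftable_trees(1)[OF v(1)]] by blast
    then have "(THE v. v \<in> verts (upper_part U e) \<and> e = {v, rt (lower_part U e)}) = v"
      using graftable_vert[OF v(1)] v(2) by (intro the_equality) (auto simp: doubleton_eq_iff)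
    then show ?case using y v by simp
  next
    case (4 y)
    then obtain U e where y: "y = (U, e)" and U: "rooted_tree U" "e \<in> edges U" "verts U = Z"
      unfolding trees_on_def by auto
    obtain v where v: "graftable (lower_part U e) (upper_part U e) v"
      "e = {v, rt (lower_part U e)}" "U = graft (lower_part U e) (upper_part U e) v"
      using cut_edge[OF U(1,2)] by metis
    have "rt (lower_part U e) \<notin> verts (upper_part U e)"
      using graftable_disjoint[OF v(1)] rooted_tree_basic(2)[OF graftable_trees(1)[OF v(1)]] by blast
    then have the: "(THE v. v \<in> verts (upper_part U e) \<and> e = {v, rt (lower_part U e)}) = v"
      using graftable_vert[OF v(1)] v(2) by (intro the_equality) (auto simp: doubleton_eq_iff)
    have "verts (lower_part U e) \<union> verts (upper_part U e) = Z"
      using arg_cong[OF v(3), of verts] U(3) by simp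
    then have "verts (lower_part U e) \<subseteq> Z" "verts (upper_part U e) = Z - verts (lower_part U e)"
      using graftable_disjoint[OF v(1)] by auto
    then show ?case
      using y the graftable_vert[OF v(1)] graftable_trees[OF v(1)] by (simp add: trees_on_def)
  next
    case (5 x)
    then obtain X S T v where "x = (X, S, T, v)" "graftable S T v"
      unfolding trees_on_def graftable_def by auto
    then show ?case by (simp add: lower_part_graft upper_part_graft)
  qed
  also have "\<dots> = (\<Sum>U\<in>trees_on Z. \<Sum>e\<in>edges U. ?c (lower_part U e) (upper_part U e) * ?P U)"
    using finite_trees_on[OF Z] by (subst sum.Sigma) (auto simp: trees_on_def rooted_tree_basic(4))
  also have "\<dots> = labelled_sum n H (cut_conv \<phi> \<psi>) Z i"
    unfolding labelled_sum_def cut_conv_def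
    by (intro sum.cong refl) (simp add: mps_const_sum_left of_rat_sum of_rat_mult)
  finally show ?thesis .
qed

lemma sum_Pow_card:
  fixes f :: "nat \<Rightarrow> (nat, complex) mps"
  assumes "finite Z"
  shows "(\<Sum>X\<in>Pow Z. f (card X)) = (\<Sum>s\<le>card Z. mps_const (of_nat (card Z choose s)) * f s)"
proof -
  have "(\<Sum>X\<in>Pow Z. f (card X)) = (\<Sum>s\<le>card Z. \<Sum>X\<in>{X \<in> Pow Z. card X = s}. f (card X))"
    using assms by (intro sum.group[symmetric]) (auto intro: card_mono)
  also have "\<dots> = (\<Sum>s\<le>card Z. mps_const (of_nat (card Z choose s)) * f s)"
  proof (intro sum.cong refl)
    fix s
    have "(\<Sum>X\<in>{X \<in> Pow Z. card X = s}. f (card X)) = (\<Sum>X\<in>{X \<in> Pow Z. card X = s}. mps_const 1 * f s)"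
      by (intro sum.cong) (auto simp: mps_const_simps)
    then show "(\<Sum>X\<in>{X \<in> Pow Z. card X = s}. f (card X)) = mps_const (of_nat (card Z choose s)) * f s"
      unfolding mps_const_sum_left using n_subsets[OF assms, of s] by simp
  qed
  finally show ?thesis .
qed

text \<open>The contribution of the trees with \<open>m\<close> vertices to \<open>\<Sum>\<^sub>T \<psi>\<^sub>T \<P>\<^sub>T\<close>; that \<open>1 / m!\<close> accounts for the
  factors \<open>1 / \<alpha>\<^sub>T\<close> is \<open>size_part_eq_sum_tree_P\<close> below.\<close>

definition size_part ::
  "nat \<Rightarrow> (nat \<Rightarrow> (nat, complex) mps) \<Rightarrow> (nat rgraph \<Rightarrow> rat) \<Rightarrow> nat \<Rightarrow> nat \<Rightarrow> (nat, complex) mps" where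
  "size_part n H \<psi> m i = mps_const (1 / fact m) * labelled_sum n H \<psi> {..<m} i"

definition tree_sum ::
  "nat \<Rightarrow> (nat \<Rightarrow> (nat, complex) mps) \<Rightarrow> (nat rgraph \<Rightarrow> rat) \<Rightarrow> nat \<Rightarrow> (nat, complex) mps" where
  "tree_sum n H \<psi> i = mps_sum (\<lambda>m. size_part n H \<psi> m i)"

text \<open>A set with \<open>m\<close> elements splits into parts of sizes \<open>s\<close> and \<open>m - s\<close> in \<open>m choose s\<close> ways, which
  the factors \<open>1 / m!\<close> absorb.\<close>

lemma size_part_cut_conv:
  assumes "iso_invariant \<phi>" "iso_invariant \<psi>"
  shows "size_part n H (cut_conv \<phi> \<psi>) m i
    = (\<Sum>s\<le>m. vector_field n (size_part n H \<phi> s) (size_part n H \<psi> (m - s) i))"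
proof -
  let ?f = "\<lambda>s. vector_field n (labelled_sum n H \<phi> {..<s}) (labelled_sum n H \<psi> {..<m - s} i)"
  have scale: "vector_field n (\<lambda>j. mps_const a * f j) (mps_const b * g)
      = mps_const (a * b) * vector_field n f g" for a b f g
    using vector_field_bilinear[of "{()}" "{()}" n "\<lambda>_. a" "\<lambda>_. f" "\<lambda>_. b" "\<lambda>_. g"] by simp
  have "(\<Sum>X\<in>Pow {..<m}. vector_field n (labelled_sum n H \<phi> X) (labelled_sum n H \<psi> ({..<m} - X) i))
      = (\<Sum>X\<in>Pow {..<m}. ?f (card X))"
  proof (intro sum.cong refl)
    fix X assume X: "X \<in> Pow {..<m}"
    then have "finite X" using finite_subset by auto
    then have "labelled_sum n H \<phi> X = labelled_sum n H \<phi> {..<card X}"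
      "labelled_sum n H \<psi> ({..<m} - X) = labelled_sum n H \<psi> {..<m - card X}"
      using X assms by (auto intro!: ext labelled_sum_card_eq simp: card_Diff_subset)
    then show "vector_field n (labelled_sum n H \<phi> X) (labelled_sum n H \<psi> ({..<m} - X) i) = ?f (card X)"
      by simp
  qed
  then have "size_part n H (cut_conv \<phi> \<psi>) m i
      = mps_const (1 / fact m) * (\<Sum>s\<le>m. mps_const (of_nat (m choose s)) * ?f s)"
    unfolding size_part_def vector_field_labelled_sum[OF finite_lessThan, symmetric]
    using sum_Pow_card[of "{..<m}" ?f] by simp
  also have "\<dots> = (\<Sum>s\<le>m. vector_field n (size_part n H \<phi> s) (size_part n H \<psi> (m - s) i))"
    unfolding sum_distrib_left size_part_def scale
    by (intro sum.cong refl) (simp add: mps_const_simps binomial_fact)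
  finally show ?thesis .
qed

lemma order_ge_size_part:
  assumes "H \<in> {1..n} \<rightarrow> higher n"
  shows "order_ge (Suc m) (size_part n H \<psi> m i)"
  unfolding size_part_def labelled_sum_def tree_series_def
proof (intro order_ge_linear order_ge_sum)
  fix T :: "nat rgraph" and l assume "T \<in> trees_on {..<m}" "l \<in> {l. l \<in> verts T \<rightarrow>\<^sub>E {1..n} \<and> l (rt T) = i}"
  then show "order_ge (Suc m) (label_series H T l)"
    using order_ge_label_series[of T H l n] assms unfolding trees_on_def by (fastforce simp: PiE_iff)
qed

lemma in_vars_size_part:
  assumes "H \<in> {1..n} \<rightarrow> higher n"
  shows "in_vars {1..n} (size_part n H \<psi> m i)"
  unfolding size_part_def labelled_sum_def tree_series_def
proof (intro in_vars_const_times in_vars_sum)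
  fix T :: "nat rgraph" and l assume "T \<in> trees_on {..<m}" "l \<in> {l. l \<in> verts T \<rightarrow>\<^sub>E {1..n} \<and> l (rt T) = i}"
  then show "in_vars {1..n} (label_series H T l)"
    using in_vars_label_series[of T H l n] assms unfolding trees_on_def by (fastforce simp: PiE_iff)
qed

lemma order_ge_vector_field:
  assumes "\<And>j. j \<in> {1..n} \<Longrightarrow> order_ge d (a j)" "order_ge e g"
  shows "order_ge (d + (e - 1)) (vector_field n a g)"
  unfolding vector_field_def
  using assms order_ge_deriv[OF assms(2)] by (intro order_ge_sum order_ge_mult) auto

text \<open>Each summand on the right has one difference as a factor, so its order is high if both pairs of
  arguments agree to high order.\<close>

lemma vector_field_diff:
  "vector_field n a f - vector_field n b g
    = vector_field n a (f - g) + vector_field n (\<lambda>j. a j - b j) g"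
  unfolding vector_field_def by (simp add: mps_deriv_diff algebra_simps sum.distrib sum_subtractf)

lemma tree_sum_truncate:
  assumes "H \<in> {1..n} \<rightarrow> higher n"
  shows "order_ge (Suc N) (tree_sum n H \<psi> i - (\<Sum>m<N. size_part n H \<psi> m i))"
  unfolding tree_sum_def using order_ge_size_part[OF assms] by (intro order_ge_mps_sum_truncate) blast

lemma size_part_0: "size_part n H \<psi> 0 i = 0"
proof -
  have "trees_on {} = ({} :: nat rgraph set)" unfolding trees_on_def using rooted_tree_basic(2) by fastforce
  then show ?thesis unfolding size_part_def labelled_sum_def by simp
qed

lemma tree_sum_higher:
  assumes "H \<in> {1..n} \<rightarrow> higher n"
  shows "tree_sum n H \<psi> i \<in> higher n"
proof -
  have "order_ge 2 (size_part n H \<psi> m i)" for m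
    using order_ge_size_part[OF assms, where m = m] size_part_0[of n H \<psi> i]
    by (cases m) (auto intro: order_ge_mono[where d = "Suc m"])
  moreover have "order_ge m (size_part n H \<psi> m i)" for m
    by (rule order_ge_mono[OF order_ge_size_part[OF assms]]) simp
  ultimately show ?thesis
    unfolding higher_iff tree_sum_def
    by (intro conjI in_vars_mps_sum order_ge_mps_sum in_vars_size_part[OF assms]; simp)
qed

text \<open>The composition law: modulo order \<open>N\<close> both sides are the sum of the contributions of pairs of
  trees with fewer than \<open>N\<close> vertices altogether.\<close>

lemma vector_field_tree_sum:
  assumes H: "H \<in> {1..n} \<rightarrow> higher n" and inv: "iso_invariant \<phi>" "iso_invariant \<psi>"
  shows "vector_field n (tree_sum n H \<phi>) (tree_sum n H \<psi> i) = tree_sum n H (cut_conv \<phi> \<psi>) i"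
proof (rule mps_eq_if_order_ge)
  fix N
  let ?a = "tree_sum n H \<phi>" and ?b = "tree_sum n H \<psi> i"
  let ?a' = "\<lambda>j. \<Sum>s<N. size_part n H \<phi> s j" and ?b' = "\<Sum>t<N. size_part n H \<psi> t i"
  let ?V = "\<lambda>s t. vector_field n (size_part n H \<phi> s) (size_part n H \<psi> t i)"
  have V: "order_ge (s + t) (?V s t)" for s t
    using order_ge_vector_field[of n "Suc s" "size_part n H \<phi> s" "Suc t"] order_ge_size_part[OF H]
    by (auto intro: order_ge_mono[where d = "Suc (s + t)"])
  have "order_ge N (vector_field n ?a ?b - vector_field n ?a' ?b')"
    unfolding vector_field_diff
  proof (rule order_ge_linear)
    have "order_ge (2 + (Suc N - 1)) (vector_field n ?a (?b - ?b'))"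
      using tree_sum_truncate[OF H] tree_sum_higher[OF H]
      by (intro order_ge_vector_field) (auto simp: higher_iff)
    then show "order_ge N (vector_field n ?a (?b - ?b'))" by (rule order_ge_mono) simp
    have "order_ge 1 ?b'"
      by (intro order_ge_sum order_ge_mono[OF order_ge_size_part[OF H]]) simp
    then have "order_ge (Suc N + (1 - 1)) (vector_field n (\<lambda>j. ?a j - ?a' j) ?b')"
      using tree_sum_truncate[OF H] by (intro order_ge_vector_field) auto
    then show "order_ge N (vector_field n (\<lambda>j. ?a j - ?a' j) ?b')" by (rule order_ge_mono) simp
  qed
  moreover have "order_ge N (vector_field n ?a' ?b' - (\<Sum>m<N. size_part n H (cut_conv \<phi> \<psi>) m i))"
  proof -
    have "vector_field n ?a' ?b' = (\<Sum>s<N. \<Sum>t<N. ?V s t)"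
      using vector_field_bilinear[of "{..<N}" "{..<N}" n "\<lambda>_. 1" "size_part n H \<phi>" "\<lambda>_. 1"
          "\<lambda>t. size_part n H \<psi> t i"] by (simp add: mps_const_simps)
    also have "\<dots> = (\<Sum>(s, t)\<in>{..<N} \<times> {..<N}. ?V s t)" by (simp add: sum.cartesian_product)
    also have "\<dots> = (\<Sum>(s, t)\<in>{(s, t). s + t < N}. ?V s t)
        + (\<Sum>(s, t)\<in>{..<N} \<times> {..<N} - {(s, t). s + t < N}. ?V s t)"
      by (subst add.commute, rule sum.subset_diff) auto
    also have "(\<Sum>(s, t)\<in>{(s, t). s + t < N}. ?V s t)
        = (\<Sum>(m, s)\<in>(SIGMA m:{..<N}. {..m}). ?V s (m - s))"
      by (rule sum.reindex_bij_witness[where j = "\<lambda>(s, t). (s + t, s)" and i = "\<lambda>(m, s). (s, m - s)"]) auto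
    also have "\<dots> = (\<Sum>m<N. size_part n H (cut_conv \<phi> \<psi>) m i)"
      unfolding size_part_cut_conv[OF inv] by (simp add: sum.Sigma)
    finally have "vector_field n ?a' ?b' - (\<Sum>m<N. size_part n H (cut_conv \<phi> \<psi>) m i)
        = (\<Sum>(s, t)\<in>{..<N} \<times> {..<N} - {(s, t). s + t < N}. ?V s t)" by simp
    moreover have "order_ge N \<dots>"
      by (intro order_ge_sum) (auto intro: order_ge_mono[OF V])
    ultimately show ?thesis by simp
  qed
  moreover have "order_ge N (tree_sum n H (cut_conv \<phi> \<psi>) i - (\<Sum>m<N. size_part n H (cut_conv \<phi> \<psi>) m i))"
    using tree_sum_truncate[OF H] by (rule order_ge_mono) auto
  ultimately show "order_ge N (vector_field n ?a ?b - tree_sum n H (cut_conv \<phi> \<psi>) i)"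
    unfolding order_ge_def by simp
qed


section \<open>Isomorphism classes and labelled trees\<close>

lemma rep_tree: "rooted_tree (rep_tree t)" "tree_class (rep_tree t) = t"
  using Quotient_rep_reflp[OF Quotient_tree, of t] Quotient_abs_rep[OF Quotient_tree, of t] by auto

lemma tree_class_eq_iff:
  assumes "rooted_tree T" "rooted_tree T'"
  shows "tree_class T = tree_class T' \<longleftrightarrow> isomorphic T T'"
  using Quotient_rel[OF Quotient_tree, of T T'] assms isomorphic_refl by auto

lemma tree_P_tree_class: "rooted_tree T \<Longrightarrow> tree_P n H (tree_class T) = normalized_tree_series n H T"
  using tree_P.abs_eq[of T n H] isomorphic_refl by auto

lemma isomorphic_iff_map_graph:
  "isomorphic T T' \<longleftrightarrow> (\<exists>p. inj_on p (verts T) \<and> T' = map_graph p T)"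
  unfolding isomorphic_def is_iso_iff_map_graph ..

lemma iso_invariant_isomorphic:
  "iso_invariant \<psi> \<Longrightarrow> rooted_tree T \<Longrightarrow> isomorphic T T' \<Longrightarrow> \<psi> T' = \<psi> T"
  unfolding isomorphic_iff_map_graph iso_invariant_def by blast

lemma iso_invariant_tree_class: "iso_invariant (\<lambda>T. \<phi> (tree_class T))"
  unfolding iso_invariant_def
proof (intro allI impI)
  fix T :: "nat rgraph" and p :: "nat \<Rightarrow> nat" assume T: "rooted_tree T" "inj_on p (verts T)"
  then have "tree_class T = tree_class (map_graph p T)"
    by (simp add: tree_class_eq_iff rooted_tree_map_graph isomorphic_map_graph)
  then show "\<phi> (tree_class (map_graph p T)) = \<phi> (tree_class T)" by simp
qed

definition tree_size :: "tree \<Rightarrow> nat" where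
  "tree_size t = card (verts (rep_tree t))"

lemma tree_size_tree_class: "rooted_tree T \<Longrightarrow> tree_size (tree_class T) = card (verts T)"
  unfolding tree_size_def using isomorphic_card tree_class_eq_iff rep_tree by metis

lemma tree_size_pos: "0 < tree_size t"
  unfolding tree_size_def using rooted_tree_basic(1,2)[OF rep_tree(1)] by (auto simp: card_gt_0_iff)

lemma tree_class_on_initial_segment:
  "\<exists>T \<in> trees_on {..<tree_size t}. tree_class T = t"
proof -
  obtain p where p: "bij_betw p (verts (rep_tree t)) {..<tree_size t}"
    using rooted_tree_basic(1)[OF rep_tree(1)] unfolding tree_size_def
    by (metis card_lessThan finite_lessThan finite_same_card_bij)
  then have inj: "inj_on p (verts (rep_tree t))" unfolding bij_betw_def by blast
  have "map_graph p (rep_tree t) \<in> trees_on {..<tree_size t}"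
    using p rooted_tree_map_graph[OF rep_tree(1) inj] unfolding trees_on_def bij_betw_def by simp
  moreover have "tree_class (map_graph p (rep_tree t)) = t"
    using iso_invariant_tree_class[of id] rep_tree inj unfolding iso_invariant_def by simp
  ultimately show ?thesis by blast
qed

lemma finite_tree_size_less: "finite {t. tree_size t < N}"
proof (rule finite_subset)
  show "{t. tree_size t < N} \<subseteq> (\<Union>m<N. tree_class ` trees_on {..<m})"
  proof
    fix t assume "t \<in> {t. tree_size t < N}"
    moreover obtain T where "T \<in> trees_on {..<tree_size t}" "tree_class T = t"
      using tree_class_on_initial_segment by blast
    ultimately show "t \<in> (\<Union>m<N. tree_class ` trees_on {..<m})" by blast
  qed
qed (simp add: finite_trees_on)

text \<open>Permuting the vertices acts transitively on the labelled trees of one isomorphism class, with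
  stabilizers of size \<open>\<alpha>\<^sub>T\<close>.\<close>

lemma card_labelled_copies:
  fixes T :: "'a rgraph"
  assumes T: "rooted_tree T"
  shows "card {T' \<in> trees_on (verts T). isomorphic T T'} * card (aut T) = fact (card (verts T))"
proof -
  let ?X = "verts T"
  let ?B = "{p \<in> ?X \<rightarrow>\<^sub>E ?X. inj_on p ?X}" and ?C = "{T' \<in> trees_on ?X. isomorphic T T'}"
  have fin: "finite ?X" by (rule rooted_tree_basic(1)[OF T])
  have finB: "finite ?B"
    using fin by (intro finite_subset[OF _ finite_PiE[of ?X "\<lambda>_. ?X"]]) auto
  have bij: "p ` ?X = ?X" if "p \<in> ?B" for p
    using that fin by (intro endo_inj_surj) auto
  have fibre: "card {p \<in> ?B. map_graph p T = T'} = card (aut T)" if T': "T' \<in> ?C" for T'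
  proof -
    have vT': "verts T' = ?X" using T' by (simp add: trees_on_def)
    obtain q where q: "inj_on q ?X" "T' = map_graph q T"
      using T' unfolding isomorphic_iff_map_graph by blast
    then have qX: "q ` ?X = ?X" using vT' by simp
    have qin: "q x \<in> ?X" if "x \<in> ?X" for x using qX that by blast
    define r where "r = inv_into ?X q"
    have rq: "r (q x) = x" if "x \<in> ?X" for x using q(1) that by (simp add: r_def)
    have qr: "q (r x) = x" "r x \<in> ?X" if "x \<in> ?X" for x
      using qX that by (simp_all add: r_def f_inv_into_f inv_into_into)
    have maps: "map_graph (restrict f ?X) T = map_graph f T" for f :: "'a \<Rightarrow> 'a"
      by (rule map_graph_cong[OF T]) simp
    have auts: "s \<in> aut T \<longleftrightarrow> s \<in> ?B \<and> map_graph s T = T" for s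
    proof
      assume s: "s \<in> aut T"
      then have "s \<in> extensional ?X" "inj_on s ?X" "T = map_graph s T"
        unfolding aut_def is_iso_iff_map_graph by auto
      moreover from this(3) have "?X = s ` ?X" using map_graph_simps(1) by metis
      ultimately show "s \<in> ?B \<and> map_graph s T = T" by (auto simp: PiE_def)
    qed (auto simp: aut_def is_iso_iff_map_graph PiE_def)
    have "bij_betw (\<lambda>s. restrict (q \<circ> s) ?X) (aut T) {p \<in> ?B. map_graph p T = T'}"
    proof (rule bij_betwI[where g = "\<lambda>p. restrict (r \<circ> p) ?X"])
      show "(\<lambda>s. restrict (q \<circ> s) ?X) \<in> aut T \<rightarrow> {p \<in> ?B. map_graph p T = T'}"
      proof
        fix s assume "s \<in> aut T"
        then have s: "s \<in> ?B" "map_graph s T = T" using auts by blast+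
        have "inj_on (q \<circ> s) ?X" using s(1) q(1) bij[OF s(1)] by (intro comp_inj_on) auto
        moreover have "map_graph (q \<circ> s) T = T'"
          unfolding map_graph_comp[symmetric] s(2) q(2) ..
        ultimately show "restrict (q \<circ> s) ?X \<in> {p \<in> ?B. map_graph p T = T'}"
          using s(1) qin maps by (auto simp: inj_on_restrict_eq PiE_iff)
      qed
      show "(\<lambda>p. restrict (r \<circ> p) ?X) \<in> {p \<in> ?B. map_graph p T = T'} \<rightarrow> aut T"
      proof
        fix p assume "p \<in> {p \<in> ?B. map_graph p T = T'}"
        then have p: "p \<in> ?B" "map_graph p T = T'" by auto
        have "inj_on r ?X" by (metis inj_onI qr(1))
        then have "inj_on (r \<circ> p) ?X" using p(1) bij[OF p(1)] by (intro comp_inj_on) auto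
        moreover have "map_graph (r \<circ> p) T = T"
          unfolding map_graph_comp[symmetric] p(2) q(2)
          unfolding map_graph_comp by (rule map_graph_ident[OF T]) (simp add: rq)
        ultimately show "restrict (r \<circ> p) ?X \<in> aut T"
          unfolding auts using p(1) qr(2) maps by (auto simp: inj_on_restrict_eq PiE_iff)
      qed
      show "restrict (r \<circ> restrict (q \<circ> s) ?X) ?X = s" if "s \<in> aut T" for s
        using that rq unfolding auts by (auto simp: fun_eq_iff PiE_def extensional_def)
      show "restrict (q \<circ> restrict (r \<circ> p) ?X) ?X = p" if "p \<in> {p \<in> ?B. map_graph p T = T'}" for p
        using that qr(1) by (auto simp: fun_eq_iff PiE_def extensional_def)
    qed
    then show ?thesis by (rule bij_betw_same_card[symmetric])
  qed
  have "(\<lambda>p. map_graph p T) ` ?B \<subseteq> ?C"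
    using bij T by (auto simp: trees_on_def rooted_tree_map_graph isomorphic_map_graph)
  then have "(\<Sum>T'\<in>?C. \<Sum>p | p \<in> ?B \<and> map_graph p T = T'. 1) = (\<Sum>p\<in>?B. 1 :: nat)"
    using finB finite_trees_on[OF fin] by (intro sum.group) auto
  then have "card ?B = (\<Sum>T'\<in>?C. card {p \<in> ?B. map_graph p T = T'})" by simp
  also have "\<dots> = (\<Sum>T'\<in>?C. card (aut T))" by (rule sum.cong[OF refl fibre])
  also have "\<dots> = card ?C * card (aut T)" by simp
  finally show ?thesis
    using card_inj_on_subset_funcset[OF fin fin, of ?X] by (simp add: fact_prod_rev)
qed

text \<open>A class with \<open>m\<close> vertices has \<open>m! / \<alpha>\<^sub>T\<close> labelled copies, all with the same series.\<close>

lemma size_part_eq_sum_tree_P: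
  "size_part n H (\<lambda>T. \<phi> (tree_class T)) m i
    = (\<Sum>t | tree_size t = m. mps_const (of_rat (\<phi> t)) * tree_P n H t i)"
proof -
  let ?c = "\<lambda>T. mps_const (of_rat (\<phi> (tree_class T))) * tree_series n H T i"
  have "labelled_sum n H (\<lambda>T. \<phi> (tree_class T)) {..<m} i
      = (\<Sum>t | tree_size t = m. \<Sum>T | T \<in> trees_on {..<m} \<and> tree_class T = t. ?c T)"
    unfolding labelled_sum_def
  proof (rule sum.group[symmetric])
    show "finite {t. tree_size t = m}"
      by (rule finite_subset[OF _ finite_tree_size_less[of "Suc m"]]) auto
    show "tree_class ` trees_on {..<m} \<subseteq> {t. tree_size t = m}"
    proof
      fix t assume "t \<in> tree_class ` trees_on {..<m}"
      then obtain T where "t = tree_class T" "rooted_tree T" "verts T = {..<m}"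
        unfolding trees_on_def by blast
      then show "t \<in> {t. tree_size t = m}" using tree_size_tree_class by simp
    qed
  qed (simp add: finite_trees_on)
  also have "\<dots> = (\<Sum>t | tree_size t = m. mps_const (fact m * of_rat (\<phi> t)) * tree_P n H t i)"
  proof (intro sum.cong refl)
    fix t assume "t \<in> {t. tree_size t = m}"
    then obtain T where T: "rooted_tree T" "verts T = {..<m}" "tree_class T = t"
      using tree_class_on_initial_segment[of t] by (auto simp: trees_on_def)
    let ?C = "{T' \<in> trees_on {..<m}. tree_class T' = t}"
    have "tree_class T' = t \<longleftrightarrow> isomorphic T T'" if "rooted_tree T'" for T'
      using tree_class_eq_iff[OF T(1) that] T(3) by metis
    then have C: "?C = {T' \<in> trees_on (verts T). isomorphic T T'}"
      using T(2) by (auto simp: trees_on_def)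
    have "?c T' = mps_const (of_rat (\<phi> t)) * tree_series n H T i" if T': "T' \<in> ?C" for T'
    proof -
      obtain p where "is_iso T T' p" using T' unfolding C isomorphic_def by blast
      then have "tree_series n H T i = tree_series n H T' i"
        using T' T(1) by (intro is_iso_tree_series) (auto simp: trees_on_def)
      then show ?thesis using T' by simp
    qed
    then have "(\<Sum>T'\<in>?C. ?c T') = (\<Sum>T'\<in>?C. mps_const (of_rat (\<phi> t)) * tree_series n H T i)"
      by (rule sum.cong[OF refl])
    also have "\<dots> = mps_const (of_nat (card ?C) * of_rat (\<phi> t)) * tree_series n H T i"
      unfolding mps_const_sum_left by simp
    also have "(of_nat (card ?C) :: complex) = fact m * (1 / of_nat (card (aut T)))"
    proof -
      have eq: "card ?C * card (aut T) = fact m"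
        using card_labelled_copies[OF T(1)] T(2) unfolding C by simp
      then have "card (aut T) \<noteq> 0" by (metis fact_nonzero mult_0_right)
      then show ?thesis using arg_cong[OF eq, of "of_nat :: nat \<Rightarrow> complex"] by (simp add: field_simps)
    qed
    also have "mps_const (fact m * (1 / of_nat (card (aut T))) * of_rat (\<phi> t)) * tree_series n H T i
        = mps_const (fact m * of_rat (\<phi> t)) * tree_P n H t i"
      unfolding T(3)[symmetric] tree_P_tree_class[OF T(1)] normalized_tree_series_def mps_const_simps
      by (simp add: mult_ac)
    finally show "(\<Sum>T'\<in>?C. ?c T') = \<dots>" .
  qed
  finally show ?thesis
    unfolding size_part_def by (simp add: sum_distrib_left mps_const_simps)
qed

lemma order_ge_tree_P:
  assumes "H \<in> {1..n} \<rightarrow> higher n"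
  shows "order_ge (Suc (tree_size t)) (tree_P n H t i)"
proof -
  have "tree_P n H t i = normalized_tree_series n H (rep_tree t) i"
    using tree_P_tree_class[OF rep_tree(1), of n H t] by (simp add: rep_tree(2))
  then show ?thesis
    unfolding normalized_tree_series_def tree_series_def tree_size_def
    using assms
    by (auto intro!: order_ge_linear order_ge_sum order_ge_label_series[OF rep_tree(1)] simp: PiE_iff Pi_iff)
qed

lemma mps_coeff_tree_sum:
  assumes "H \<in> {1..n} \<rightarrow> higher n" "size M < N"
  shows "mps_coeff (tree_sum n H \<psi> i) M = (\<Sum>m<N. mps_coeff (size_part n H \<psi> m i) M)"
  unfolding tree_sum_def
  by (rule mps_coeff_mps_sum_nat[OF order_ge_mono[OF order_ge_size_part[OF assms(1)]] assms(2)]) simp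

lemma mps_coeff_sum_over_classes:
  assumes H: "H \<in> {1..n} \<rightarrow> higher n" and N: "size M < N"
  shows "mps_coeff (mps_sum (\<lambda>t. mps_const (of_rat (\<phi> t)) * tree_P n H t i)) M
    = (\<Sum>t | tree_size t < N. of_rat (\<phi> t) * mps_coeff (tree_P n H t i) M)"
proof -
  have "tree_size t < N" if "mps_coeff (tree_P n H t i) M \<noteq> 0" for t
  proof (rule ccontr)
    assume "\<not> tree_size t < N"
    then have "size M < Suc (tree_size t)" using N by simp
    then show False using order_ge_tree_P[OF H, of t i] that unfolding order_ge_def by blast
  qed
  then show ?thesis
    unfolding mps_coeff_mps_sum mps_coeff_const_times
    by (intro Sum_any.expand_superset finite_tree_size_less) auto
qed

lemma sum_over_classes:
  assumes H: "H \<in> {1..n} \<rightarrow> higher n"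
  shows "mps_sum (\<lambda>t. mps_const (of_rat (\<phi> t)) * tree_P n H t i)
    = tree_sum n H (\<lambda>T. \<phi> (tree_class T)) i"
proof (rule mps_eqI)
  fix M :: "nat multiset"
  let ?N = "Suc (size M)" and ?c = "\<lambda>t. of_rat (\<phi> t) * mps_coeff (tree_P n H t i) M"
  have "(\<Sum>t | tree_size t < ?N. ?c t) = (\<Sum>m<?N. \<Sum>t | t \<in> {t. tree_size t < ?N} \<and> tree_size t = m. ?c t)"
    by (rule sum.group[symmetric]) (auto simp: finite_tree_size_less)
  also have "\<dots> = (\<Sum>m<?N. \<Sum>t | tree_size t = m. ?c t)"
    by (intro sum.cong refl) auto
  also have "\<dots> = (\<Sum>m<?N. mps_coeff (size_part n H (\<lambda>T. \<phi> (tree_class T)) m i) M)"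
    unfolding size_part_eq_sum_tree_P by (simp add: mps_coeff_sum)
  finally show "mps_coeff (mps_sum (\<lambda>t. mps_const (of_rat (\<phi> t)) * tree_P n H t i)) M
      = mps_coeff (tree_sum n H (\<lambda>T. \<phi> (tree_class T)) i) M"
    by (simp only: mps_coeff_sum_over_classes[OF H lessI] mps_coeff_tree_sum[OF H lessI])
qed


section \<open>Cut sequences as iterated convolution\<close>

definition cut_sum :: "(tree \<Rightarrow> rat) \<Rightarrow> nat \<Rightarrow> nat rgraph \<Rightarrow> rat" where
  "cut_sum \<phi> r T = (\<Sum>es\<in>cut_seqs T r. prod_list (map (\<lambda>S. \<phi> (tree_class S)) (pieces T es)))"

lemma cut_term_eq: "cut_term \<phi> T (Suc r) = 1 / fact (Suc r) * cut_sum \<phi> r T"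
  unfolding cut_term_def cut_sum_def by simp

lemma cut_sum_0: "cut_sum \<phi> 0 T = \<phi> (tree_class T)"
proof -
  have "cut_seqs T 0 = {[]}" unfolding cut_seqs_def by auto
  then show ?thesis unfolding cut_sum_def by simp
qed

lemma edges_upper_part_subset: "edges (upper_part T e) \<subseteq> edges T"
  unfolding upper_part_def component_def by (auto simp: Let_def)

text \<open>After the first cut the relation \<open>\<succ>\<close> can be evaluated in the upper part, which makes the set of cut
  sequences recursive.\<close>

lemma edge_succ_upper_part:
  assumes "rooted_tree T" "e \<in> edges T" "f \<in> edges (upper_part T e)" "g \<in> edges (upper_part T e)"
  shows "edge_succ T f g \<longleftrightarrow> edge_succ (upper_part T e) f g"
  using cut_edge[OF assms(1,2)] edge_succ_stock[OF _ assms(3,4)] by metis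

text \<open>The condition that the first edge \<open>e\<close> precedes all others says precisely that the others lie in
  the upper part.\<close>

lemma Cons_in_cut_seqs_iff:
  assumes T: "rooted_tree T"
  shows "e # es \<in> cut_seqs T (Suc r) \<longleftrightarrow> e \<in> edges T \<and> es \<in> cut_seqs (upper_part T e) r"
proof (cases "e \<in> edges T \<and> set es \<subseteq> edges (upper_part T e)")
  case True
  then have rel: "edge_succ T f g \<longleftrightarrow> edge_succ (upper_part T e) f g" if "f \<in> set es" "g \<in> set es" for f g
    using edge_succ_upper_part[OF T, of e f g] that by blast
  have "sorted_wrt (edge_succ T) es \<longleftrightarrow> sorted_wrt (edge_succ (upper_part T e)) es"
    by (intro iffI; erule sorted_wrt_mono_rel[rotated]) (simp_all add: rel)
  then show ?thesis
    using True edges_upper_part_subset[of T e] unfolding cut_seqs_def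
    by (auto simp: edge_succ_def[of T e])
next
  case False
  then show ?thesis unfolding cut_seqs_def by (auto simp: edge_succ_def)
qed

lemma finite_cut_seqs: "rooted_tree T \<Longrightarrow> finite (cut_seqs T r)"
  unfolding cut_seqs_def
  by (rule finite_subset[OF _ finite_lists_length_eq[OF rooted_tree_basic(4), of T r]]) auto

lemma cut_sum_Suc:
  assumes T: "rooted_tree T"
  shows "cut_sum \<phi> (Suc r) T = cut_conv (\<lambda>T. \<phi> (tree_class T)) (cut_sum \<phi> r) T"
proof -
  let ?w = "\<lambda>T es. prod_list (map (\<lambda>S. \<phi> (tree_class S)) (pieces T es))"
  have "cut_sum \<phi> (Suc r) T = (\<Sum>(e, es)\<in>(SIGMA e:edges T. cut_seqs (upper_part T e) r). ?w T (e # es))"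
    unfolding cut_sum_def
  proof (rule sum.reindex_bij_witness[where i = "\<lambda>(e, es). e # es" and j = "\<lambda>es. (hd es, tl es)"], goal_cases)
    case (1 es)
    then have "length es = Suc r" by (simp add: cut_seqs_def)
    then show ?case by (cases es) auto
  next
    case (2 es)
    then have "length es = Suc r" by (simp add: cut_seqs_def)
    then show ?case using 2 Cons_in_cut_seqs_iff[OF T] by (cases es) auto
  next
    case (3 x)
    then show ?case by auto
  next
    case (4 x)
    then show ?case using Cons_in_cut_seqs_iff[OF T] by auto
  next
    case (5 es)
    then have "length es = Suc r" by (simp add: cut_seqs_def)
    then show ?case by (cases es) auto
  qed
  also have "\<dots> = (\<Sum>e\<in>edges T. \<Sum>es\<in>cut_seqs (upper_part T e) r. ?w T (e # es))"
    by (rule sum.Sigma[symmetric])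
      (auto simp: rooted_tree_basic(4)[OF T] finite_cut_seqs parts_rooted_tree[OF T])
  finally show ?thesis
    unfolding cut_conv_def cut_sum_def by (simp add: sum_distrib_left)
qed

lemma iso_invariant_cut_conv:
  assumes "iso_invariant \<phi>" "iso_invariant \<psi>"
  shows "iso_invariant (cut_conv \<phi> \<psi>)"
  unfolding iso_invariant_def
proof (intro allI impI)
  fix T :: "'a rgraph" and p :: "'a \<Rightarrow> 'a"
  assume T: "rooted_tree T" and inj: "inj_on p (verts T)"
  have "inj_on ((`) p) (edges T)"
    using inj rooted_tree_edge_subset[OF T] by (intro inj_on_subset[OF inj_on_image_Pow]) blast+
  then have "cut_conv \<phi> \<psi> (map_graph p T)
      = (\<Sum>e\<in>edges T. \<phi> (map_graph p (lower_part T e)) * \<psi> (map_graph p (upper_part T e)))"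
    unfolding cut_conv_def by (simp add: sum.reindex parts_map_graph[OF T inj])
  also have "\<dots> = cut_conv \<phi> \<psi> T"
    unfolding cut_conv_def
  proof (intro sum.cong refl)
    fix e assume e: "e \<in> edges T"
    have "verts (lower_part T e) \<subseteq> verts T" "verts (upper_part T e) \<subseteq> verts T"
      unfolding lower_part_def upper_part_def component_def by (auto simp: Let_def)
    then show "\<phi> (map_graph p (lower_part T e)) * \<psi> (map_graph p (upper_part T e))
        = \<phi> (lower_part T e) * \<psi> (upper_part T e)"
      using assms parts_rooted_tree[OF T e] inj_on_subset[OF inj] unfolding iso_invariant_def by metis
  qed
  finally show "cut_conv \<phi> \<psi> (map_graph p T) = cut_conv \<phi> \<psi> T" .
qed

lemma iso_invariant_cut_sum: "iso_invariant (cut_sum \<phi> r)"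
proof (induction r)
  case 0
  show ?case unfolding cut_sum_0 by (rule iso_invariant_tree_class)
next
  case (Suc r)
  then have "iso_invariant (cut_conv (\<lambda>T. \<phi> (tree_class T)) (cut_sum \<phi> r))"
    by (intro iso_invariant_cut_conv iso_invariant_tree_class)
  then show ?case
    unfolding iso_invariant_def by (simp add: cut_sum_Suc rooted_tree_map_graph)
qed

text \<open>A tree with \<open>m\<close> vertices has only \<open>m - 1\<close> edges to cut.\<close>

lemma cut_sum_eq_0: "rooted_tree T \<Longrightarrow> card (verts T) \<le> r \<Longrightarrow> cut_sum \<phi> r T = 0"
proof (induction r arbitrary: T)
  case 0
  then show ?case using rooted_tree_basic(1,2)[of T] by auto
next
  case (Suc r)
  have "cut_sum \<phi> r (upper_part T e) = 0" if e: "e \<in> edges T" for e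
    using Suc.IH[OF parts_rooted_tree(2)[OF Suc.prems(1) e]] card_parts[OF Suc.prems(1) e] Suc.prems(2)
    by linarith
  then show ?case unfolding cut_sum_Suc[OF Suc.prems(1)] cut_conv_def by simp
qed

lemma cut_sum_cong:
  assumes "rooted_tree T" "\<And>t. tree_size t \<le> card (verts T) \<Longrightarrow> \<phi> t = \<phi>' t"
  shows "cut_sum \<phi> r T = cut_sum \<phi>' r T"
  using assms
proof (induction r arbitrary: T)
  case 0
  then show ?case by (simp add: cut_sum_0 tree_size_tree_class)
next
  case (Suc r)
  have "\<phi> (tree_class (lower_part T e)) * cut_sum \<phi> r (upper_part T e)
      = \<phi>' (tree_class (lower_part T e)) * cut_sum \<phi>' r (upper_part T e)" if e: "e \<in> edges T" for e
    using Suc.IH[OF parts_rooted_tree(2)[OF Suc.prems(1) e]] Suc.prems(2)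
      card_parts[OF Suc.prems(1) e] parts_rooted_tree[OF Suc.prems(1) e]
    by (simp add: tree_size_tree_class)
  then show ?case unfolding cut_sum_Suc[OF Suc.prems(1)] cut_conv_def by (intro sum.cong refl)
qed

text \<open>With at least one cut all pieces are proper, so the recursion determines \<open>\<phi>\<close>.\<close>

lemma cut_term_cong:
  assumes T: "rooted_tree T" and "\<And>t. tree_size t < card (verts T) \<Longrightarrow> \<phi> t = \<phi>' t" and k: "2 \<le> k"
  shows "cut_term \<phi> T k = cut_term \<phi>' T k"
proof -
  obtain r where r: "k = Suc (Suc r)" using k that[of "k - 2"] by simp
  have "cut_sum \<phi> (Suc r) T = cut_sum \<phi>' (Suc r) T"
    unfolding cut_sum_Suc[OF T] cut_conv_def
  proof (intro sum.cong refl)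
    fix e assume e: "e \<in> edges T"
    note tr = parts_rooted_tree[OF T e] and c = card_parts[OF T e]
    have "cut_sum \<phi> r (upper_part T e) = cut_sum \<phi>' r (upper_part T e)"
      using c by (intro cut_sum_cong tr assms(2)) linarith
    then show "\<phi> (tree_class (lower_part T e)) * cut_sum \<phi> r (upper_part T e)
        = \<phi>' (tree_class (lower_part T e)) * cut_sum \<phi>' r (upper_part T e)"
      using assms(2) tr c by (simp add: tree_size_tree_class)
  qed
  then show ?thesis unfolding r cut_term_eq by simp
qed

lemma cut_term_isomorphic:
  "rooted_tree T \<Longrightarrow> isomorphic T T' \<Longrightarrow> cut_term \<phi> T' k = cut_term \<phi> T k"
  using iso_invariant_isomorphic[OF iso_invariant_cut_sum]
  unfolding cut_term_def cut_sum_def by metis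

text \<open>The coefficients passed to \<^const>\<open>cut_term\<close> are set to \<open>0\<close> on trees that are not smaller than
  \<open>t\<close>. This makes the recursion visibly well-founded and does not affect the terms with \<open>k \<ge> 2\<close>, by
  \<open>cut_term_cong\<close>.\<close>

function recursive_coeff :: "tree \<Rightarrow> rat" where
  "recursive_coeff t = (if tree_size t = 1 then 1 else
     - (\<Sum>k=2..tree_size t. cut_term
          (\<lambda>s. if tree_size s < tree_size t then recursive_coeff s else 0) (rep_tree t) k))"
  by pat_completeness auto
termination by (relation "measure tree_size") auto

declare recursive_coeff.simps [simp del]

lemma satisfies_recursion_recursive_coeff: "satisfies_recursion recursive_coeff"
  unfolding satisfies_recursion_def
proof (intro conjI allI impI; elim conjE)
  fix T :: "nat rgraph" assume "rooted_tree T" "card (verts T) = 1"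
  then show "recursive_coeff (tree_class T) = 1"
    by (simp add: recursive_coeff.simps tree_size_tree_class)
next
  fix T :: "nat rgraph" assume T: "rooted_tree T" "2 \<le> card (verts T)"
  let ?t = "tree_class T"
  have size: "tree_size ?t = card (verts T)" by (rule tree_size_tree_class[OF T(1)])
  have iso: "isomorphic T (rep_tree ?t)"
    using tree_class_eq_iff[OF T(1) rep_tree(1), of ?t] rep_tree(2)[of ?t] by metis
  have "recursive_coeff ?t = - (\<Sum>k=2..card (verts T). cut_term
      (\<lambda>s. if tree_size s < tree_size ?t then recursive_coeff s else 0) (rep_tree ?t) k)"
    by (subst recursive_coeff.simps) (use T size in simp)
  also have "\<dots> = - (\<Sum>k=2..card (verts T). cut_term recursive_coeff T k)"
  proof (intro arg_cong[where f = uminus] sum.cong refl)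
    fix k assume "k \<in> {2..card (verts T)}"
    then show "cut_term (\<lambda>s. if tree_size s < tree_size ?t then recursive_coeff s else 0) (rep_tree ?t) k
        = cut_term recursive_coeff T k"
      unfolding cut_term_isomorphic[OF T(1) iso] using size by (intro cut_term_cong T(1)) auto
  qed
  finally show "recursive_coeff ?t = - (\<Sum>k=2..card (verts T). cut_term recursive_coeff T k)" .
qed

lemma satisfies_recursion_unique:
  assumes "satisfies_recursion \<phi>" "satisfies_recursion \<psi>"
  shows "\<phi> = \<psi>"
proof
  fix t
  show "\<phi> t = \<psi> t"
  proof (induction "tree_size t" arbitrary: t rule: less_induct)
    case less
    let ?T = "rep_tree t"
    note T = rep_tree[of t]
    show ?case
    proof (cases "card (verts ?T) = 1")
      case True
      then show ?thesis using assms T unfolding satisfies_recursion_def by metis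
    next
      case False
      then have ge: "2 \<le> card (verts ?T)" using tree_size_pos[of t] unfolding tree_size_def by linarith
      have "cut_term \<phi> ?T k = cut_term \<psi> ?T k" if "k \<in> {2..card (verts ?T)}" for k
        using that less by (intro cut_term_cong T(1)) (auto simp: tree_size_def[of t])
      then have "(\<Sum>k=2..card (verts ?T). cut_term \<phi> ?T k) = (\<Sum>k=2..card (verts ?T). cut_term \<psi> ?T k)"
        by (rule sum.cong[OF refl])
      then show ?thesis using assms T ge unfolding satisfies_recursion_def by metis
    qed
  qed
qed

lemma sum_cut_term_split:
  assumes "1 \<le> m"
  shows "(\<Sum>k=1..m. cut_term \<phi> T k) = \<phi> (tree_class T) + (\<Sum>k=2..m. cut_term \<phi> T k)"
  using assms cut_term_eq[of \<phi> T 0] by (simp add: sum.atLeast_Suc_atMost cut_sum_0 numeral_2_eq_2)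

lemma recursion_sum:
  assumes "satisfies_recursion \<phi>" and T: "rooted_tree T"
  shows "(\<Sum>k=1..card (verts T). cut_term \<phi> T k) = (if card (verts T) = 1 then 1 else 0)"
proof -
  have "1 \<le> card (verts T)" using rooted_tree_basic(1,2)[OF T] by (auto simp: Suc_le_eq card_gt_0_iff)
  then show ?thesis
    using assms unfolding sum_cut_term_split[OF \<open>1 \<le> card (verts T)\<close>] satisfies_recursion_def
    by (cases "card (verts T) = 1") auto
qed


section \<open>The D-Log as a sum over trees\<close>

lemma vector_field_var: "i \<in> {1..n} \<Longrightarrow> vector_field n a (mps_var i) = a i"
  unfolding vector_field_def by (simp add: mps_deriv_var if_distrib cong: if_cong)

lemma vector_field_cong:
  "(\<And>i. i \<in> {1..n} \<Longrightarrow> a i = b i) \<Longrightarrow> vector_field n a = vector_field n b"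
  unfolding vector_field_def by (intro ext sum.cong) auto

lemma order_ge_iterate:
  assumes "\<And>j. j \<in> {1..n} \<Longrightarrow> order_ge 2 (a j)"
  shows "order_ge (Suc k) ((vector_field n a ^^ k) (mps_var i))"
proof (induction k)
  case (Suc k)
  then show ?case using order_ge_vector_field[OF assms Suc] by simp
qed (use order_ge_var[of i] in simp)

lemma mps_coeff_exp_operator:
  assumes "\<And>j. j \<in> {1..n} \<Longrightarrow> order_ge 2 (a j)" "size M < N"
  shows "mps_coeff (exp_operator (vector_field n a) (mps_var i)) M
    = (\<Sum>k<N. 1 / fact k * mps_coeff ((vector_field n a ^^ k) (mps_var i)) M)"
proof -
  have "order_ge k (mps_const (1 / fact k) * (vector_field n a ^^ k) (mps_var i))" for k
    by (intro order_ge_linear order_ge_mono[OF order_ge_iterate[OF assms(1)]]) auto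
  then show ?thesis
    unfolding exp_operator_def by (subst mps_coeff_mps_sum_nat[OF _ assms(2)]) auto
qed

text \<open>If \<open>a\<close> and \<open>b\<close> agree below order \<open>d\<close>, the second and higher iterates agree one order further, so
  the exponentials detect the parts of order \<open>d\<close> of \<open>a\<close> and \<open>b\<close>.\<close>

lemma exp_operator_inj:
  assumes a: "\<And>j. j \<in> {1..n} \<Longrightarrow> order_ge 2 (a j)" and b: "\<And>j. j \<in> {1..n} \<Longrightarrow> order_ge 2 (b j)"
    and eq: "\<And>j. j \<in> {1..n} \<Longrightarrow>
      exp_operator (vector_field n a) (mps_var j) = exp_operator (vector_field n b) (mps_var j)"
    and i: "i \<in> {1..n}"
  shows "a i = b i"
proof -
  have "\<forall>i\<in>{1..n}. order_ge d (a i - b i)" for d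
  proof (induction d)
    case (Suc d)
    show ?case
    proof
      fix i assume i: "i \<in> {1..n}"
      define D where "D k = (vector_field n a ^^ k) (mps_var i) - (vector_field n b ^^ k) (mps_var i)" for k
      have D_Suc: "D (Suc k) = vector_field n a (D k)
          + vector_field n (\<lambda>j. a j - b j) ((vector_field n b ^^ k) (mps_var i))" for k
        unfolding D_def by (simp add: vector_field_diff)
      have step: "order_ge (Suc d) (D (Suc k))" if "order_ge d (D k)" "1 \<le> k" for k
        unfolding D_Suc
      proof (rule order_ge_linear)
        have "order_ge (2 + (d - 1)) (vector_field n a (D k))" by (rule order_ge_vector_field[OF a that(1)])
        then show "order_ge (Suc d) (vector_field n a (D k))" by (rule order_ge_mono) simp
        have "order_ge (d + (Suc k - 1))
            (vector_field n (\<lambda>j. a j - b j) ((vector_field n b ^^ k) (mps_var i)))"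
          using Suc order_ge_iterate[OF b] by (intro order_ge_vector_field) auto
        then show "order_ge (Suc d) (vector_field n (\<lambda>j. a j - b j) ((vector_field n b ^^ k) (mps_var i)))"
          by (rule order_ge_mono) (use that(2) in simp)
      qed
      have D1: "D 1 = a i - b i" using i by (simp add: D_def vector_field_var)
      have "order_ge d (D (Suc k))" for k
      proof (induction k)
        case 0
        then show ?case using D1 Suc i by simp
      next
        case (Suc k)
        then show ?case using step[of "Suc k"] by (auto intro: order_ge_mono)
      qed
      then have D2: "order_ge (Suc d) (D (Suc (Suc k)))" for k using step by simp
      show "order_ge (Suc d) (a i - b i)"
        unfolding order_ge_def
      proof (intro allI impI)
        fix M :: "nat multiset" assume M: "size M < Suc d"
        have "0 = (\<Sum>k<size M + 2. 1 / fact k * mps_coeff (D k) M)"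
          using arg_cong[OF eq[OF i], of "\<lambda>f. mps_coeff f M"]
            mps_coeff_exp_operator[where n = n and a = a and M = M and i = i, OF a, of "size M + 2"]
            mps_coeff_exp_operator[where n = n and a = b and M = M and i = i, OF b, of "size M + 2"]
          unfolding D_def by (simp add: right_diff_distrib sum_subtractf)
        also have "\<dots> = (\<Sum>k\<in>{1}. 1 / fact k * mps_coeff (D k) M)"
        proof (rule sum.mono_neutral_right)
          show "\<forall>k\<in>{..<size M + 2} - {1}. 1 / fact k * mps_coeff (D k) M = 0"
          proof
            fix k assume "k \<in> {..<size M + 2} - {1}"
            then consider "k = 0" | j where "k = Suc (Suc j)" by (metis DiffE One_nat_def not0_implies_Suc singletonI)
            then show "1 / fact k * mps_coeff (D k) M = 0"
              using D2 M by cases (auto simp: D_def order_ge_def)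
          qed
        qed auto
        finally show "mps_coeff (a i - b i) M = 0" using D1 by simp
      qed
    qed
  qed simp
  then show ?thesis using i by (intro mps_eq_if_order_ge) blast
qed

lemma size_part_cong:
  "(\<And>T. T \<in> trees_on {..<m} \<Longrightarrow> \<psi> T = \<psi>' T) \<Longrightarrow> size_part n H \<psi> m i = size_part n H \<psi>' m i"
  unfolding size_part_def labelled_sum_def by simp

lemma tree_sum_cong:
  "(\<And>T. rooted_tree T \<Longrightarrow> \<psi> T = \<psi>' T) \<Longrightarrow> tree_sum n H \<psi> i = tree_sum n H \<psi>' i"
  unfolding tree_sum_def
  by (intro arg_cong[where f = mps_sum] ext size_part_cong) (simp add: trees_on_def)

lemma size_part_linear:
  "(\<Sum>k\<in>K. mps_const (of_rat (c k)) * size_part n H (\<psi> k) m i)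
    = size_part n H (\<lambda>T. \<Sum>k\<in>K. c k * \<psi> k T) m i"
  unfolding size_part_def labelled_sum_def sum_distrib_left
  by (subst sum.swap, intro sum.cong refl)
    (simp only: mps_const_simps(3) mps_const_sum_left, simp add: of_rat_sum of_rat_mult sum_distrib_left mult_ac)

lemma of_rat_fact: "of_rat (fact k) = (fact k :: complex)"
  by (metis of_nat_fact of_rat_of_nat_eq)

lemma size_part_1:
  assumes "i \<in> {1..n}"
  shows "size_part n H (\<lambda>T. 1) 1 i = H i"
proof -
  let ?T = "\<lparr>verts = {0}, edges = {}, rt = 0\<rparr> :: nat rgraph"
  have tree: "rooted_tree ?T" by (simp add: rooted_tree_iff_bridges)
  have "T = ?T" if "T \<in> trees_on {0}" for T :: "nat rgraph"
    using that edges_empty_iff_singleton[of T] rooted_tree_basic(2)[of T]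
    unfolding trees_on_def by (cases T) auto
  then have "trees_on {0} = {?T}" using tree unfolding trees_on_def by auto
  moreover have "{l. l \<in> {0 :: nat} \<rightarrow>\<^sub>E {1..n} \<and> l 0 = i} = {\<lambda>x\<in>{0}. i}"
    using assms by (auto simp: fun_eq_iff PiE_def extensional_def)
  ultimately show ?thesis
    unfolding size_part_def labelled_sum_def tree_series_def label_series_def
    by (simp add: children_def mps_const_simps lessThan_Suc)
qed

text \<open>Each application of the vector field cuts off one more lower part.\<close>

lemma iterate_tree_sum:
  assumes H: "H \<in> {1..n} \<rightarrow> higher n" and i: "i \<in> {1..n}"
  shows "(vector_field n (tree_sum n H (\<lambda>T. \<phi> (tree_class T))) ^^ Suc k) (mps_var i)
    = tree_sum n H (cut_sum \<phi> k) i"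
proof (induction k)
  case 0
  show ?case using i by (simp add: vector_field_var cut_sum_0)
next
  case (Suc k)
  let ?A = "vector_field n (tree_sum n H (\<lambda>T. \<phi> (tree_class T)))"
  have "(?A ^^ Suc (Suc k)) (mps_var i) = ?A ((?A ^^ Suc k) (mps_var i))" by simp
  also have "\<dots> = tree_sum n H (cut_conv (\<lambda>T. \<phi> (tree_class T)) (cut_sum \<phi> k)) i"
    unfolding Suc by (rule vector_field_tree_sum[OF H iso_invariant_tree_class iso_invariant_cut_sum])
  also have "\<dots> = tree_sum n H (cut_sum \<phi> (Suc k)) i"
    by (rule tree_sum_cong) (simp add: cut_sum_Suc)
  finally show ?case .
qed

text \<open>The recursion says that, in the exponential, the contributions of every tree with more than one
  vertex cancel.\<close>

lemma exp_tree_sum: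
  assumes \<phi>: "satisfies_recursion \<phi>" and H: "H \<in> {1..n} \<rightarrow> higher n" and i: "i \<in> {1..n}"
  shows "exp_operator (vector_field n (tree_sum n H (\<lambda>T. \<phi> (tree_class T)))) (mps_var i) = mps_var i + H i"
proof (rule mps_eqI)
  fix M :: "nat multiset"
  let ?a = "tree_sum n H (\<lambda>T. \<phi> (tree_class T))"
  \<comment> \<open>Trees with at least \<open>N\<close> vertices do not reach the coefficient of \<open>M\<close>; the summand \<open>2\<close> keeps the
    one-vertex tree within the bound even if \<open>M\<close> is constant.\<close>
  define N where "N = size M + 2"
  have N: "size M < N" "1 < N" by (simp_all add: N_def)
  have part: "(\<Sum>k<N. mps_const (1 / fact (Suc k)) * size_part n H (cut_sum \<phi> k) m i)
      = (if m = 1 then H i else 0)" if m: "m < N" for m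
  proof -
    have "(\<Sum>k<N. mps_const (1 / fact (Suc k)) * size_part n H (cut_sum \<phi> k) m i)
        = (\<Sum>k<N. mps_const (of_rat (1 / fact (Suc k))) * size_part n H (cut_sum \<phi> k) m i)"
      by (simp add: of_rat_divide of_rat_fact del: fact_Suc)
    also have "\<dots> = size_part n H (\<lambda>T. \<Sum>k<N. 1 / fact (Suc k) * cut_sum \<phi> k T) m i"
      by (rule size_part_linear)
    also have "\<dots> = size_part n H (\<lambda>T. if m = 1 then 1 else 0) m i"
    proof (rule size_part_cong)
      fix T assume "T \<in> trees_on {..<m}"
      then have T: "rooted_tree T" "card (verts T) = m" unfolding trees_on_def by auto
      have "(\<Sum>k<N. 1 / fact (Suc k) * cut_sum \<phi> k T) = (\<Sum>k<m. 1 / fact (Suc k) * cut_sum \<phi> k T)"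
        using m T by (intro sum.mono_neutral_right) (auto simp: cut_sum_eq_0)
      also have "\<dots> = (\<Sum>k=1..m. cut_term \<phi> T k)"
        by (rule sum.reindex_bij_witness[where i = "\<lambda>k. k - 1" and j = Suc])
          (auto simp: cut_term_eq simp del: fact_Suc)
      finally show "(\<Sum>k<N. 1 / fact (Suc k) * cut_sum \<phi> k T) = (if m = 1 then 1 else 0)"
        using recursion_sum[OF \<phi> T(1)] T(2) by simp
    qed
    also have "\<dots> = (if m = 1 then H i else 0)"
      using size_part_1[OF i] by (auto simp: size_part_def labelled_sum_def mps_const_simps)
    finally show ?thesis .
  qed
  have "mps_coeff (exp_operator (vector_field n ?a) (mps_var i)) M
      = (\<Sum>k<Suc N. 1 / fact k * mps_coeff ((vector_field n ?a ^^ k) (mps_var i)) M)"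
    using tree_sum_higher[OF H] N by (intro mps_coeff_exp_operator) (auto simp: higher_iff)
  also have "\<dots> = mps_coeff (mps_var i) M
      + (\<Sum>k<N. 1 / fact (Suc k) * mps_coeff ((vector_field n ?a ^^ Suc k) (mps_var i)) M)"
    by (subst sum.lessThan_Suc_shift) simp
  also have "(\<Sum>k<N. 1 / fact (Suc k) * mps_coeff ((vector_field n ?a ^^ Suc k) (mps_var i)) M)
      = (\<Sum>k<N. \<Sum>m<N. mps_coeff (mps_const (1 / fact (Suc k)) * size_part n H (cut_sum \<phi> k) m i) M)"
    unfolding iterate_tree_sum[OF H i] mps_coeff_const_times sum_distrib_left[symmetric]
    by (intro sum.cong refl arg_cong2[where f = "(*)"] mps_coeff_tree_sum[OF H N(1)])
  also have "\<dots> = (\<Sum>m<N. mps_coeff (\<Sum>k<N. mps_const (1 / fact (Suc k)) * size_part n H (cut_sum \<phi> k) m i) M)"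
    unfolding mps_coeff_sum by (rule sum.swap)
  also have "\<dots> = (\<Sum>m<N. if m = 1 then mps_coeff (H i) M else 0)"
    by (intro sum.cong refl) (simp add: part del: fact_Suc)
  also have "\<dots> = mps_coeff (H i) M" using N(2) by simp
  finally show "mps_coeff (exp_operator (vector_field n ?a) (mps_var i)) M = mps_coeff (mps_var i + H i) M"
    by simp
qed

lemma D_Log_eq_tree_sum:
  assumes \<phi>: "satisfies_recursion \<phi>" and H: "H \<in> {1..n} \<rightarrow> higher n" and i: "i \<in> {1..n}"
  shows "D_Log n (\<lambda>j. mps_var j + H j) i = tree_sum n H (\<lambda>T. \<phi> (tree_class T)) i"
proof -
  define a where "a = restrict (tree_sum n H (\<lambda>T. \<phi> (tree_class T))) {1..n}"
  have a: "a \<in> {1..n} \<rightarrow>\<^sub>E higher n" using tree_sum_higher[OF H] unfolding a_def by auto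
  have "vector_field n a = vector_field n (tree_sum n H (\<lambda>T. \<phi> (tree_class T)))"
    unfolding a_def by (rule vector_field_cong) simp
  then have exp: "exp_operator (vector_field n a) (mps_var j) = mps_var j + H j" if "j \<in> {1..n}" for j
    using exp_tree_sum[OF \<phi> H that] by simp
  have "D_Log n (\<lambda>j. mps_var j + H j) = a"
    unfolding D_Log_def
  proof (rule the_equality)
    fix b assume b: "b \<in> {1..n} \<rightarrow>\<^sub>E higher n \<and>
      (\<forall>i\<in>{1..n}. exp_operator (vector_field n b) (mps_var i) = mps_var i + H i)"
    have ord: "order_ge 2 (a j)" "order_ge 2 (b j)" if "j \<in> {1..n}" for j
      using a b that higher_iff by (meson PiE_mem)+
    have "b j = a j" if "j \<in> {1..n}" for j
      using exp b by (intro exp_operator_inj[of n b a] that ord) auto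
    then show "b = a" using a b by (intro PiE_ext) auto
  qed (use a exp in blast)
  then show ?thesis using i by (simp add: a_def)
qed

lemma represents_D_Log_if_recursion:
  assumes "satisfies_recursion \<phi>"
  shows "represents_D_Log \<phi>"
  unfolding represents_D_Log_def using D_Log_eq_tree_sum[OF assms] sum_over_classes by simp


section \<open>Linear independence of the tree series\<close>

lift_definition mps_monom :: "'v multiset \<Rightarrow> ('v, 'a :: comm_ring_1) mps"
  is "\<lambda>M m. if m = M then 1 else 0" .

lemma mps_coeff_monom: "mps_coeff (mps_monom M) m = (if m = M then 1 else 0)"
  by transfer simp

lemma mps_monom_mult: "mps_monom M * mps_monom N = (mps_monom (M + N) :: ('v, 'a :: comm_ring_1) mps)"
proof (rule mps_eqI)
  fix m :: "'v multiset"
  have "mps_coeff (mps_monom M * mps_monom N :: ('v, 'a) mps) m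
      = (\<Sum>p\<in>{(a, b). a + b = m}. if p = (M, N) then 1 else 0)"
    unfolding mps_coeff_times by (intro sum.cong refl) (simp add: mps_coeff_monom split: prod.split)
  also have "\<dots> = mps_coeff (mps_monom (M + N)) m"
    by (subst sum.delta) (auto simp: mps_coeff_monom)
  finally show "mps_coeff (mps_monom M * mps_monom N :: ('v, 'a) mps) m = mps_coeff (mps_monom (M + N)) m" .
qed

lemma prod_const_monom:
  "(\<Prod>v\<in>A. mps_const (c v) * mps_monom (N v) :: ('v, 'a :: comm_ring_1) mps)
    = mps_const (\<Prod>v\<in>A. c v) * mps_monom (\<Sum>v\<in>A. N v)"
proof -
  have one: "mps_monom {#} = (1 :: ('v, 'a) mps)" "mps_const 1 = (1 :: ('v, 'a) mps)"
    by (rule mps_eqI, simp add: mps_coeff_monom mps_const.rep_eq mps_coeff_one)+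
  have step: "mps_const a * mps_monom M * (mps_const b * mps_monom N)
      = (mps_const (a * b) * mps_monom (M + N) :: ('v, 'a) mps)" for a b M N
    unfolding mps_monom_mult[symmetric] mps_const_simps(3)[symmetric] by (simp add: mult_ac)
  show ?thesis
    by (induction A rule: infinite_finite_induct) (simp_all add: one step mps_const_simps)
qed

lemma mps_deriv_const_monom:
  "mps_deriv i (mps_const c * mps_monom M :: ('v, 'a :: comm_ring_1) mps)
    = mps_const (of_nat (count M i) * c) * mps_monom (M - {#i#})"
proof (rule mps_eqI)
  fix m
  have "add_mset i m = M \<longleftrightarrow> i \<in># M \<and> m = M - {#i#}" by auto
  then show "mps_coeff (mps_deriv i (mps_const c * mps_monom M :: ('v, 'a) mps)) m
      = mps_coeff (mps_const (of_nat (count M i) * c) * mps_monom (M - {#i#})) m"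
    by (cases "i \<in># M") (auto simp: mps_coeff_deriv mps_coeff_monom not_in_iff)
qed

lemma fold_deriv_zero: "finite C \<Longrightarrow> Finite_Set.fold (\<lambda>w. mps_deriv (l w)) (0 :: ('v, 'a :: comm_ring_1) mps) C = 0"
proof (induction C rule: finite_induct)
  case (insert w C)
  have "mps_deriv i (0 :: ('v, 'a) mps) = 0" for i by (rule mps_eqI) (simp add: mps_coeff_deriv)
  then show ?case using insert by (simp add: fold_deriv_insert)
qed simp

text \<open>Repeated differentiation of a monomial removes variables; the scalar that arises is zero exactly when a
  variable is removed more often than it occurs. It is kept as a natural number so that no cancellation
  can occur when such scalars are added.\<close>

lemma fold_deriv_monom:
  fixes l :: "'b \<Rightarrow> 'v"
  assumes "finite C"
  shows "\<exists>k :: nat. Finite_Set.fold (\<lambda>w. mps_deriv (l w)) (mps_monom M :: ('v, 'a :: comm_ring_1) mps) C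
      = mps_const (of_nat k) * mps_monom (M - image_mset l (mset_set C))
    \<and> (k \<noteq> 0 \<longleftrightarrow> image_mset l (mset_set C) \<subseteq># M)"
  using assms
proof (induction C)
  case empty
  show ?case by (rule exI[of _ 1]) (simp add: mps_const_simps)
next
  case (insert w C)
  let ?I = "image_mset l (mset_set C)"
  obtain k where k: "Finite_Set.fold (\<lambda>w. mps_deriv (l w)) (mps_monom M :: ('v, 'a) mps) C
      = mps_const (of_nat k) * mps_monom (M - ?I)" "k \<noteq> 0 \<longleftrightarrow> ?I \<subseteq># M"
    using insert.IH by blast
  have "count (M - ?I) (l w) * k \<noteq> 0 \<longleftrightarrow> add_mset (l w) ?I \<subseteq># M"
  proof (cases "?I \<subseteq># M")
    case True
    have "l w \<in># M - ?I \<longleftrightarrow> {#l w#} \<subseteq># M - ?I" by simp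
    also have "\<dots> \<longleftrightarrow> add_mset (l w) ?I \<subseteq># M"
      using subset_mset.le_diff_conv2[OF True, of "{#l w#}"] by simp
    finally show ?thesis
      using True k(2) unfolding mult_eq_0_iff de_Morgan_disj count_eq_zero_iff by blast
  next
    case False
    then show ?thesis using k(2) by (auto dest: mset_subset_eq_insertD subset_mset.less_imp_le)
  qed
  then show ?case
    using insert.hyps
    by (intro exI[of _ "count (M - ?I) (l w) * k"])
      (simp add: fold_deriv_insert k(1) mps_deriv_const_monom)
qed

text \<open>Each edge joins a vertex to one of its children, so a tree is determined by its root, its vertices
  and the sets of children.\<close>

lemma edges_eq_children:
  assumes T: "rooted_tree T"
  shows "edges T = {{v, w} | v w. v \<in> verts T \<and> w \<in> children T v}"
proof (intro equalityI subsetI)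
  fix e assume e: "e \<in> edges T"
  then obtain a b where ab: "e = {a, b}" "a \<in> verts T" "b \<in> verts T"
    using rooted_tree_edgeE[OF T] by blast
  then have "b \<in> children T a \<or> a \<in> children T b"
    using near_end_cases[OF T, of a b] e unfolding children_iff_near_end[OF T]
    by (simp add: insert_commute)
  then show "e \<in> {{v, w} | v w. v \<in> verts T \<and> w \<in> children T v}"
    using ab by (auto simp: insert_commute)
qed (auto simp: children_def)

text \<open>A map that respects the root and sends children onto children is surjective, since every vertex is
  reached from the root through children; equal cardinality makes it bijective.\<close>

lemma isomorphic_if_children:
  assumes U: "rooted_tree U" and T: "rooted_tree T" and card: "card (verts U) = card (verts T)"
    and rt: "l (rt U) = rt T" and l: "l ` verts U \<subseteq> verts T"
    and ch: "\<And>v. v \<in> verts U \<Longrightarrow> children T (l v) = l ` children U v"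
  shows "isomorphic U T"
proof -
  have "rt T \<in> l ` verts U" using rt rooted_tree_basic(2)[OF U] by force
  moreover have "children T w \<subseteq> l ` verts U" if "w \<in> l ` verts U" for w
    using that ch children_subset[OF U] by fastforce
  ultimately have "verts T \<subseteq> l ` verts U" by (rule children_closed_superset[OF T])
  with l have im: "l ` verts U = verts T" by blast
  then have inj: "inj_on l (verts U)"
    using card rooted_tree_basic(1)[OF U] by (intro eq_card_imp_inj_on) auto
  have "edges T = {l ` {v, w} | v w. v \<in> verts U \<and> w \<in> children U v}"
    unfolding edges_eq_children[OF T] im[symmetric] using ch by auto (metis, blast)
  also have "\<dots> = (\<lambda>e. l ` e) ` edges U"
    unfolding edges_eq_children[OF U] by blast
  finally show ?thesis
    unfolding isomorphic_def is_iso_def bij_betw_def using inj im rt by blast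
qed

text \<open>The system that detects \<open>T\<close> uses the vertices of \<open>T\<close> as variables and one further variable \<open>x\<close>. The
  component of a vertex is \<open>x\<^sup>2\<close> times the product of its children; without the factor \<open>x\<^sup>2\<close> vertices with
  fewer than two children would violate the condition on the order.\<close>

definition detector :: "nat rgraph \<Rightarrow> nat \<Rightarrow> nat \<Rightarrow> (nat, complex) mps" where
  "detector T x j = (if j \<in> verts T then mps_monom ({#x, x#} + mset_set (children T j)) else 0)"

context
  fixes T :: "nat rgraph" and n :: nat
  assumes T: "rooted_tree T" and n: "verts T \<subseteq> {1..<n}"
begin

lemma n_ge_1: "1 \<le> n"
  using n rooted_tree_basic(2)[OF T] by fastforce

lemma n_notin: "n \<notin> verts T"
  using n by auto

lemma detector_higher: "detector T n \<in> {1..n} \<rightarrow> higher n"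
proof
  fix j
  have "set_mset ({#n, n#} + mset_set (children T j)) \<subseteq> {1..n}"
    using children_subset[OF T, of j] n n_ge_1 finite_children[OF T] by fastforce
  then show "detector T n j \<in> higher n"
    unfolding detector_def higher_def by (auto simp: mps_coeff_monom split: if_splits)
qed

text \<open>A labelling \<open>l\<close> of \<open>U\<close> contributes to the coefficient of a pure power of the extra variable only if at
  every vertex \<open>v\<close> the derivatives, which are labelled by the children of \<open>v\<close>, use up all children of
  \<open>l v\<close>; each vertex then contributes the square of the extra variable, so that the exponent \<open>2 v(T)\<close> forces \<open>v(U) = v(T)\<close>.\<close>

lemma label_series_detector:
  fixes U :: "nat rgraph"
  assumes U: "rooted_tree U"
  obtains k :: nat
    where "mps_coeff (label_series (detector T n) U l) (replicate_mset (2 * card (verts T)) n) = of_nat k"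
      "k \<noteq> 0 \<longleftrightarrow> l ` verts U \<subseteq> verts T \<and> card (verts U) = card (verts T) \<and>
        (\<forall>v\<in>verts U. image_mset l (mset_set (children U v)) = mset_set (children T (l v)))"
proof (cases "l ` verts U \<subseteq> verts T")
  case False
  then obtain v where v: "v \<in> verts U" "l v \<notin> verts T" by blast
  then have "Finite_Set.fold (\<lambda>w. mps_deriv (l w)) (detector T n (l v)) (children U v) = 0"
    by (simp add: detector_def fold_deriv_zero finite_children[OF U])
  then have "label_series (detector T n) U l = 0"
    unfolding label_series_def using v(1) rooted_tree_basic(1)[OF U] by (intro prod_zero) auto
  then show ?thesis using False that[of 0] by simp
next
  case True
  let ?I = "\<lambda>v. image_mset l (mset_set (children U v))"
  let ?J = "\<lambda>v. mset_set (children T (l v))"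
  let ?M = "\<lambda>v. {#n, n#} + ?J v"
  note finU = rooted_tree_basic(1)[OF U]
  have "\<forall>v\<in>verts U. \<exists>k :: nat.
      Finite_Set.fold (\<lambda>w. mps_deriv (l w)) (detector T n (l v)) (children U v)
        = mps_const (of_nat k) * mps_monom (?M v - ?I v)
      \<and> (k \<noteq> 0 \<longleftrightarrow> ?I v \<subseteq># ?M v)"
  proof
    fix v assume "v \<in> verts U"
    then have "detector T n (l v) = mps_monom (?M v)" using True by (auto simp: detector_def)
    then show "\<exists>k :: nat. Finite_Set.fold (\<lambda>w. mps_deriv (l w)) (detector T n (l v)) (children U v)
        = mps_const (of_nat k) * mps_monom (?M v - ?I v) \<and> (k \<noteq> 0 \<longleftrightarrow> ?I v \<subseteq># ?M v)"
      using fold_deriv_monom[OF finite_children[OF U, of v], of l "?M v"] by simp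
  qed
  then obtain k where k: "\<And>v. v \<in> verts U \<Longrightarrow>
        Finite_Set.fold (\<lambda>w. mps_deriv (l w)) (detector T n (l v)) (children U v)
          = mps_const (of_nat (k v)) * mps_monom (?M v - ?I v)"
      "\<And>v. v \<in> verts U \<Longrightarrow> k v \<noteq> 0 \<longleftrightarrow> ?I v \<subseteq># ?M v"
    by metis
  let ?X = "replicate_mset (2 * card (verts T)) n"
  let ?K = "if (\<Sum>v\<in>verts U. ?M v - ?I v) = ?X then \<Prod>v\<in>verts U. k v else 0"
  have "label_series (detector T n) U l
      = mps_const (of_nat (\<Prod>v\<in>verts U. k v)) * mps_monom (\<Sum>v\<in>verts U. ?M v - ?I v)"
    unfolding label_series_def by (simp add: k(1) prod_const_monom)
  then have coeff: "mps_coeff (label_series (detector T n) U l) ?X = of_nat ?K"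
    by (simp add: mps_coeff_monom)
  have nI: "n \<notin># ?I v" for v
    using True n_notin children_subset[OF U, of v] finite_children[OF U, of v] by auto
  have nJ: "n \<notin># ?J v" for v
    using n_notin children_subset[OF T] finite_children[OF T] by auto
  have replicate: "(\<Sum>v\<in>A. {#n, n#}) = replicate_mset (2 * card A) n" if "finite A" for A :: "nat set"
    using that by induction auto
  have "?K \<noteq> 0 \<longleftrightarrow> card (verts U) = card (verts T) \<and> (\<forall>v\<in>verts U. ?I v = ?J v)"
  proof
    assume K: "?K \<noteq> 0"
    then have sum: "(\<Sum>v\<in>verts U. ?M v - ?I v) = ?X" and "(\<Prod>v\<in>verts U. k v) \<noteq> 0"
      by (auto split: if_splits)
    then have "k v \<noteq> 0" if "v \<in> verts U" for v using that finU by auto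
    then have sub: "?I v \<subseteq># ?M v" if "v \<in> verts U" for v using k(2) that by blast
    have eq: "?I v = ?J v" if v: "v \<in> verts U" for v
    proof -
      have "?I v \<subseteq># ?J v"
        unfolding subseteq_mset_def
      proof
        fix a
        show "count (?I v) a \<le> count (?J v) a"
        proof (cases "a = n")
          case True
          then show ?thesis using nI[of v] unfolding not_in_iff by simp
        next
          case False
          then show ?thesis using mset_subset_eq_count[OF sub[OF v], of a] by simp
        qed
      qed
      moreover have "?J v \<subseteq># ?I v"
        unfolding subseteq_mset_def
      proof
        fix a
        show "count (?J v) a \<le> count (?I v) a"
        proof (cases "a = n")
          case True
          then show ?thesis using nJ[of v] unfolding not_in_iff by simp
        next
          case False
          have "count (?M v - ?I v) a \<le> (\<Sum>v\<in>verts U. count (?M v - ?I v) a)"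
            using v finU by (intro member_le_sum) auto
          also have "\<dots> = count ?X a" unfolding sum[symmetric] by (simp add: count_sum)
          also have "\<dots> = 0" using False by simp
          finally show ?thesis using False by simp
        qed
      qed
      ultimately show ?thesis by (rule subset_mset.antisym)
    qed
    have "(\<Sum>v\<in>verts U. ?M v - ?I v) = (\<Sum>v\<in>verts U. {#n, n#})"
      by (intro sum.cong refl) (simp only: eq add_diff_cancel_right')
    then have "replicate_mset (2 * card (verts U)) n = ?X" using sum replicate[OF finU] by simp
    then have "card (verts U) = card (verts T)" by (metis size_replicate_mset mult_cancel1 zero_neq_numeral)
    with eq show "card (verts U) = card (verts T) \<and> (\<forall>v\<in>verts U. ?I v = ?J v)" by blast
  next
    assume eq: "card (verts U) = card (verts T) \<and> (\<forall>v\<in>verts U. ?I v = ?J v)"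
    have "(\<Sum>v\<in>verts U. ?M v - ?I v) = (\<Sum>v\<in>verts U. {#n, n#})"
      using eq by (intro sum.cong refl) (simp only: add_diff_cancel_right')
    then have "(\<Sum>v\<in>verts U. ?M v - ?I v) = ?X" using replicate[OF finU] eq by simp
    moreover have "k v \<noteq> 0" if "v \<in> verts U" for v using k(2)[OF that] eq that by simp
    ultimately show "?K \<noteq> 0" using finU by simp
  qed
  then show ?thesis using that[OF coeff] True by simp
qed

text \<open>The identity labelling contributes, and all contributions are natural numbers.\<close>

lemma coeff_tree_series_detector_nonzero:
  "mps_coeff (tree_series n (detector T n) T (rt T)) (replicate_mset (2 * card (verts T)) n) \<noteq> 0"
proof -
  let ?X = "replicate_mset (2 * card (verts T)) n"
  let ?L = "{l. l \<in> verts T \<rightarrow>\<^sub>E {1..n} \<and> l (rt T) = rt T}"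
  let ?l = "restrict id (verts T)"
  have "\<exists>k :: nat. mps_coeff (label_series (detector T n) T l) ?X = of_nat k" for l
    using label_series_detector[OF T, of l] by metis
  then obtain k :: "(nat \<Rightarrow> nat) \<Rightarrow> nat"
    where k: "\<And>l. mps_coeff (label_series (detector T n) T l) ?X = of_nat (k l)" by metis
  have fin: "finite ?L" by (rule finite_labelings[OF rooted_tree_basic(1)[OF T]])
  have "verts T \<subseteq> {1..n}" using n by auto
  then have l: "?l \<in> ?L" using rooted_tree_basic(2)[OF T] by auto
  have "image_mset ?l (mset_set (children T v)) = mset_set (children T v)" for v
  proof -
    have "image_mset ?l (mset_set (children T v)) = image_mset id (mset_set (children T v))"
      using children_subset[OF T, of v] finite_children[OF T, of v] by (intro image_mset_cong) auto
    then show ?thesis by simp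
  qed
  then have "k ?l \<noteq> 0"
    using label_series_detector[OF T, of ?l] k[of ?l]
    by (metis (no_types, lifting) id_apply image_restrict_eq of_nat_eq_iff restrict_apply' image_id order_refl)
  then have "\<not> (\<forall>l\<in>?L. k l = 0)" using bspec[OF _ l, of "\<lambda>l. k l = 0"] by argo
  then have "(\<Sum>l\<in>?L. k l) \<noteq> 0" unfolding sum_eq_0_iff[OF fin] .
  then have "of_nat (\<Sum>l\<in>?L. k l) \<noteq> (0 :: complex)" unfolding of_nat_eq_0_iff .
  then show ?thesis unfolding tree_series_def mps_coeff_sum k of_nat_sum .
qed

lemma coeff_tree_series_detector_zero:
  fixes U :: "nat rgraph"
  assumes U: "rooted_tree U" and "\<not> isomorphic U T"
  shows "mps_coeff (tree_series n (detector T n) U (rt T)) (replicate_mset (2 * card (verts T)) n) = 0"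
  unfolding tree_series_def mps_coeff_sum
proof (intro sum.neutral ballI)
  fix l assume "l \<in> {l. l \<in> verts U \<rightarrow>\<^sub>E {1..n} \<and> l (rt U) = rt T}"
  then have rt: "l (rt U) = rt T" by blast
  obtain k :: nat where k:
    "mps_coeff (label_series (detector T n) U l) (replicate_mset (2 * card (verts T)) n) = of_nat k"
    "k \<noteq> 0 \<longleftrightarrow> l ` verts U \<subseteq> verts T \<and> card (verts U) = card (verts T) \<and>
        (\<forall>v\<in>verts U. image_mset l (mset_set (children U v)) = mset_set (children T (l v)))"
    using label_series_detector[OF U] by metis
  have "k = 0"
  proof (rule ccontr)
    assume "k \<noteq> 0"
    with k(2) have l: "l ` verts U \<subseteq> verts T" "card (verts U) = card (verts T)"
      "\<And>v. v \<in> verts U \<Longrightarrow> image_mset l (mset_set (children U v)) = mset_set (children T (l v))" by auto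
    have "children T (l v) = l ` children U v" if "v \<in> verts U" for v
      using arg_cong[OF l(3)[OF that], of set_mset] by (simp add: finite_children U T)
    then have "isomorphic U T" by (rule isomorphic_if_children[OF U T l(2) rt l(1)])
    with assms(2) show False ..
  qed
  then show "mps_coeff (label_series (detector T n) U l) (replicate_mset (2 * card (verts T)) n) = 0"
    using k(1) by simp
qed

end

text \<open>Evaluated on the system that detects \<open>T\<close>, the two expansions have a common coefficient that is the
  same nonzero multiple of \<open>\<phi>\<^sub>T\<close> and of \<open>\<psi>\<^sub>T\<close>.\<close>

lemma represents_D_Log_unique:
  assumes "represents_D_Log \<phi>" "represents_D_Log \<psi>"
  shows "\<phi> = \<psi>"
proof
  fix t
  \<comment> \<open>The variables are numbered from \<open>1\<close>, whereas \<open>0\<close> may be a vertex of the representative.\<close>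
  define T where "T = map_graph Suc (rep_tree t)"
  have T: "rooted_tree T" unfolding T_def by (rule rooted_tree_map_graph[OF rep_tree(1)]) simp
  have cls: "tree_class T = t"
    using iso_invariant_tree_class[of id] rep_tree unfolding iso_invariant_def T_def by simp
  define n where "n = Suc (Max (verts T))"
  have n: "verts T \<subseteq> {1..<n}"
    using Max_ge[OF rooted_tree_basic(1)[OF T]] unfolding n_def by (auto simp: T_def less_Suc_eq_le)
  let ?H = "detector T n" and ?X = "replicate_mset (2 * card (verts T)) n"
  define N where "N = Suc (size ?X + tree_size t)"
  have H: "?H \<in> {1..n} \<rightarrow> higher n" by (rule detector_higher[OF T n])
  have i: "rt T \<in> {1..n}" "1 \<le> n" using n rooted_tree_basic(2)[OF T] by auto
  have zero: "mps_coeff (tree_P n ?H s (rt T)) ?X = 0" if "s \<noteq> t" for s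
  proof -
    have "\<not> isomorphic (rep_tree s) T"
      using that cls tree_class_eq_iff[OF rep_tree(1)[of s] T] rep_tree(2) by simp
    then show ?thesis
      using coeff_tree_series_detector_zero[OF T n rep_tree(1)] tree_P_tree_class[OF rep_tree(1), of n ?H s]
      by (simp add: normalized_tree_series_def rep_tree(2))
  qed
  have "card (aut T) \<noteq> 0" using card_labelled_copies[OF T] by (metis fact_nonzero mult_0_right)
  then have nonzero: "mps_coeff (tree_P n ?H t (rt T)) ?X \<noteq> 0"
    using coeff_tree_series_detector_nonzero[OF T n] tree_P_tree_class[OF T, of n ?H]
    by (simp add: normalized_tree_series_def cls)
  have sum: "mps_coeff (mps_sum (\<lambda>t. mps_const (of_rat (\<chi> t)) * tree_P n ?H t (rt T))) ?X
      = of_rat (\<chi> t) * mps_coeff (tree_P n ?H t (rt T)) ?X" for \<chi> :: "tree \<Rightarrow> rat"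
  proof -
    have "mps_coeff (mps_sum (\<lambda>t. mps_const (of_rat (\<chi> t)) * tree_P n ?H t (rt T))) ?X
        = (\<Sum>s | tree_size s < N. of_rat (\<chi> s) * mps_coeff (tree_P n ?H s (rt T)) ?X)"
      by (rule mps_coeff_sum_over_classes[OF H]) (simp add: N_def)
    also have "\<dots> = (\<Sum>s\<in>{t}. of_rat (\<chi> s) * mps_coeff (tree_P n ?H s (rt T)) ?X)"
      using zero by (intro sum.mono_neutral_right finite_tree_size_less) (auto simp: N_def)
    finally show ?thesis by simp
  qed
  have D: "D_Log n (\<lambda>j. mps_var j + ?H j) (rt T)
      = mps_sum (\<lambda>t. mps_const (of_rat (\<chi> t)) * tree_P n ?H t (rt T))"
    if "represents_D_Log \<chi>" for \<chi>
    using that[unfolded represents_D_Log_def, rule_format, OF i(2) H i(1)] .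
  have "mps_sum (\<lambda>t. mps_const (of_rat (\<phi> t)) * tree_P n ?H t (rt T))
      = mps_sum (\<lambda>t. mps_const (of_rat (\<psi> t)) * tree_P n ?H t (rt T))"
    unfolding D[OF assms(1), symmetric] by (rule D[OF assms(2)])
  then have "(of_rat (\<phi> t) :: complex) * mps_coeff (tree_P n ?H t (rt T)) ?X
      = of_rat (\<psi> t) * mps_coeff (tree_P n ?H t (rt T)) ?X"
    unfolding sum[symmetric] by simp
  then show "\<phi> t = \<psi> t" using nonzero by simp
qed

theorem theorem3p4:
  shows "(\<exists>!\<phi>. represents_D_Log \<phi>)
    \<and> (\<forall>\<phi>. represents_D_Log \<phi> \<longrightarrow> satisfies_recursion \<phi>)
    \<and> (\<exists>!\<phi>. satisfies_recursion \<phi>)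
    \<and> (\<forall>\<phi> :: tree \<Rightarrow> rat. \<forall>T :: nat rgraph. rooted_tree T \<and> 2 \<le> card (verts T) \<longrightarrow>
          (\<phi> (tree_class T) = - (\<Sum>k=2..card (verts T). cut_term \<phi> T k)
             \<longleftrightarrow> (\<Sum>k=1..card (verts T). cut_term \<phi> T k) = 0))"
proof (intro conjI allI impI)
  note rec = satisfies_recursion_recursive_coeff
  show "\<exists>!\<phi>. represents_D_Log \<phi>"
    using represents_D_Log_if_recursion[OF rec] represents_D_Log_unique by blast
  show "satisfies_recursion \<phi>" if "represents_D_Log \<phi>" for \<phi>
    using represents_D_Log_unique[OF that represents_D_Log_if_recursion[OF rec]] rec by simp
  show "\<exists>!\<phi>. satisfies_recursion \<phi>"
    using rec satisfies_recursion_unique by blast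
  show "\<phi> (tree_class T) = - (\<Sum>k=2..card (verts T). cut_term \<phi> T k)
      \<longleftrightarrow> (\<Sum>k=1..card (verts T). cut_term \<phi> T k) = 0"
    if "rooted_tree T \<and> 2 \<le> card (verts T)" for \<phi> and T :: "nat rgraph"
  proof -
    have "1 \<le> card (verts T)" using that by simp
    show ?thesis unfolding sum_cut_term_split[OF \<open>1 \<le> card (verts T)\<close>] by (rule eq_neg_iff_add_eq_0)
  qed
qed

end
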